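(* Assume the $abc$-conjecture for number fields. Then there exist infinitely many integers $k\neq 0$ such that, with $(a,d)=(4k,27k^4+1)$, the polynomial $f(x)=x^4+ax^3+d$ is monogenic and $\mathrm{Gal}(f)\simeq A_4$.
   Context: A monic polynomial $f(x)\in\mathbb{Z}[x]$ of degree 4 is called monogenic if $f(x)$ is irreducible over $\mathbb{Q}$ and, for $\theta$ with $f(\theta)=0$ and $K=\mathbb{Q}(\theta)$, the set $\{1,\theta,\theta^2,\theta^3\}$ is a $\mathbb{Z}$-basis of the ring of integers $\mathbb{Z}_K$ of $K$ (equivalently, $\mathbb{Z}_K=\mathbb{Z}[\theta]$). $\mathrm{Gal}(f)$ is the Galois group of $f$ over $\mathbb{Q}$, i.e. the Galois group over $\mathbb{Q}$ of the splitting field of $f$. $A_4$ is the alternating group of order 12. The $abc$-conjecture for number fields (standard form): for every number field $K$ and every $\varepsilon>0$ there is a constant $C_{K,\varepsilon}>0$ such that for all nonzero $\alpha,\beta,\gamma\in K$ with $\alpha+\beta+\gamma=0$ one has $$\prod_{v}\max(|\alpha|_v,|\beta|_v,|\gamma|_v)\le C_{K,\varepsilon}\Big(\prod_{\mathfrak p\in S}N(\mathfrak p)\Big)^{1+\varepsilon},$$ where $v$ runs over all places of $K$ with absolute values normalized so that the product formula holds ($|x|_{\mathfrak p}=N(\mathfrak p)^{-v_{\mathfrak p}(x)}$ for finite $\mathfrak p$, the usual absolute value at real places, and its square at complex places), $N(\mathfrak p)$ is the cardinality of the residue field at $\mathfrak p$, and $S$ is the set of prime ideals $\mathfrak p$ of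 the ring of integers of $K$ for which $v_{\mathfrak p}(\alpha),v_{\mathfrak p}(\beta),v_{\mathfrak p}(\gamma)$ are not all equal. For $K=\mathbb{Q}$ this is the usual $abc$-conjecture. *)

theory Defs
  imports
    Complex_Main
    "HOL-Computational_Algebra.Polynomial_Factorial"
    "HOL-Algebra.Ideal_Product"
    "HOL-Algebra.QuotRing"
    "HOL-Algebra.Bij"
    "HOL-Algebra.Embedded_Algebras"
    "HOL-Algebra.Generated_Fields"
    "HOL-Algebra.Sym_Groups"
begin

text \<open>
  Every number field embeds into the complex numbers, so number fields, splitting fields and
  the like are represented by subfields of the complex field. Statements about a number field
  are invariant under isomorphism, so nothing is lost by this.
\<close>

definition complex_ring :: "complex ring" where
  "complex_ring = \<lparr>carrier = UNIV, mult = (*), one = 1, zero = 0, add = (+)\<rparr>"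

definition number_field :: "complex set \<Rightarrow> bool" where
  "number_field K \<longleftrightarrow> subfield K complex_ring \<and> ring.finite_dimension complex_ring \<rat> K"

definition integers_of :: "complex set \<Rightarrow> complex set" where
  "integers_of K = {x \<in> K. algebraic_int x}"

definition integer_ring :: "complex set \<Rightarrow> complex ring" where
  "integer_ring K = complex_ring\<lparr>carrier := integers_of K\<rparr>"


subsection \<open>Places and their normalized absolute values\<close>

text \<open>The zero ideal is prime in the sense of \<^locale>\<open>primeideal\<close>, but it is not a place.\<close>

definition finite_primes :: "complex set \<Rightarrow> complex set set" where
  "finite_primes K = {P. primeideal P (integer_ring K) \<and> P \<noteq> {0}}"

definition prime_norm :: "complex set \<Rightarrow> complex set \<Rightarrow> nat" where
  "prime_norm K P = card (carrier (integer_ring K Quot P))"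

text \<open>The exponent of \<open>P\<close> in a nonzero integer \<open>a\<close> is the largest \<open>n\<close> with \<open>a \<in> P ^ n\<close>.\<close>

definition int_val :: "complex set \<Rightarrow> complex set \<Rightarrow> complex \<Rightarrow> nat" where
  "int_val K P a = (GREATEST n::nat. a \<in> P [^]\<^bsub>ideals_set (integer_ring K)\<^esub> n)"

text \<open>
  Every nonzero element of \<open>K\<close> is a quotient of nonzero integers, and the difference of the
  exponents does not depend on the chosen quotient. The value at 0 is irrelevant.
\<close>

definition val :: "complex set \<Rightarrow> complex set \<Rightarrow> complex \<Rightarrow> int" where
  "val K P x = (THE n. \<exists>a \<in> integers_of K - {0}. \<exists>b \<in> integers_of K - {0}.
     x = a / b \<and> n = int (int_val K P a) - int (int_val K P b))"

text \<open>Embeddings are extensional, so that distinct embeddings differ on \<open>K\<close>.\<close>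

definition embeddings :: "complex set \<Rightarrow> (complex \<Rightarrow> complex) set" where
  "embeddings K = ring_hom (complex_ring\<lparr>carrier := K\<rparr>) complex_ring \<inter> extensional K"

text \<open>
  An archimedean place is an embedding up to complex conjugation: \<open>{\<sigma>}\<close> for a real embedding
  \<open>\<sigma>\<close>, and the pair of \<open>\<sigma>\<close> and its conjugate otherwise.
\<close>

datatype place = Finite "complex set" | Archimedean "(complex \<Rightarrow> complex) set"

definition places :: "complex set \<Rightarrow> place set" where
  "places K = Finite ` finite_primes K \<union>
     (\<lambda>\<sigma>. Archimedean {\<sigma>, restrict (cnj \<circ> \<sigma>) K}) ` embeddings K"

fun place_abs :: "complex set \<Rightarrow> place \<Rightarrow> complex \<Rightarrow> real" where
  "place_abs K (Finite P) x = (if x = 0 then 0 else real (prime_norm K P) powi (- val K P x))"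
| "place_abs K (Archimedean V) x =
     (let \<sigma> = (SOME \<sigma>. \<sigma> \<in> V) in if \<sigma> ` K \<subseteq> \<real> then cmod (\<sigma> x) else (cmod (\<sigma> x))\<^sup>2)"


subsection \<open>The abc-conjecture for number fields\<close>

definition abc_primes :: "complex set \<Rightarrow> complex \<Rightarrow> complex \<Rightarrow> complex \<Rightarrow> complex set set" where
  "abc_primes K \<alpha> \<beta> \<gamma> =
     {P \<in> finite_primes K. \<not> (val K P \<alpha> = val K P \<beta> \<and> val K P \<beta> = val K P \<gamma>)}"

text \<open>
  The product over all places has only finitely many factors different from 1;
  \<^const>\<open>prod'\<close> is the product over these factors.
\<close>

definition abc_height :: "complex set \<Rightarrow> complex \<Rightarrow> complex \<Rightarrow> complex \<Rightarrow> real" where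
  "abc_height K \<alpha> \<beta> \<gamma> =
     prod' (\<lambda>v. max (place_abs K v \<alpha>) (max (place_abs K v \<beta>) (place_abs K v \<gamma>))) (places K)"

definition abc_conjecture_number_fields :: bool where
  "abc_conjecture_number_fields \<longleftrightarrow>
     (\<forall>K. number_field K \<longrightarrow> (\<forall>\<epsilon>::real. \<epsilon> > 0 \<longrightarrow> (\<exists>C::real. C > 0 \<and>
       (\<forall>\<alpha> \<in> K - {0}. \<forall>\<beta> \<in> K - {0}. \<forall>\<gamma> \<in> K - {0}. \<alpha> + \<beta> + \<gamma> = 0 \<longrightarrow>
          abc_height K \<alpha> \<beta> \<gamma>
            \<le> C * real (\<Prod>P \<in> abc_primes K \<alpha> \<beta> \<gamma>. prime_norm K P) powr (1 + \<epsilon>)))))"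


subsection \<open>Monogenic quartic polynomials and Galois groups\<close>

definition complex_roots :: "int poly \<Rightarrow> complex set" where
  "complex_roots f = {z. poly (map_poly of_int f) z = 0}"

abbreviation int_scale :: "int \<Rightarrow> complex \<Rightarrow> complex" where
  "int_scale \<equiv> (\<lambda>n z. of_int n * z)"

definition is_int_basis :: "complex set \<Rightarrow> complex set \<Rightarrow> bool" where
  "is_int_basis B M \<longleftrightarrow>
     \<not> Modules.module.dependent int_scale B \<and> Modules.module.span int_scale B = M"

definition monogenic_quartic :: "int poly \<Rightarrow> bool" where
  "monogenic_quartic f \<longleftrightarrow>
     Polynomial.degree f = 4 \<and> Polynomial.lead_coeff f = 1 \<and>
     Factorial_Ring.irreducible (map_poly of_int f :: rat poly) \<and>
     (\<forall>\<theta> \<in> complex_roots f.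
        is_int_basis {1, \<theta>, \<theta>\<^sup>2, \<theta> ^ 3}
          (integers_of (generate_field complex_ring (\<rat> \<union> {\<theta>}))))"

definition splitting_field :: "int poly \<Rightarrow> complex set" where
  "splitting_field f = generate_field complex_ring (\<rat> \<union> complex_roots f)"

definition galois_group :: "int poly \<Rightarrow> (complex \<Rightarrow> complex) monoid" where
  "galois_group f = (let L = splitting_field f; R = complex_ring\<lparr>carrier := L\<rparr> in
     (BijGroup L)\<lparr>carrier := {\<sigma> \<in> Bij L. \<sigma> \<in> ring_hom R R \<and> (\<forall>q \<in> \<rat>. \<sigma> q = q)}\<rparr>)"

end

theory Submission
  imports
    Defs
    "Jordan_Normal_Form.Char_Poly"
    "HOL-Computational_Algebra.Squarefree"
    "HOL-Computational_Algebra.Field_as_Ring"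
begin

text \<open>
  Write \<open>d(k) = 27 k\<^sup>4 + 1\<close>. The polynomial \<open>x\<^sup>4 + 4 k x\<^sup>3 + d(k)\<close> has the square discriminant
  \<open>(16 d(k))\<^sup>2\<close>. If \<open>k \<noteq> 0\<close> is even and \<open>d(k)\<close> is squarefree, then it is Eisenstein at 2 after the shift
  \<open>x \<mapsto> x + 1\<close>, it is maximal at every prime dividing \<open>d(k)\<close>, and its cubic resolvent
  \<open>y\<^sup>3 - 4 d y - 16 k\<^sup>2 d\<close> has no rational root. Hence it is monogenic with group \<open>A\<^sub>4\<close>.

  For the squarefree values only the abc-conjecture over the rational numbers is needed. Applied to
  an identity \<open>432 k\<^sup>4 (16 d(k))\<^sup>1\<^sup>5 + 15\<^sup>1\<^sup>5 = d(2 k)\<^sup>2 G\<close>, it bounds the product of the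
  square factors of \<open>d(k)\<close> and \<open>d(2 k)\<close> by \<open>k\<^sup>1\<^sup>+\<^sup>\<epsilon>\<close>, so that at most one of them is
  divisible by the square of a prime larger than \<open>k\<^sup>3\<^sup>/\<^sup>5\<close>. Squares of smaller primes are excluded by
  counting residue classes among the multiples of \<open>20!\<close>.
\<close>

section \<open>The abc-conjecture over the rational numbers\<close>

text \<open>For \<open>27 k^4 + 1\<close> alone, abc only bounds a prime whose square divides it by
  k^(1+eps), and an interval of length comparable to k is too short to sieve by that many primes.
  For a pair of values the same power of k bounds the product of two such primes, so the smaller one
  is at most about k^(1/2), within reach of the sieve. Any cutoff exponent strictly between 1/2 and
  1 would do. Passing from k to 2 k is harmless, so it is enough that one value of the pair is
  squarefree.

  The shape of d comes from the derivative 4 x^2 (x + 3 k) of the quartic: d is chosen so that the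
  value at -3 k is 1.

  The arithmetic stays elementary: elements are rational polynomials in a root, conjugation
  evaluates the same polynomial at another root, and norms are products of four values. In the
  Galois group the square discriminant allows only even permutations. The irrational resolvent roots
  keep a second root out of the field of the first, over which it then has degree 3; so the twelve
  ordered pairs of distinct roots give twelve automorphisms.\<close>

lemma complex_ring_simps [simp]:
  "carrier complex_ring = UNIV" "x \<otimes>\<^bsub>complex_ring\<^esub> y = x * y" "x \<oplus>\<^bsub>complex_ring\<^esub> y = x + y"
  "\<one>\<^bsub>complex_ring\<^esub> = 1" "\<zero>\<^bsub>complex_ring\<^esub> = 0"
  by (simp_all add: complex_ring_def)

lemma field_complex_ring: "Ring.field complex_ring"
proof (rule cring.cring_fieldI2)
  show "cring complex_ring"
  proof (rule cringI)
    show "abelian_group complex_ring"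
      by (rule abelian_groupI) (auto simp: algebra_simps intro: exI[of _ "- x" for x] add.right_inverse)
    show "Group.comm_monoid complex_ring"
      by (rule comm_monoidI) (auto simp: algebra_simps)
  qed (auto simp: algebra_simps)
  show "\<exists>b\<in>carrier complex_ring. a \<otimes>\<^bsub>complex_ring\<^esub> b = \<one>\<^bsub>complex_ring\<^esub>"
    if "a \<noteq> \<zero>\<^bsub>complex_ring\<^esub>" for a
    using that by (intro bexI[of _ "inverse a"]) auto
qed auto

interpretation complex_ring: cring complex_ring
  using field_complex_ring by (simp add: Ring.field_def Ring.domain_def)

lemma complex_ring_minus [simp]: "\<ominus>\<^bsub>complex_ring\<^esub> x = - x"
  by (rule complex_ring.minus_equality) auto

lemma complex_ring_inv: "x \<noteq> 0 \<Longrightarrow> inv\<^bsub>complex_ring\<^esub> x = inverse x"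
  by (rule complex_ring.comm_inv_char) auto

lemma subfield_complex_ringI:
  assumes "1 \<in> K" "\<And>x y. x \<in> K \<Longrightarrow> y \<in> K \<Longrightarrow> x + y \<in> K" "\<And>x. x \<in> K \<Longrightarrow> - x \<in> K"
    "\<And>x y. x \<in> K \<Longrightarrow> y \<in> K \<Longrightarrow> x * y \<in> K" "\<And>x. x \<in> K \<Longrightarrow> x \<noteq> 0 \<Longrightarrow> inverse x \<in> K"
  shows "subfield K complex_ring"
proof (rule field.subfieldI'[OF field_complex_ring])
  show "subring K complex_ring" by (rule complex_ring.subringI) (use assms in auto)
qed (use assms in \<open>auto simp: complex_ring_inv\<close>)

lemma subfield_Rats: "subfield \<rat> complex_ring"
  by (rule subfield_complex_ringI) auto

lemma number_field_Rats: "number_field \<rat>"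
  unfolding number_field_def complex_ring.finite_dimension_def
  using complex_ring.dimension_one[OF subfield_Rats] subfield_Rats by blast

lemma integers_of_Rats: "integers_of \<rat> = \<int>"
  unfolding integers_of_def using rational_algebraic_int_is_int
  by (auto intro: int_imp_algebraic_int Ints_subset_Rats[THEN subsetD])

section \<open>The integers as a ring of integers: prime ideals, valuations, norms\<close>

abbreviation Z_ring :: "complex ring" where "Z_ring \<equiv> integer_ring \<rat>"

lemma Z_ring_simps [simp]:
  "carrier Z_ring = \<int>" "x \<otimes>\<^bsub>Z_ring\<^esub> y = x * y" "x \<oplus>\<^bsub>Z_ring\<^esub> y = x + y"
  "\<one>\<^bsub>Z_ring\<^esub> = 1" "\<zero>\<^bsub>Z_ring\<^esub> = 0"
  by (simp_all add: integer_ring_def integers_of_Rats)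

lemma cring_Z_ring: "cring Z_ring"
proof -
  have "subcring \<int> complex_ring"
    by (rule complex_ring.subcringI') (rule complex_ring.subringI, auto)
  then show ?thesis
    using complex_ring.subcring_iff[of \<int>] by (simp add: integer_ring_def integers_of_Rats)
qed

interpretation Z_ring: cring Z_ring
  by (rule cring_Z_ring)

definition multiples :: "nat \<Rightarrow> complex set" where
  "multiples q = range (\<lambda>z :: int. of_int (int q * z))"

lemma of_int_in_multiples: "of_int n \<in> multiples q \<longleftrightarrow> int q dvd n"
  unfolding multiples_def by (auto simp: dvd_def simp flip: of_int_mult)

lemma multiples_subset: "multiples q \<subseteq> \<int>"
  by (auto simp: multiples_def)

text \<open>A nonzero prime ideal contains a positive integer and hence one of its prime factors
  \<open>p\<close>. An element not divisible by \<open>p\<close> would put 1 into the ideal by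
  Bezout.\<close>

lemma finite_primes_Rats:
  assumes "P \<in> finite_primes \<rat>"
  obtains p :: nat where "Factorial_Ring.prime p" "P = multiples p"
proof -
  have prime: "primeideal P Z_ring" and nz: "P \<noteq> {0}"
    using assms by (auto simp: finite_primes_def)
  interpret primeideal P Z_ring by (rule prime)
  have add: "a + b \<in> P" if "a \<in> P" "b \<in> P" for a b using a_closed that by simp
  have mult: "of_int n * a \<in> P" if "a \<in> P" for a n using I_l_closed[of a "of_int n"] that by simp
  have sub: "P \<subseteq> \<int>" using a_subset by simp
  have one: "1 \<notin> P"
  proof
    assume "1 \<in> P"
    then have "\<int> \<subseteq> P" using mult[of 1] by (auto elim!: Ints_cases)
    then show False using I_notcarr sub by auto
  qed
  have split: "of_int a \<in> P \<or> of_int b \<in> P" if "of_int (a * b) \<in> P" for a b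
    using I_prime[of "of_int a" "of_int b"] that by simp
  obtain a where a: "a \<in> P" "a \<noteq> 0" using nz zero_closed by auto
  obtain n where n: "a = of_int n" using a sub by (auto elim!: Ints_cases)
  have "of_int (\<bar>n\<bar>) \<in> P" using mult[OF a(1), of "sgn n"] n by (simp add: abs_sgn mult.commute flip: of_int_mult)
  then have m: "of_nat (nat \<bar>n\<bar>) \<in> P" by simp
  have nat_prime: "of_nat m \<in> P \<Longrightarrow> m > 0 \<Longrightarrow> \<exists>p::nat. Factorial_Ring.prime p \<and> of_nat p \<in> P" for m :: nat
  proof (induction m rule: less_induct)
    case (less m)
    then have "m \<noteq> 1" using one by auto
    then obtain p where p: "Factorial_Ring.prime p" "p dvd m" using prime_factor_nat by blast
    then obtain k where k: "m = p * k" by (auto simp: dvd_def)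
    have "of_int (int p * int k) \<in> P" using less k by simp
    then consider "of_nat p \<in> P" | "of_nat k \<in> P" using split[of "int p" "int k"] by auto
    then show ?case
    proof cases
      case 2
      moreover have "0 < k" "k < m" using k less.prems p prime_gt_1_nat[of p] by auto
      ultimately show ?thesis using less.IH by blast
    qed (use p in blast)
  qed
  obtain p :: nat where p: "Factorial_Ring.prime p" "of_nat p \<in> P" using nat_prime[OF m] a n by auto
  have "P = multiples p"
  proof
    show "multiples p \<subseteq> P" using mult[OF p(2)] by (auto simp: multiples_def mult.commute)
    show "P \<subseteq> multiples p"
    proof
      fix x assume x: "x \<in> P"
      obtain k where k: "x = of_int k" using x sub by (auto elim!: Ints_cases)
      have "int p dvd k"
      proof (rule ccontr)
        assume "\<not> int p dvd k"
        then have "Rings.coprime (int p) k" using p by (intro prime_imp_coprime) auto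
        then obtain u v where "u * int p + v * k = 1"
          using bezout_int[of "int p" k] by auto
        then have "(1::complex) = of_int (u * int p + v * k)" by simp
        also have "\<dots> = of_int u * of_nat p + of_int v * x" by (simp add: k)
        also have "\<dots> \<in> P" using add mult p x by blast
        finally show False using one by simp
      qed
      then show "x \<in> multiples p" by (simp add: k of_int_in_multiples)
    qed
  qed
  with p that show ?thesis by blast
qed

lemma multiples_ideal: "ideal (multiples q) Z_ring"
proof (rule idealI)
  show "Ring.ring Z_ring" by (rule Z_ring.ring_axioms)
  show "subgroup (multiples q) (add_monoid Z_ring)"
  proof (rule subgroup.intro)
    show "multiples q \<subseteq> carrier (add_monoid Z_ring)" using multiples_subset by simp
    show "x \<otimes>\<^bsub>add_monoid Z_ring\<^esub> y \<in> multiples q" if "x \<in> multiples q" "y \<in> multiples q" for x y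
      using that by (auto simp: multiples_def simp flip: of_int_add distrib_left)
    show "\<one>\<^bsub>add_monoid Z_ring\<^esub> \<in> multiples q"
      using of_int_in_multiples[of 0 q] by simp
    show "inv\<^bsub>add_monoid Z_ring\<^esub> x \<in> multiples q" if "x \<in> multiples q" for x
    proof -
      obtain n where n: "x = of_int (int q * n)" using \<open>x \<in> multiples q\<close> by (auto simp: multiples_def)
      have "\<ominus>\<^bsub>Z_ring\<^esub> x = - x" by (rule Z_ring.minus_equality) (auto simp: n)
      also have "\<dots> = of_int (int q * (- n))" by (simp add: n)
      finally show ?thesis by (simp only: of_int_in_multiples dvd_triv_left flip: a_inv_def)
    qed
  qed
  fix a x assume "a \<in> multiples q" "x \<in> carrier Z_ring"
  then obtain m n where "x = of_int m" "a = of_int (int q * n)"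
    by (auto simp: multiples_def elim!: Ints_cases)
  then have "x \<otimes>\<^bsub>Z_ring\<^esub> a = of_int (int q * (m * n))" "a \<otimes>\<^bsub>Z_ring\<^esub> x = of_int (int q * (m * n))"
    by (simp_all add: mult_ac)
  then show "x \<otimes>\<^bsub>Z_ring\<^esub> a \<in> multiples q" "a \<otimes>\<^bsub>Z_ring\<^esub> x \<in> multiples q"
    by (simp_all only: of_int_in_multiples dvd_triv_left)
qed

lemma multiples_prod: "multiples a \<cdot>\<^bsub>Z_ring\<^esub> multiples b = multiples (a * b)"
proof
  show "multiples a \<cdot>\<^bsub>Z_ring\<^esub> multiples b \<subseteq> multiples (a * b)"
  proof
    fix x assume "x \<in> multiples a \<cdot>\<^bsub>Z_ring\<^esub> multiples b"
    then show "x \<in> multiples (a * b)"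
    proof induction
      case (prod i j)
      then obtain m n where "i = of_int (int a * m)" "j = of_int (int b * n)" by (auto simp: multiples_def)
      then have "i \<otimes>\<^bsub>Z_ring\<^esub> j = of_int (int (a * b) * (m * n))" by (simp add: mult_ac)
      then show ?case by (simp only: of_int_in_multiples dvd_triv_left)
    next
      case (sum s t)
      then show ?case using ideal.axioms(1)[OF multiples_ideal, THEN additive_subgroup.a_closed] by blast
    qed
  qed
  show "multiples (a * b) \<subseteq> multiples a \<cdot>\<^bsub>Z_ring\<^esub> multiples b"
  proof
    fix x assume "x \<in> multiples (a * b)"
    then obtain n where n: "x = of_int (int (a * b) * n)" by (auto simp: multiples_def)
    have "of_int (int a) \<in> multiples a" "of_int (int b * n) \<in> multiples b"
      by (simp_all only: of_int_in_multiples dvd_triv_left dvd_refl)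
    from ideal_prod.prod[OF this, of Z_ring] show "x \<in> multiples a \<cdot>\<^bsub>Z_ring\<^esub> multiples b"
      by (simp add: n mult_ac)
  qed
qed

lemma multiples_power: "multiples p [^]\<^bsub>ideals_set Z_ring\<^esub> n = multiples (p ^ n)" for n :: nat
proof (induction n)
  case 0
  have "\<int> = multiples 1" by (auto simp: multiples_def elim!: Ints_cases)
  then show ?case by (simp add: nat_pow_def ideals_set_def)
next
  case (Suc n)
  then show ?case using multiples_prod[of "p ^ n" p]
    by (simp add: nat_pow_def ideals_set_def mult.commute)
qed

text \<open>Powers of the ideal of multiples of \<open>p\<close> are the multiples of p^n, which
  turns the greatest exponent into a multiplicity. Additivity of multiplicities makes the difference
  independent of the chosen quotient.\<close>

lemma val_Rats:
  assumes p: "Factorial_Ring.prime p" and n: "n \<noteq> 0"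
  shows "val \<rat> (multiples p) (of_int n) = int (multiplicity (int p) n)"
proof -
  have p': "\<not> is_unit (int p)" "Factorial_Ring.prime_elem (int p)" using p by auto
  have iv: "int_val \<rat> (multiples p) (of_int m) = multiplicity (int p) m" if "m \<noteq> 0" for m
    unfolding int_val_def multiples_power of_int_in_multiples of_nat_power
    by (rule Greatest_equality)
       (use that p' in \<open>auto simp: multiplicity_dvd power_dvd_iff_le_multiplicity\<close>)
  show ?thesis unfolding val_def integers_of_Rats
  proof (rule the_equality)
    show "\<exists>a\<in>\<int> - {0}. \<exists>b\<in>\<int> - {0}. of_int n = a / b \<and>
        int (multiplicity (int p) n) = int (int_val \<rat> (multiples p) a) - int (int_val \<rat> (multiples p) b)"
      using iv[OF n] iv[of 1] n by (intro bexI[of _ "of_int n"] bexI[of _ 1]) auto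
    fix m assume "\<exists>a\<in>\<int> - {0}. \<exists>b\<in>\<int> - {0}. of_int n = a / b \<and>
        m = int (int_val \<rat> (multiples p) a) - int (int_val \<rat> (multiples p) b)"
    then obtain a b where ab: "a \<noteq> 0" "b \<noteq> 0" "(of_int n :: complex) = of_int a / of_int b"
      "m = int (int_val \<rat> (multiples p) (of_int a)) - int (int_val \<rat> (multiples p) (of_int b))"
      by (auto elim!: Ints_cases)
    then have "(of_int a :: complex) = of_int (n * b)" by (simp add: field_simps)
    then have "a = n * b" using of_int_eq_iff by blast
    then show "m = int (multiplicity (int p) n)"
      using ab n iv[of a] iv[of b] prime_elem_multiplicity_mult_distrib[OF p'(2) n, of b] by simp
  qed
qed

text \<open>The upper bound leads to the radical. The lower bound makes finite absolute values of
  integers at most 1 and lets further primes be added to a product of norms.\<close>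

lemma prime_norm_Rats:
  assumes "p > 0"
  shows "1 \<le> prime_norm \<rat> (multiples p)" "prime_norm \<rat> (multiples p) \<le> p"
proof -
  interpret I: ideal "multiples p" Z_ring by (rule multiples_ideal)
  let ?C = "(\<lambda>r. multiples p +>\<^bsub>Z_ring\<^esub> of_nat r) ` {..<p}"
  have car: "carrier (Z_ring Quot multiples p) = (\<lambda>x. multiples p +>\<^bsub>Z_ring\<^esub> x) ` \<int>"
    by (auto simp: FactRing_def A_RCOSETS_def' )
  have "multiples p +>\<^bsub>Z_ring\<^esub> x \<in> ?C" if x: "x \<in> \<int>" for x
  proof -
    obtain n where n: "x = of_int n" using x by (auto elim!: Ints_cases)
    define r where "r = nat (n mod int p)"
    have r: "r < p" "int r = n mod int p" using assms by (auto simp: r_def nat_less_iff)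
    have "int p dvd n - int r" using r by (simp add: mod_eq_dvd_iff[symmetric])
    then obtain q where q: "n = int r + int p * q" by (auto simp: dvd_def algebra_simps)
    have "of_int (int p * q) \<in> multiples p" by (simp only: of_int_in_multiples dvd_triv_left)
    then have "x \<in> multiples p +>\<^bsub>Z_ring\<^esub> of_nat r"
      unfolding a_r_coset_def' by (auto simp: n q intro!: bexI[of _ "of_int (int p * q)"])
    then have "multiples p +>\<^bsub>Z_ring\<^esub> x = multiples p +>\<^bsub>Z_ring\<^esub> of_nat r"
      using I.a_repr_independence' by (metis Ints_of_nat Z_ring_simps(1))
    then show ?thesis using r by auto
  qed
  then have sub: "carrier (Z_ring Quot multiples p) \<subseteq> ?C" using car by auto
  have "card (carrier (Z_ring Quot multiples p)) \<le> card ?C" by (rule card_mono) (use sub in auto)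
  also have "\<dots> \<le> p" using card_image_le[of "{..<p}"] by simp
  finally show "prime_norm \<rat> (multiples p) \<le> p" by (simp add: prime_norm_def)
  have "finite (carrier (Z_ring Quot multiples p))" using sub finite_subset by blast
  moreover have "carrier (Z_ring Quot multiples p) \<noteq> {}" using car by auto
  ultimately show "1 \<le> prime_norm \<rat> (multiples p)"
    unfolding prime_norm_def by (simp add: Suc_le_eq card_gt_0_iff)
qed

section \<open>Places of the rationals, height and radical\<close>

lemma embedding_Rats:
  assumes "\<sigma> \<in> embeddings \<rat>"
  shows "\<sigma> = restrict (\<lambda>x. x) \<rat>"
proof
  have hom: "\<sigma> \<in> Ring.ring_hom (complex_ring\<lparr>carrier := \<rat>\<rparr>) complex_ring" and ext: "\<sigma> \<in> extensional \<rat>"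
    using assms by (auto simp: embeddings_def)
  have add: "\<sigma> (x + y) = \<sigma> x + \<sigma> y" and mult: "\<sigma> (x * y) = \<sigma> x * \<sigma> y"
    if "x \<in> \<rat>" "y \<in> \<rat>" for x y
    using ring_hom_add[OF hom, of x y] ring_hom_mult[OF hom, of x y] that by auto
  have one: "\<sigma> 1 = 1" using ring_hom_one[OF hom] by simp
  have zero: "\<sigma> 0 = 0" using add[of 0 0] by simp
  have minus: "\<sigma> (- x) = - \<sigma> x" if "x \<in> \<rat>" for x
    using add[of x "- x"] that zero by (simp add: eq_neg_iff_add_eq_0 add.commute)
  have nat: "\<sigma> (of_nat n) = of_nat n" for n by (induction n) (auto simp: zero one add)
  have int: "\<sigma> (of_int n) = of_int n" for n
  proof (cases n rule: int_cases2)
    case (nonneg m)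
    then show ?thesis using nat by simp
  next
    case (nonpos m)
    then show ?thesis using nat minus[of "of_nat m"] by simp
  qed
  fix x
  show "\<sigma> x = restrict (\<lambda>x. x) \<rat> x"
  proof (cases "x \<in> \<rat>")
    case True
    then obtain a b where ab: "b > 0" "x = of_int a / of_int b" by (auto elim: Rats_cases')
    then have "of_int b * \<sigma> x = \<sigma> (of_int b * x)" using mult[of "of_int b" x] True int by simp
    also have "of_int b * x = of_int a" using ab by simp
    finally have "of_int b * \<sigma> x = of_int b * x" using ab int by simp
    moreover have "of_int b \<noteq> (0 :: complex)" using ab(1) by simp
    ultimately have "\<sigma> x = x" using mult_left_cancel by blast
    then show ?thesis using True by simp
  qed (use ext in \<open>auto simp: extensional_def\<close>)
qed

abbreviation real_place :: place where
  "real_place \<equiv> Archimedean {restrict (\<lambda>x. x) \<rat>}"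

text \<open>Conjugation fixes the rationals, so the pair in \<open>Archimedean\<close> is a
  singleton and the choice in \<open>place_abs\<close> is forced.\<close>

lemma places_Rats: "places \<rat> = Finite ` finite_primes \<rat> \<union> {real_place}"
proof -
  have "restrict (\<lambda>x. x) \<rat> \<in> embeddings \<rat>"
    unfolding embeddings_def by (auto intro!: ring_hom_memI)
  then have "embeddings \<rat> = {restrict (\<lambda>x. x) \<rat>}" using embedding_Rats by blast
  moreover have "restrict (cnj \<circ> restrict (\<lambda>x. x) \<rat>) \<rat> = restrict (\<lambda>x. x) (\<rat> :: complex set)"
    by (rule ext) (auto simp: restrict_def elim!: Rats_cases')
  ultimately show ?thesis unfolding places_def by simp
qed

lemma place_abs_real_place:
  assumes "x \<in> \<rat>" shows "place_abs \<rat> real_place x = cmod x"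
proof -
  have "restrict (\<lambda>x. x) \<rat> ` \<rat> \<subseteq> (\<real> :: complex set)"
    by (auto simp: Rats_def of_rat_def elim!: Rats_cases')
  then show ?thesis using assms by (simp add: Let_def)
qed

definition radical :: "nat \<Rightarrow> nat" where
  "radical n = \<Prod> (Factorial_Ring.prime_factors n)"

text \<open>For coprime integers every finite place contributes the factor 1 to the height.\<close>

lemma abc_height_Rats:
  assumes nz: "a \<noteq> 0" "b \<noteq> 0" "c \<noteq> 0" and cop: "Rings.coprime a b"
  shows "abc_height \<rat> (of_int a) (of_int b) (of_int c)
    = max \<bar>real_of_int a\<bar> (max \<bar>real_of_int b\<bar> \<bar>real_of_int c\<bar>)"
proof -
  define f where "f v = max (place_abs \<rat> v (of_int a))
    (max (place_abs \<rat> v (of_int b)) (place_abs \<rat> v (of_int c)))" for v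
  have fin: "f (Finite P) = 1" if "P \<in> finite_primes \<rat>" for P
  proof -
    obtain p where p: "Factorial_Ring.prime p" "P = multiples p"
      using finite_primes_Rats[OF \<open>P \<in> finite_primes \<rat>\<close>] by metis
    define N where "N = real (prime_norm \<rat> P)"
    have N: "N \<ge> 1" using prime_norm_Rats(1)[of p] p prime_gt_0_nat by (simp add: N_def)
    have pa: "place_abs \<rat> (Finite P) (of_int m) = inverse (N ^ multiplicity (int p) m)"
      if "m \<noteq> 0" for m
      using val_Rats[OF p(1) that] that p(2)
      by (simp add: N_def power_int_minus flip: power_int_of_nat)
    have le: "inverse (N ^ k) \<le> 1" for k using N by (simp add: inverse_le_1_iff)
    \<comment> \<open>So one of the first two absolute values is 1, while all three are at most
      1.\<close>
    have "\<not> int p dvd a \<or> \<not> int p dvd b"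
      using coprime_common_divisor[OF cop, of "int p"] prime_gt_1_nat[OF p(1)] by auto
    then have "multiplicity (int p) a = 0 \<or> multiplicity (int p) b = 0"
      by (elim disjE) (simp_all add: not_dvd_imp_multiplicity_0)
    then show ?thesis unfolding f_def pa[OF nz(1)] pa[OF nz(2)] pa[OF nz(3)]
      using le[of "multiplicity (int p) a"] le[of "multiplicity (int p) b"] le[of "multiplicity (int p) c"]
      by auto
  qed
  have f_real: "f real_place = max \<bar>real_of_int a\<bar> (max \<bar>real_of_int b\<bar> \<bar>real_of_int c\<bar>)"
    unfolding f_def by (simp only: place_abs_real_place Rats_of_int norm_of_int)
  \<comment> \<open>\<open>prod'\<close> multiplies the factors different from 1. At most one place
    is left, and if its factor is 1 as well, the empty product still equals it.\<close>
  have "{v \<in> places \<rat>. f v \<noteq> 1} = (if f real_place = 1 then {} else {real_place})"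
    unfolding places_Rats using fin by auto
  then have "abc_height \<rat> (of_int a) (of_int b) (of_int c) = f real_place"
    unfolding abc_height_def f_def[symmetric] by (simp add: prod.G_def)
  then show ?thesis by (simp only: f_real)
qed

text \<open>At a prime dividing none of the three numbers all valuations are 0. Prime factors
  outside \<open>abc_primes\<close> have norm at least 1, hence the inequality.\<close>

lemma abc_primes_Rats:
  assumes nz: "a > 0" "b > 0"
  shows "(\<Prod>P\<in>abc_primes \<rat> (of_nat a) (of_nat b) (- of_nat (a + b)). prime_norm \<rat> P)
    \<le> radical (a * b * (a + b))"
proof -
  let ?S = "Factorial_Ring.prime_factors (a * b * (a + b))"
  let ?A = "abc_primes \<rat> (of_nat a) (of_nat b) (- of_nat (a + b))"
  have inj: "inj_on multiples ?S"
  proof (rule inj_onI)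
    fix p q assume "p \<in> ?S" "q \<in> ?S" and eq: "multiples p = multiples q"
    then have "of_int (int p) \<in> multiples q" using of_int_in_multiples[of "int p" p] by simp
    then show "p = q" using \<open>p \<in> ?S\<close> \<open>q \<in> ?S\<close>
      by (simp only: of_int_in_multiples int_dvd_int_iff) (metis in_prime_factors_imp_prime primes_dvd_imp_eq)
  qed
  have sub: "?A \<subseteq> multiples ` ?S"
  proof
    fix P assume P: "P \<in> ?A"
    then obtain p where p: "Factorial_Ring.prime p" "P = multiples p"
      using finite_primes_Rats[of P] unfolding abc_primes_def by blast
    have "p dvd a * b * (a + b)"
    proof (rule ccontr)
      assume "\<not> p dvd a * b * (a + b)"
      then have "\<not> int p dvd int a" "\<not> int p dvd int b" "\<not> int p dvd - int (a + b)"
        using int_dvd_int_iff by (auto simp del: of_nat_add)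
      then have "multiplicity (int p) (int a) = 0" "multiplicity (int p) (int b) = 0"
        "multiplicity (int p) (- int (a + b)) = 0" by - (rule not_dvd_imp_multiplicity_0, assumption)+
      then have "val \<rat> P (of_nat a) = 0" "val \<rat> P (of_nat b) = 0" "val \<rat> P (- of_nat (a + b)) = 0"
        using val_Rats[OF p(1), of "int a"] val_Rats[OF p(1), of "int b"]
          val_Rats[OF p(1), of "- int (a + b)"] nz p(2) by simp_all
      then show False using P unfolding abc_primes_def by simp
    qed
    then have "p \<in> ?S" using p nz by (simp add: in_prime_factors_iff)
    then show "P \<in> multiples ` ?S" using p by blast
  qed
  have pos: "p > 0" if "p \<in> ?S" for p using that prime_gt_0_nat by (auto simp: in_prime_factors_iff)
  have "(\<Prod>P\<in>?A. prime_norm \<rat> P) \<le> (\<Prod>P\<in>multiples ` ?S. prime_norm \<rat> P)"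
  proof -
    have "1 \<le> (\<Prod>P\<in>multiples ` ?S - ?A. prime_norm \<rat> P)"
      by (rule prod_ge_1) (use prime_norm_Rats(1) pos in auto)
    then show ?thesis using prod.subset_diff[OF sub, of "prime_norm \<rat>"] by simp
  qed
  also have "\<dots> = (\<Prod>p\<in>?S. prime_norm \<rat> (multiples p))" using inj by (simp add: prod.reindex)
  also have "\<dots> \<le> \<Prod> ?S" by (rule prod_mono) (use prime_norm_Rats pos in auto)
  finally show ?thesis by (simp add: radical_def)
qed

lemma abc_for_naturals:
  assumes "abc_conjecture_number_fields" and "\<epsilon> > 0"
  obtains C :: real where "C > 0"
    "\<And>a b. a > 0 \<Longrightarrow> b > 0 \<Longrightarrow> Rings.coprime a b \<Longrightarrow>
      real (a + b) \<le> C * real (radical (a * b * (a + b))) powr (1 + \<epsilon>)"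
proof -
  obtain C :: real where C: "C > 0" "\<And>\<alpha> \<beta> \<gamma>. \<alpha> \<in> \<rat> - {0} \<Longrightarrow> \<beta> \<in> \<rat> - {0} \<Longrightarrow> \<gamma> \<in> \<rat> - {0} \<Longrightarrow>
      \<alpha> + \<beta> + \<gamma> = 0 \<Longrightarrow> abc_height \<rat> \<alpha> \<beta> \<gamma> \<le>
        C * real (\<Prod>P \<in> abc_primes \<rat> \<alpha> \<beta> \<gamma>. prime_norm \<rat> P) powr (1 + \<epsilon>)"
    using assms number_field_Rats unfolding abc_conjecture_number_fields_def by blast
  have "real (a + b) \<le> C * real (radical (a * b * (a + b))) powr (1 + \<epsilon>)"
    if ab: "a > 0" "b > 0" "Rings.coprime a b" for a b
  proof -
    let ?N = "\<Prod>P\<in>abc_primes \<rat> (of_nat a) (of_nat b) (- of_nat (a + b)). prime_norm \<rat> P"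
    have "real (a + b) \<le> abc_height \<rat> (of_int (int a)) (of_int (int b)) (of_int (- int (a + b)))"
      using ab by (subst abc_height_Rats) auto
    also have "\<dots> = abc_height \<rat> (of_nat a) (of_nat b) (- of_nat (a + b))" by simp
    also have "\<dots> \<le> C * real ?N powr (1 + \<epsilon>)"
    proof (rule C(2))
      have "of_nat (a + b) \<noteq> (0 :: complex)" using ab by (simp only: of_nat_eq_0_iff)
      then show "- of_nat (a + b) \<in> \<rat> - {0 :: complex}" by (metis DiffI Rats_minus_iff Rats_of_nat neg_equal_0_iff_equal singletonD)
    qed (use ab in auto)
    also have "\<dots> \<le> C * real (radical (a * b * (a + b))) powr (1 + \<epsilon>)"
      using C(1) assms(2) abc_primes_Rats[OF ab(1,2)]
      by (intro mult_left_mono powr_mono2 of_nat_mono) (simp_all del: of_nat_prod)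
    finally show ?thesis .
  qed
  with C(1) that show ?thesis by blast
qed

section \<open>Squarefree values\<close>

lemma prime_factor_pos: "p \<in> Factorial_Ring.prime_factors n \<Longrightarrow> p > 0" for n :: nat
  using in_prime_factors_imp_prime prime_gt_0_nat by blast

lemma radical_pos: "radical n > 0"
  unfolding radical_def by (intro prod_pos) (simp add: prime_factor_pos)

lemma radical_dvd: "radical n dvd n"
proof (cases "n = 0")
  case False
  have "(\<Prod>p\<in>Factorial_Ring.prime_factors n. p) dvd
      (\<Prod>p\<in>Factorial_Ring.prime_factors n. p ^ multiplicity p n)"
    by (intro prod_dvd_prod) (auto simp: in_prime_factors_iff prime_factors_multiplicity intro!: dvd_power)
  also have "\<dots> = n" using False by (simp add: prime_factorization_nat[symmetric])
  finally show ?thesis by (simp add: radical_def)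
qed auto

lemma radical_le: "n > 0 \<Longrightarrow> radical n \<le> n"
  using radical_dvd dvd_imp_le by blast

lemma radical_mult_le:
  assumes "a > 0" "b > 0"
  shows "radical (a * b) \<le> radical a * radical b"
proof -
  let ?A = "Factorial_Ring.prime_factors a" and ?B = "Factorial_Ring.prime_factors b"
  have "1 \<le> \<Prod> (?A \<inter> ?B)" by (rule prod_ge_1) (auto simp: Suc_le_eq intro: prime_factor_pos)
  then have "\<Prod> (?A \<union> ?B) \<le> \<Prod> (?A \<union> ?B) * \<Prod> (?A \<inter> ?B)" by simp
  also have "\<dots> = \<Prod> ?A * \<Prod> ?B" by (rule prod.union_inter) auto
  finally show ?thesis using assms by (simp add: radical_def prime_factors_product)
qed

lemma radical_dvd_mono:
  assumes "a dvd b" "b > 0"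
  shows "radical a \<le> radical b"
proof -
  have "radical a dvd radical b" unfolding radical_def
    by (rule prod_dvd_prod_subset) (use assms dvd_prime_factors in auto)
  then show ?thesis using radical_pos dvd_imp_le by blast
qed

lemma radical_power: "n > 0 \<Longrightarrow> radical (a ^ n) = radical a"
  unfolding radical_def
  by (intro arg_cong[where f = Prod]) (auto simp: in_prime_factors_iff prime_dvd_power_iff)

text \<open>One factor \<open>p\<close> can be removed from \<open>n\<close> without losing a prime
  factor. This is how a square divisor enters the abc estimate.\<close>

lemma radical_square_factor:
  assumes "Factorial_Ring.prime p" "p\<^sup>2 dvd n" "n > 0"
  shows "p * radical n \<le> n"
proof -
  obtain m where m: "n = p * (p * m)" using assms(2) by (auto simp: dvd_def power2_eq_square mult.assoc)
  then have "Factorial_Ring.prime_factors n = Factorial_Ring.prime_factors (p * m)"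
    using assms by (auto simp: in_prime_factors_iff prime_dvd_mult_iff)
  then have "radical n = radical (p * m)" by (simp add: radical_def)
  also have "\<dots> \<le> p * m" using m assms(3) by (intro radical_le) auto
  finally show ?thesis using m by simp
qed

section \<open>The identity with a double zero and the abc estimate for pairs of values\<close>

lemma binomial_mod_square: "\<exists>r. (w + a) ^ n = a ^ n + of_nat n * a ^ (n - 1) * w + w\<^sup>2 * r"
  for w a :: int
proof (induction n)
  case (Suc n)
  then obtain r where r: "(w + a) ^ n = a ^ n + of_nat n * a ^ (n - 1) * w + w\<^sup>2 * r" by blast
  have "(w + a) ^ Suc n = (w + a) * (a ^ n + of_nat n * a ^ (n - 1) * w + w\<^sup>2 * r)"
    by (simp add: r)
  also have "\<dots> = a * a ^ n + (a ^ n + of_nat n * a ^ (n - 1) * a) * w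
      + w\<^sup>2 * (of_nat n * a ^ (n - 1) + (w + a) * r)"
    by (simp add: algebra_simps power2_eq_square)
  also have "\<dots> = a ^ Suc n + of_nat (Suc n) * a ^ (Suc n - 1) * w
      + w\<^sup>2 * (of_nat n * a ^ (n - 1) + (w + a) * r)"
    by (cases n) (simp_all add: algebra_simps)
  finally show ?case by blast
qed (auto intro: exI[of _ 0])

text \<open>
  The exponents 1 and 15 are chosen such that \<open>x (1 - x)\<^sup>1\<^sup>5\<close> has its only other critical
  point at \<open>1/16\<close>; with \<open>x = - 27 k\<^sup>4\<close> the points \<open>1\<close> and \<open>1/16\<close> are the zeros of
  \<open>27 k\<^sup>4 + 1\<close> and \<open>27 (2 k)\<^sup>4 + 1\<close>. In the lemma, \<open>u = 27 (2 k)\<^sup>4\<close>.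
\<close>

lemma Belyi_identity:
  obtains G :: nat where "u * (u + 16) ^ 15 + 15 ^ 15 = (u + 1)\<^sup>2 * G" "G \<le> 2 * 16 ^ 15 * (u + 1) ^ 14"
proof -
  define w where "w = int u + 1"
  obtain r where r: "(w + 15) ^ 15 = 15 ^ 15 + of_nat 15 * 15 ^ (15 - 1) * w + w\<^sup>2 * r"
    using binomial_mod_square[of w 15 15] by blast
  \<comment> \<open>Modulo w^2 the constant terms cancel, and the linear terms 15^15 w and 15 *
    15^14 w cancel because exponent and shift are both 15.\<close>
  have "(w - 1) * (w + 15) ^ 15 + 15 ^ 15 = w\<^sup>2 * (15 ^ 15 + (w - 1) * r)"
    unfolding r by (simp add: algebra_simps power2_eq_square)
  then have "int ((u + 1)\<^sup>2) dvd int (u * (u + 16) ^ 15 + 15 ^ 15)"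
    by (simp add: w_def add.commute)
  then have "(u + 1)\<^sup>2 dvd u * (u + 16) ^ 15 + 15 ^ 15" by (simp only: int_dvd_int_iff)
  then obtain G where G: "u * (u + 16) ^ 15 + 15 ^ 15 = (u + 1)\<^sup>2 * G" by (auto simp: dvd_def)
  define v where "v = u + 1"
  have v: "1 \<le> v" "u \<le> v" "u + 16 \<le> 16 * v" by (simp_all add: v_def)
  have "v * (16 * v) ^ 15 = 16 ^ 15 * (v * v ^ 15)" by (simp only: power_mult_distrib mult.left_commute)
  moreover have "v * v ^ 15 = v\<^sup>2 * v ^ 14" using power_add[of v 1 15] power_add[of v 2 14] by simp
  ultimately have eq: "v * (16 * v) ^ 15 = v\<^sup>2 * (16 ^ 15 * v ^ 14)" by (simp only: mult.left_commute)
  have "u * (u + 16) ^ 15 \<le> v * (16 * v) ^ 15"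
    using v by (intro mult_mono power_mono) auto
  moreover have "(15::nat) ^ 15 \<le> 16 ^ 15" by simp
  moreover have "1 \<le> v\<^sup>2 * v ^ 14" using v by simp
  then have "(16::nat) ^ 15 \<le> v\<^sup>2 * (16 ^ 15 * v ^ 14)" by simp
  ultimately have "v\<^sup>2 * G \<le> v\<^sup>2 * (16 ^ 15 * v ^ 14) + v\<^sup>2 * (16 ^ 15 * v ^ 14)"
    unfolding v_def G[symmetric] eq[unfolded v_def, symmetric] by linarith
  then have "v\<^sup>2 * G \<le> v\<^sup>2 * (2 * 16 ^ 15 * v ^ 14)" by (simp add: algebra_simps)
  then have "G \<le> 2 * 16 ^ 15 * v ^ 14" using v by simp
  then have "G \<le> 2 * 16 ^ 15 * (u + 1) ^ 14" by (simp only: v_def)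
  with G that show ?thesis by blast
qed

text \<open>The exponent is 65 = 1 + 4 + 4 + 56. The factor k^4 contributes only k to the radical,
  the two squared primes improve the radicals of the values at k and 2 k by the factors
  \<open>p\<close> and \<open>q\<close>, and the cofactor \<open>G\<close> costs 14 powers of
  \<open>432 * k ^ 4 + 1\<close>. The sum in the abc triple has size k^64, so one power of k remains
  for the product of \<open>p\<close> and \<open>q\<close>.\<close>

lemma radical_bound:
  fixes k p q :: nat
  assumes k: "k > 0" and p: "Factorial_Ring.prime p" "p\<^sup>2 dvd 27 * k ^ 4 + 1"
    and q: "Factorial_Ring.prime q" "q\<^sup>2 dvd 432 * k ^ 4 + 1"
    and G: "432 * k ^ 4 * (432 * k ^ 4 + 16) ^ 15 + 15 ^ 15 = (432 * k ^ 4 + 1)\<^sup>2 * G"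
      "G \<le> 2 * 16 ^ 15 * (432 * k ^ 4 + 1) ^ 14"
  shows "p * q * radical ((432 * k ^ 4 * (432 * k ^ 4 + 16) ^ 15) * 15 ^ 15
      * (432 * k ^ 4 * (432 * k ^ 4 + 16) ^ 15 + 15 ^ 15))
    \<le> 432 * 16 * 15 * 2 * 16 ^ 15 * 433 ^ 16 * k ^ 65"
proof -
  define w where "w = 432 * k ^ 4 + 1"
  define d where "d = 27 * k ^ 4 + 1"
  have d: "432 * k ^ 4 + 16 = 16 * d" "d \<le> w" "d > 0" by (simp_all add: d_def w_def)
  have w: "w > 0" by (simp add: w_def)
  have u: "432 * k ^ 4 > 0" using k by simp
  have "0 < w\<^sup>2 * G" using G(1) unfolding w_def[symmetric] by (metis add_gr_0 zero_less_numeral zero_less_power)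
  then have G0: "G > 0" by simp
  have mono: "radical (x * y) \<le> X * Y" if "radical x \<le> X" "radical y \<le> Y" "x > 0" "y > 0" for x y X Y
    using radical_mult_le[OF that(3,4)] mult_le_mono[OF that(1,2)] by (rule order_trans)
  have G': "radical G \<le> 2 * 16 ^ 15 * w ^ 14"
    using radical_le[OF G0] G(2) unfolding w_def by (rule order_trans)
  have k': "radical (k ^ 4) \<le> k" using radical_le[OF k] by (simp add: radical_power)
  have r16: "radical 16 \<le> 16" "radical 432 \<le> 432" "radical (15 ^ 15) \<le> 15"
    using radical_le[of 16] radical_le[of 432] radical_le[of 15] by (simp_all only: radical_power zero_less_numeral simp_thms)
  have d': "radical ((16 * d) ^ 15) \<le> 16 * radical d"
    using mono[OF r16(1) order_refl, of d] d(3) by (simp only: radical_power zero_less_numeral simp_thms)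
  have w': "radical (w\<^sup>2) \<le> radical w" by (simp only: radical_power zero_less_numeral order_refl)
  have "432 * k ^ 4 * (16 * d) ^ 15 + 15 ^ 15 = w\<^sup>2 * G" using G(1) by (simp only: d(1) w_def)
  then have "radical ((432 * k ^ 4 * (432 * k ^ 4 + 16) ^ 15) * 15 ^ 15
      * (432 * k ^ 4 * (432 * k ^ 4 + 16) ^ 15 + 15 ^ 15))
    = radical ((432 * k ^ 4) * (16 * d) ^ 15 * 15 ^ 15 * (w\<^sup>2 * G))"
    by (simp only: d(1))
  also have "\<dots> \<le> 432 * k * (16 * radical d) * 15 * (radical w * (2 * 16 ^ 15 * w ^ 14))"
    by (intro mono r16 k' d' w' G') (use k d w G0 in simp_all)
  finally have "radical ((432 * k ^ 4 * (432 * k ^ 4 + 16) ^ 15) * 15 ^ 15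
      * (432 * k ^ 4 * (432 * k ^ 4 + 16) ^ 15 + 15 ^ 15))
    \<le> 432 * k * (16 * radical d) * 15 * (radical w * (2 * 16 ^ 15 * w ^ 14))" .
  then have "p * q * radical ((432 * k ^ 4 * (432 * k ^ 4 + 16) ^ 15) * 15 ^ 15
      * (432 * k ^ 4 * (432 * k ^ 4 + 16) ^ 15 + 15 ^ 15))
    \<le> p * q * (432 * k * (16 * radical d) * 15 * (radical w * (2 * 16 ^ 15 * w ^ 14)))"
    by (rule mult_le_mono2)
  also have "\<dots> = 432 * 16 * 15 * 2 * 16 ^ 15 * k * ((p * radical d) * (q * radical w) * w ^ 14)"
    by (simp only: mult_ac)
  also have "\<dots> \<le> 432 * 16 * 15 * 2 * 16 ^ 15 * k * (w * w * w ^ 14)"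
  proof (intro mult_le_mono order_refl)
    show "p * radical d \<le> w"
      using radical_square_factor[OF p(1), of d] p(2) d by (simp add: d_def)
    show "q * radical w \<le> w"
      using radical_square_factor[OF q(1), of w] q(2) by (simp add: w_def)
  qed
  also have "\<dots> \<le> 432 * 16 * 15 * 2 * 16 ^ 15 * k * (433 ^ 16 * k ^ 64)"
  proof (intro mult_le_mono2)
    have "w * w * w ^ 14 = w ^ 16" using power_add[of w 2 14] by (simp add: power2_eq_square)
    also have "\<dots> \<le> (433 * k ^ 4) ^ 16"
      using k by (intro power_mono) (simp_all add: w_def Suc_le_eq)
    also have "\<dots> = 433 ^ 16 * k ^ 64" by (simp only: power_mult_distrib flip: power_mult) simp
    finally show "w * w * w ^ 14 \<le> 433 ^ 16 * k ^ 64" .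
  qed
  also have "\<dots> = 432 * 16 * 15 * 2 * 16 ^ 15 * 433 ^ 16 * (k ^ 1 * k ^ 64)"
    by (simp only: mult_ac power_one_right)
  also have "k ^ 1 * k ^ 64 = k ^ 65" by (simp only: flip: power_add) simp
  finally show ?thesis .
qed

text \<open>With k of size M^5 the cutoff k^(3/5) is the integer M^3. Two primes beyond it lower the
  bound for the radical from order M^325 to order M^319, while the abc sum has at least order
  M^320.\<close>

lemma abc_no_pair_of_large_square_factors:
  assumes "abc_conjecture_number_fields" and "L > 0"
  obtains M0 :: nat where
    "\<And>M k p q. M \<ge> M0 \<Longrightarrow> M ^ 5 \<le> k \<Longrightarrow> k \<le> L * M ^ 5 \<Longrightarrow>
       Factorial_Ring.prime p \<Longrightarrow> p\<^sup>2 dvd 27 * k ^ 4 + 1 \<Longrightarrow> M ^ 3 < p \<Longrightarrow>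
       Factorial_Ring.prime q \<Longrightarrow> q\<^sup>2 dvd 432 * k ^ 4 + 1 \<Longrightarrow> M ^ 3 < q \<Longrightarrow> False"
proof -
  \<comment> \<open>The exponent has to satisfy 319 (1 + eps) < 320. With eps = 1/640 the gap is
    321/640, because 319 * 641 / 640 = 320 - 321 / 640.\<close>
  obtain C :: real where C: "C > 0"
    "\<And>a b. a > 0 \<Longrightarrow> b > 0 \<Longrightarrow> Rings.coprime a b \<Longrightarrow>
      real (a + b) \<le> C * real (radical (a * b * (a + b))) powr (1 + 1 / 640)"
    using abc_for_naturals[OF assms(1), of "1 / 640"] by auto
  define K where "K = real (432 * 16 * 15 * 2 * 16 ^ 15 * 433 ^ 16 * L ^ 65)"
  define D where "D = 15 ^ 15 * C * K powr (641 / 640)"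
  have K: "K > 0" using assms(2) unfolding K_def by simp
  have D: "D > 0" using C K by (simp add: D_def)
  \<comment> \<open>Beyond this threshold M^(321/640) exceeds \<open>D\<close>, against the bound
    that abc will give.\<close>
  define M0 where "M0 = max 1 (nat \<lceil>D powr (640 / 321)\<rceil> + 1)"
  show ?thesis
  proof (rule that[of M0])
    fix M k p q :: nat
    assume M: "M \<ge> M0" and k: "M ^ 5 \<le> k" "k \<le> L * M ^ 5"
      and p: "Factorial_Ring.prime p" "p\<^sup>2 dvd 27 * k ^ 4 + 1" "M ^ 3 < p"
      and q: "Factorial_Ring.prime q" "q\<^sup>2 dvd 432 * k ^ 4 + 1" "M ^ 3 < q"
    have M1: "M \<ge> 1" using M by (simp add: M0_def)
    then have k0: "k > 0" using k by (metis less_le_trans not_gr_zero not_one_le_zero zero_less_power)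
    define u where "u = 432 * k ^ 4"
    obtain G where G: "u * (u + 16) ^ 15 + 15 ^ 15 = (u + 1)\<^sup>2 * G" "G \<le> 2 * 16 ^ 15 * (u + 1) ^ 14"
      using Belyi_identity by blast
    define a where "a = u * (u + 16) ^ 15"
    define b where "b = (15 :: nat) ^ 15"
    define R where "R = radical (a * b * (a + b))"
    have pqR: "p * q * R \<le> 432 * 16 * 15 * 2 * 16 ^ 15 * 433 ^ 16 * k ^ 65"
      using radical_bound[OF k0 p(1,2) q(1,2), folded u_def, OF G] unfolding R_def a_def b_def .
    have u0: "u > 0" "k ^ 4 \<le> u" using k0 by (simp_all add: u_def)
    have ab: "a > 0" "b > 0" using u0 by (simp_all add: a_def b_def)
    \<comment> \<open>abc is available for coprime entries. The gcd divides the constant 15^15, so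
      dividing by it costs a bounded factor, and the radical does not grow.\<close>
    define g where "g = gcd a b"
    have g: "g > 0" "g dvd a" "g dvd b" using ab by (simp_all add: g_def)
    obtain a' b' where a': "a = g * a'" "b = g * b'" using g by (auto simp: dvd_def)
    have cop: "Rings.coprime a' b'"
    proof -
      have "g * gcd a' b' = gcd (g * a') (g * b')" by (rule gcd_mult_distrib_nat)
      also have "\<dots> = g" unfolding a'[symmetric] by (simp only: g_def)
      finally show ?thesis using g(1) by (simp add: coprime_iff_gcd_eq_1)
    qed
    have ab': "a' > 0" "b' > 0" using ab a' by (auto intro: Nat.gr0I)
    have "a * b * (a + b) = (a' * b' * (a' + b')) * (g * g * g)" by (simp add: a' algebra_simps)
    then have "radical (a' * b' * (a' + b')) \<le> R" unfolding R_def
      by (intro radical_dvd_mono) (use ab ab' g(1) in auto)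
    then have "real (radical (a' * b' * (a' + b'))) powr (641 / 640) \<le> real R powr (641 / 640)"
      by (intro powr_mono2) simp_all
    then have "C * real (radical (a' * b' * (a' + b'))) powr (641 / 640) \<le> C * real R powr (641 / 640)"
      using C(1) by simp
    moreover have "real (a' + b') \<le> C * real (radical (a' * b' * (a' + b'))) powr (641 / 640)"
      using C(2)[OF ab' cop] by simp
    ultimately have 1: "real (a' + b') \<le> C * real R powr (641 / 640)" by linarith
    have "g \<le> 15 ^ 15" using g ab by (intro dvd_imp_le) (auto simp: b_def)
    have "M ^ 320 = (M ^ 5) ^ 64" by (simp flip: power_mult)
    also have "\<dots> \<le> k ^ 64" using k by (intro power_mono) auto
    also have "\<dots> = (k ^ 4) ^ 16" by (simp flip: power_mult)
    also have "\<dots> \<le> u ^ 16" using u0 by (intro power_mono) auto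
    also have "\<dots> = u * u ^ 15" using power_add[of u 1 15] by simp
    also have "\<dots> \<le> a" unfolding a_def by (intro mult_le_mono power_mono) auto
    also have "\<dots> \<le> 15 ^ 15 * (a' + b')" unfolding a' using \<open>g \<le> 15 ^ 15\<close> by (intro mult_le_mono) auto
    finally have "real (M ^ 320) \<le> real (15 ^ 15 * (a' + b'))" by (simp only: of_nat_le_iff)
    also have "\<dots> = 15 ^ 15 * real (a' + b')" by simp
    also have "\<dots> \<le> 15 ^ 15 * (C * real R powr (641 / 640))" using 1 by (intro mult_left_mono) auto
    finally have 2: "real (M ^ 320) \<le> 15 ^ 15 * C * real R powr (641 / 640)" by (simp only: mult.assoc)
    define N :: nat where "N = 432 * 16 * 15 * 2 * 16 ^ 15 * 433 ^ 16"
    have "M ^ 6 * R = M ^ 3 * M ^ 3 * R" by (simp flip: power_add)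
    also have "\<dots> \<le> p * q * R" using p q by (intro mult_le_mono) auto
    also have "\<dots> \<le> N * k ^ 65" using pqR unfolding N_def .
    also have "\<dots> \<le> N * (L * M ^ 5) ^ 65" using k by (intro mult_le_mono2 power_mono) auto
    also have "(L * M ^ 5) ^ 65 = L ^ 65 * M ^ 325" by (simp only: power_mult_distrib flip: power_mult) simp
    also have "M ^ 325 = M ^ 6 * M ^ 319" using power_add[of M 6 319] by simp
    finally have "M ^ 6 * R \<le> M ^ 6 * (N * L ^ 65 * M ^ 319)" by (simp only: mult_ac)
    then have "R \<le> N * L ^ 65 * M ^ 319" using M1 by simp
    then have "real R \<le> real (N * L ^ 65 * M ^ 319)" by (simp only: of_nat_le_iff)
    then have RK: "real R \<le> K * real M ^ 319" unfolding K_def N_def by (simp only: of_nat_mult of_nat_power)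
    have "real M powr 320 \<le> 15 ^ 15 * C * real R powr (641 / 640)"
      using 2 M1 by (simp add: powr_numeral)
    also have "\<dots> \<le> 15 ^ 15 * C * (K * real M ^ 319) powr (641 / 640)"
      using RK C(1) by (intro mult_left_mono powr_mono2) auto
    also have "\<dots> = D * real M powr (319 * 641 / 640)"
      using K M1 by (simp add: D_def powr_mult powr_powr flip: powr_numeral)
    finally have "real M powr (321 / 640) * real M powr (319 * 641 / 640) \<le> D * real M powr (319 * 641 / 640)"
      by (simp flip: powr_add)
    then have 3: "real M powr (321 / 640) \<le> D" using M1 by simp
    have "D powr (640 / 321) < real M" using M unfolding M0_def by linarith
    then have "(D powr (640 / 321)) powr (321 / 640) < real M powr (321 / 640)"
      by (intro powr_less_mono2) auto
    then have "D < real M powr (321 / 640)" using D by (simp add: powr_powr)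
    with 3 show False by simp
  qed
qed

section \<open>Sieving by the squares of small primes\<close>

lemma card_residue_class_le:
  fixes N q :: nat
  assumes "q > 0"
  shows "card {m \<in> {N<..2 * N}. int q dvd int m - c} \<le> N div q + 1"
proof -
  let ?S = "{m \<in> {N<..2 * N}. int q dvd int m - c}"
  \<comment> \<open>The number of the block of length \<open>q\<close> that contains
    \<open>m\<close>; two members of one residue class never share a block.\<close>
  define h where "h m = (m - N - 1) div q" for m
  have "inj_on h ?S"
  proof (rule inj_onI)
    fix m m' assume m: "m \<in> ?S" and m': "m' \<in> ?S" and eq: "h m = h m'"
    have "int q dvd int m - c" "int q dvd int m' - c" using m m' by auto
    then have "int q dvd (int m - c) - (int m' - c)" by (rule dvd_diff)
    then have "int q dvd (int m - int N - 1) - (int m' - int N - 1)" by simp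
    then have "(int m - int N - 1) mod int q = (int m' - int N - 1) mod int q"
      by (simp only: mod_eq_dvd_iff)
    moreover have "int m - int N - 1 = int (m - N - 1)" "int m' - int N - 1 = int (m' - N - 1)"
      using m m' by auto
    ultimately have "int ((m - N - 1) mod q) = int ((m' - N - 1) mod q)" by (simp only: zmod_int)
    then have "(m - N - 1) mod q = (m' - N - 1) mod q" by simp
    with eq have "m - N - 1 = m' - N - 1" unfolding h_def by (metis div_mult_mod_eq)
    then show "m = m'" using m m' by auto
  qed
  moreover have "h ` ?S \<subseteq> {..N div q}" by (auto simp: h_def intro!: div_le_mono)
  ultimately have "card ?S \<le> card {..N div q}" by (intro card_inj_on_le) auto
  then show ?thesis by simp
qed

text \<open>For two solutions p^2 divides (m - n) (m + n) (m^2 + n^2) because it is prime to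
  \<open>A\<close>. As \<open>p\<close> does not divide 2 A m, it divides only one of these factors,
  which then takes all of p^2. So the solutions lie in at most four classes, those of plus or minus
  m0 and m1, where m1^2 = - m0^2. An even \<open>A\<close> rules out p = 2.\<close>

lemma card_square_divisor_le:
  fixes N p A :: nat
  assumes p: "Factorial_Ring.prime p" and A: "even A"
  shows "card {m \<in> {N<..2 * N}. p\<^sup>2 dvd A * m ^ 4 + 1} \<le> 4 * (N div p\<^sup>2 + 1)"
proof -
  let ?S = "{m \<in> {N<..2 * N}. p\<^sup>2 dvd A * m ^ 4 + 1}"
  define q where "q = int (p\<^sup>2)"
  define R where "R c = {m \<in> {N<..2 * N}. int (p\<^sup>2) dvd int m - c}" for c
  have cardR: "card (R c) \<le> N div p\<^sup>2 + 1" for c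
    unfolding R_def by (rule card_residue_class_le) (use p prime_gt_0_nat in auto)
  have finR: "finite (R c)" for c by (simp add: R_def)
  have pI: "Factorial_Ring.prime (int p)" using p by simp
  have unit: "\<not> int p dvd 2 * int A * int m" if "p\<^sup>2 dvd A * m ^ 4 + 1" for m
  proof
    assume "int p dvd 2 * int A * int m"
    then have "int p dvd 2 \<or> int p dvd int A \<or> int p dvd int m" using pI by (simp add: prime_dvd_mult_iff)
    then have "p dvd 2 \<or> p dvd A \<or> p dvd m" using int_dvd_int_iff[of p 2] by auto
    moreover have "m dvd m ^ 4" by simp
    ultimately have "p dvd A \<or> p dvd m ^ 4" using A by (meson dvd_trans)
    then have "p dvd A * m ^ 4" by auto
    moreover have "p dvd A * m ^ 4 + 1" using that by (metis dvd_mult_left power2_eq_square)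
    ultimately have "p dvd 1" by (metis dvd_add_right_iff)
    then show False using p by simp
  qed
  have cop: "Rings.coprime q x" if "\<not> int p dvd x" for x
    using prime_imp_coprime[OF pI that] by (simp add: q_def)
  have linear: "q dvd int m - int n \<or> q dvd int m + int n"
    if "m \<in> ?S" "n \<in> ?S" "q dvd (int m)\<^sup>2 - (int n)\<^sup>2" for m n
  proof -
    have d: "q dvd (int m - int n) * (int m + int n)"
      using that(3) by (simp add: power2_eq_square algebra_simps)
    have "\<not> (int p dvd int m - int n \<and> int p dvd int m + int n)"
    proof
      assume "int p dvd int m - int n \<and> int p dvd int m + int n"
      then have "int p dvd (int m - int n) + (int m + int n)" by (simp only: dvd_add)
      then have "int p dvd (2 * int m) * int A" by simp
      then show False using unit[of m] that by (simp add: mult_ac)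
    qed
    then have "Rings.coprime q (int m - int n) \<or> Rings.coprime q (int m + int n)" using cop by blast
    then show ?thesis using d by (auto simp: coprime_dvd_mult_left_iff coprime_dvd_mult_right_iff)
  qed
  have quadratic: "q dvd (int m)\<^sup>2 - (int n)\<^sup>2 \<or> q dvd (int m)\<^sup>2 + (int n)\<^sup>2"
    if "m \<in> ?S" "n \<in> ?S" for m n
  proof -
    have "q dvd int (A * m ^ 4 + 1) - int (A * n ^ 4 + 1)"
      using that unfolding q_def by (intro dvd_diff) (auto simp only: int_dvd_int_iff mem_Collect_eq)
    also have "int (A * m ^ 4 + 1) - int (A * n ^ 4 + 1)
        = int A * (((int m)\<^sup>2 - (int n)\<^sup>2) * ((int m)\<^sup>2 + (int n)\<^sup>2))"
      by (simp add: algebra_simps power2_eq_square power4_eq_xxxx)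
    finally have "q dvd int A * (((int m)\<^sup>2 - (int n)\<^sup>2) * ((int m)\<^sup>2 + (int n)\<^sup>2))" .
    moreover have "\<not> int p dvd int A" using unit[of m] that by auto
    ultimately have d: "q dvd ((int m)\<^sup>2 - (int n)\<^sup>2) * ((int m)\<^sup>2 + (int n)\<^sup>2)"
      using cop by (simp add: coprime_dvd_mult_right_iff)
    have "\<not> (int p dvd (int m)\<^sup>2 - (int n)\<^sup>2 \<and> int p dvd (int m)\<^sup>2 + (int n)\<^sup>2)"
    proof
      assume "int p dvd (int m)\<^sup>2 - (int n)\<^sup>2 \<and> int p dvd (int m)\<^sup>2 + (int n)\<^sup>2"
      then have "int p dvd ((int m)\<^sup>2 - (int n)\<^sup>2) + ((int m)\<^sup>2 + (int n)\<^sup>2)"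
        by (simp only: dvd_add)
      then have "int p dvd int A * (((int m)\<^sup>2 - (int n)\<^sup>2) + ((int m)\<^sup>2 + (int n)\<^sup>2))" by (rule dvd_mult)
      then have "int p dvd (2 * int A * int m) * int m" by (simp add: power2_eq_square algebra_simps)
      then have "int p dvd 2 * int A * int m \<or> int p dvd int m" using pI by (simp only: prime_dvd_mult_iff)
      then show False using unit[of m] that by auto
    qed
    then have "Rings.coprime q ((int m)\<^sup>2 - (int n)\<^sup>2) \<or> Rings.coprime q ((int m)\<^sup>2 + (int n)\<^sup>2)"
      using cop by blast
    then show ?thesis using d by (auto simp: coprime_dvd_mult_left_iff coprime_dvd_mult_right_iff)
  qed
  have "\<exists>c1 c2 c3 c4. ?S \<subseteq> R c1 \<union> R c2 \<union> R c3 \<union> R c4"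
  proof (cases "?S = {}")
    case False
    then obtain m0 where m0: "m0 \<in> ?S" by blast
    \<comment> \<open>The solutions whose square is opposite to that of \<open>m0\<close>. Their
      squares agree with each other, so one representative \<open>m1\<close> is enough; if there is
      none, \<open>m1\<close> is arbitrary.\<close>
    define T where "T = {m \<in> ?S. q dvd (int m)\<^sup>2 + (int m0)\<^sup>2}"
    obtain m1 where m1: "m1 \<in> T \<or> T = {}" by blast
    have "m \<in> R (int m0) \<union> R (- int m0) \<union> R (int m1) \<union> R (- int m1)" if m: "m \<in> ?S" for m
    proof -
      have "q dvd int m - int m0 \<or> q dvd int m + int m0 \<or> q dvd int m - int m1 \<or> q dvd int m + int m1"
      proof (cases "m \<in> T")
        case False
        then show ?thesis using quadratic[OF m m0] linear[OF m m0] m by (auto simp: T_def)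
      next
        case True
        then have "m1 \<in> T" using m1 by blast
        then have "q dvd ((int m)\<^sup>2 + (int m0)\<^sup>2) - ((int m1)\<^sup>2 + (int m0)\<^sup>2)"
          using True by (intro dvd_diff) (auto simp: T_def)
        then have "q dvd (int m)\<^sup>2 - (int m1)\<^sup>2" by simp
        then show ?thesis using linear[OF m, of m1] \<open>m1 \<in> T\<close> by (auto simp: T_def)
      qed
      then show ?thesis using m by (auto simp: R_def q_def)
    qed
    then show ?thesis by blast
  next
    case True
    show ?thesis unfolding True by blast
  qed
  then obtain c1 c2 c3 c4 where sub: "?S \<subseteq> R c1 \<union> R c2 \<union> R c3 \<union> R c4" by blast
  have "card ?S \<le> card (R c1 \<union> R c2 \<union> R c3 \<union> R c4)" by (rule card_mono) (use sub finR in auto)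
  also have "\<dots> \<le> card (R c1) + card (R c2) + card (R c3) + card (R c4)"
    using card_Un_le[of "R c1 \<union> R c2 \<union> R c3" "R c4"] card_Un_le[of "R c1 \<union> R c2" "R c3"]
      card_Un_le[of "R c1" "R c2"] by linarith
  also have "\<dots> \<le> 4 * (N div p\<^sup>2 + 1)"
    using add_mono[OF add_mono[OF add_mono[OF cardR cardR] cardR] cardR, of c1 c2 c3 c4] by simp
  finally show ?thesis .
qed

text \<open>Telescoping: 1 / (x + 1)^2 is at most 1 / x - 1 / (x + 1).\<close>

lemma sum_inverse_squares_le:
  fixes z n :: nat
  assumes "z > 0"
  shows "(\<Sum>i\<in>{z<..z + n}. 1 / (real i)\<^sup>2) \<le> 1 / real z - 1 / real (z + n)"
proof (induction n)
  case (Suc n)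
  have "{z<..z + Suc n} = insert (z + Suc n) {z<..z + n}" by auto
  then have "(\<Sum>i\<in>{z<..z + Suc n}. 1 / (real i)\<^sup>2) = 1 / (real (z + Suc n))\<^sup>2 + (\<Sum>i\<in>{z<..z + n}. 1 / (real i)\<^sup>2)"
    by simp
  also have "1 / (real (z + Suc n))\<^sup>2 \<le> 1 / real (z + n) - 1 / real (z + Suc n)"
  proof -
    define x where "x = real (z + n)"
    have x: "x > 0" using assms by (simp add: x_def)
    have "1 / (x + 1)\<^sup>2 \<le> 1 / (x * (x + 1))"
      using x by (intro frac_le) (auto simp: power2_eq_square)
    also have "\<dots> = 1 / x - 1 / (x + 1)" using x by (simp add: field_simps)
    finally show ?thesis by (simp add: x_def add_ac)
  qed
  also note Suc.IH
  finally show ?case by simp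
qed simp

text \<open>The two coefficients \<open>A\<close> belong to the values at k = 20! m and at 2 k.
  Primes up to 20 divide them and so cannot divide the values. Each larger prime excludes four
  classes per coefficient. With N = M^5 this amounts to at most 8 N / 20 numbers, plus 8 M^3 for
  incomplete periods, which is at most N / 2 when M is at least 4. The bound 20 leaves 2 N / 5 + N /
  2 < N.\<close>

lemma exists_without_small_square_factors:
  fixes M :: nat
  assumes M: "M \<ge> 4"
  obtains m where "M ^ 5 < m" "m \<le> 2 * M ^ 5"
    "\<And>p A. Factorial_Ring.prime p \<Longrightarrow> p \<le> M ^ 3 \<Longrightarrow> A = 27 * fact 20 ^ 4 \<or> A = 432 * fact 20 ^ 4 \<Longrightarrow>
      \<not> p\<^sup>2 dvd A * m ^ 4 + 1"
proof -
  define N where "N = M ^ 5"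
  define F where "F A p = {m \<in> {N<..2 * N}. p\<^sup>2 dvd A * m ^ 4 + 1}" for A p :: nat
  define As :: "nat set" where "As = {27 * fact 20 ^ 4, 432 * fact 20 ^ 4}"
  define Ps where "Ps = {p. Factorial_Ring.prime p \<and> 20 < p \<and> p \<le> M ^ 3}"
  define Bad where "Bad = (\<Union>A\<in>As. \<Union>p\<in>Ps. F A p)"
  have f20: "even (fact 20 :: nat)" by (simp add: dvd_fact)
  have evenA: "even A" if "A \<in> As" for A using that f20 by (auto simp: As_def)
  have Ps: "Ps \<subseteq> {20<..20 + M ^ 3}" "finite Ps" by (auto simp: Ps_def)
  have cardAs: "card As \<le> 2" unfolding As_def by (rule card_insert_le_m1) auto
  have Fle: "real (card (F A p)) \<le> 4 * real N * (1 / (real p)\<^sup>2) + 4" if "A \<in> As" "p \<in> Ps" for A p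
  proof -
    have "card (F A p) \<le> 4 * (N div p\<^sup>2 + 1)"
      unfolding F_def by (rule card_square_divisor_le) (use that evenA in \<open>auto simp: Ps_def\<close>)
    then have "real (card (F A p)) \<le> real (4 * (N div p\<^sup>2 + 1))" by (simp only: of_nat_le_iff)
    then have "real (card (F A p)) \<le> 4 * real (N div p\<^sup>2) + 4" by simp
    also have "real (N div p\<^sup>2) \<le> real N / real (p\<^sup>2)" by (rule of_nat_div_le_of_nat)
    finally show ?thesis by simp
  qed
  have sumF: "real (\<Sum>p\<in>Ps. card (F A p)) \<le> real N / 5 + 4 * real M ^ 3" if "A \<in> As" for A
  proof -
    have "real (\<Sum>p\<in>Ps. card (F A p)) \<le> (\<Sum>p\<in>Ps. 4 * real N * (1 / (real p)\<^sup>2) + 4)"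
      using Fle[OF that] by (simp add: sum_mono)
    also have "\<dots> = 4 * real N * (\<Sum>p\<in>Ps. 1 / (real p)\<^sup>2) + 4 * real (card Ps)"
      by (simp add: sum.distrib sum_distrib_left)
    also have "\<dots> \<le> 4 * real N * (1 / 20) + 4 * real M ^ 3"
    proof (intro add_mono mult_left_mono)
      have "(\<Sum>p\<in>Ps. 1 / (real p)\<^sup>2) \<le> (\<Sum>p\<in>{20<..20 + M ^ 3}. 1 / (real p)\<^sup>2)"
        using Ps by (intro sum_mono2) auto
      also have "\<dots> \<le> 1 / real 20 - 1 / real (20 + M ^ 3)" by (rule sum_inverse_squares_le) simp
      also have "\<dots> \<le> 1 / 20" by simp
      finally show "(\<Sum>p\<in>Ps. 1 / (real p)\<^sup>2) \<le> 1 / 20" .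
      have "card Ps \<le> M ^ 3" using card_mono[OF _ Ps(1)] by simp
      then have "real (card Ps) \<le> real (M ^ 3)" by (simp only: of_nat_le_iff)
      then show "real (card Ps) \<le> real M ^ 3" by simp
    qed auto
    finally show ?thesis by simp
  qed
  have "card Bad \<le> (\<Sum>A\<in>As. card (\<Union>p\<in>Ps. F A p))" unfolding Bad_def by (rule card_UN_le) (simp add: As_def)
  also have "\<dots> \<le> (\<Sum>A\<in>As. \<Sum>p\<in>Ps. card (F A p))" by (intro sum_mono card_UN_le Ps)
  finally have "real (card Bad) \<le> (\<Sum>A\<in>As. real (\<Sum>p\<in>Ps. card (F A p)))"
    by (metis of_nat_le_iff of_nat_sum)
  also have "\<dots> \<le> (\<Sum>A\<in>As. real N / 5 + 4 * real M ^ 3)" using sumF by (rule sum_mono)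
  also have "\<dots> = real (card As) * (real N / 5 + 4 * real M ^ 3)" by simp
  also have "\<dots> \<le> 2 * (real N / 5 + 4 * real M ^ 3)" using cardAs by (intro mult_right_mono) auto
  also have "\<dots> < real N"
  proof -
    have "(16 :: real) \<le> (real M)\<^sup>2" using M power_mono[of 4 "real M" 2] by simp
    then have "16 * real M ^ 3 \<le> (real M)\<^sup>2 * real M ^ 3" using M by (intro mult_right_mono) auto
    also have "\<dots> = real N" by (simp add: N_def flip: power_add)
    finally have "16 * real M ^ 3 \<le> real N" .
    moreover have "real M ^ 3 > 0" using M by simp
    moreover have "2 * (y / 5 + 4 * x) < y" if "16 * x \<le> y" "x > 0" for x y :: real
      using that by (simp add: field_simps)
    ultimately show ?thesis by blast
  qed
  finally have "card Bad < card {N<..2 * N}" by simp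
  moreover have "finite Bad" unfolding Bad_def F_def using Ps by (auto simp: As_def)
  ultimately obtain m where m: "m \<in> {N<..2 * N}" "m \<notin> Bad"
    by (metis card_mono not_less subsetI)
  show ?thesis
  proof (rule that[of m])
    show "M ^ 5 < m" "m \<le> 2 * M ^ 5" using m by (auto simp: N_def)
    fix p A :: nat assume p: "Factorial_Ring.prime p" "p \<le> M ^ 3" and A: "A = 27 * fact 20 ^ 4 \<or> A = 432 * fact 20 ^ 4"
    show "\<not> p\<^sup>2 dvd A * m ^ 4 + 1"
    proof
      assume d: "p\<^sup>2 dvd A * m ^ 4 + 1"
      show False
      proof (cases "p \<le> 20")
        case True
        then have "p dvd fact 20" using p prime_gt_0_nat by (intro dvd_fact) (auto simp: Suc_le_eq)
        then have "p dvd A" using A by (auto intro!: dvd_mult dvd_power_same[THEN dvd_trans] dvd_trans[of p "fact 20" "fact 20 ^ 4"] dvd_power)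
        then have "p dvd A * m ^ 4" by simp
        moreover have "p dvd A * m ^ 4 + 1" using d by (metis dvd_mult_left power2_eq_square)
        ultimately have "p dvd 1" by (metis dvd_add_right_iff)
        then show False using p by simp
      next
        case False
        then have "m \<in> Bad" using m d p A by (auto simp: Bad_def F_def Ps_def As_def)
        then show False using m by simp
      qed
    qed
  qed
qed

text \<open>For k = 20! m neither of the two values has a small square factor, and abc excludes
  large ones in both at once; so k or 2 k serves.\<close>

lemma abc_squarefree_values:
  assumes "abc_conjecture_number_fields"
  shows "\<exists>k > B. even k \<and> squarefree (27 * k ^ 4 + 1 :: nat)"
proof -
  define Q :: nat where "Q = fact 20"
  have Q: "Q > 0" "even Q" by (simp_all add: Q_def dvd_fact)
  obtain M0 :: nat where M0:
    "\<And>M k p q. M \<ge> M0 \<Longrightarrow> M ^ 5 \<le> k \<Longrightarrow> k \<le> 2 * Q * M ^ 5 \<Longrightarrow>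
       Factorial_Ring.prime p \<Longrightarrow> p\<^sup>2 dvd 27 * k ^ 4 + 1 \<Longrightarrow> M ^ 3 < p \<Longrightarrow>
       Factorial_Ring.prime q \<Longrightarrow> q\<^sup>2 dvd 432 * k ^ 4 + 1 \<Longrightarrow> M ^ 3 < q \<Longrightarrow> False"
    using abc_no_pair_of_large_square_factors[OF assms, of "2 * Q"] Q by auto
  \<comment> \<open>Three demands at once: beyond the abc threshold, large enough for
    \<open>B < k\<close>, and at least 4 for the sieve.\<close>
  define M where "M = M0 + B + 4"
  have M4: "M \<ge> 4" by (simp add: M_def)
  from M4 obtain m where m: "M ^ 5 < m" "m \<le> 2 * M ^ 5"
    "\<And>p A. Factorial_Ring.prime p \<Longrightarrow> p \<le> M ^ 3 \<Longrightarrow> A = 27 * fact 20 ^ 4 \<or> A = 432 * fact 20 ^ 4 \<Longrightarrow>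
      \<not> p\<^sup>2 dvd A * m ^ 4 + 1"
    using exists_without_small_square_factors by blast
  define k where "k = Q * m"
  have "M ^ 5 \<ge> M" using M4 by (intro self_le_power) auto
  moreover have "m \<le> k" using Q by (simp add: k_def)
  ultimately have kB: "B < k" "M ^ 5 \<le> k" using m(1) by (simp_all add: M_def)
  have kle: "k \<le> 2 * Q * M ^ 5" using m(2) Q by (simp add: k_def)
  have small: "M ^ 3 < p" if "Factorial_Ring.prime p" "p\<^sup>2 dvd c * k ^ 4 + 1" "c = 27 \<or> c = 432" for p c
  proof (rule ccontr)
    assume "\<not> M ^ 3 < p"
    then have "\<not> p\<^sup>2 dvd (c * Q ^ 4) * m ^ 4 + 1" using m(3)[OF that(1), of "c * Q ^ 4"] that(3) by (auto simp: Q_def)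
    then show False using that(2) by (simp add: k_def power_mult_distrib mult.assoc)
  qed
  have sqf: "\<exists>p. Factorial_Ring.prime p \<and> p\<^sup>2 dvd n" if "\<not> squarefree n" "n > 0" for n :: nat
    using that by (simp add: squarefree_factorial_semiring)
  have "squarefree (27 * k ^ 4 + 1) \<or> squarefree (432 * k ^ 4 + 1)"
    using sqf[of "27 * k ^ 4 + 1"] sqf[of "432 * k ^ 4 + 1"] small M0[of M k] kB kle
    by (metis M_def le_add1 add.assoc zero_less_Suc Suc_eq_plus1)
  then show ?thesis
  proof
    assume "squarefree (27 * k ^ 4 + 1)"
    then show ?thesis using kB Q by (intro exI[of _ k]) (auto simp: k_def)
  next
    assume "squarefree (432 * k ^ 4 + 1)"
    then show ?thesis using kB by (intro exI[of _ "2 * k"]) (auto simp: power_mult_distrib)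
  qed
qed

section \<open>Algebraic integers\<close>

text \<open>The family \<open>v\<close> is a nonzero eigenvector, with eigenvalue \<open>x\<close>,
  of an integer matrix, whose characteristic polynomial is monic with integer coefficients.\<close>

lemma algebraic_int_if_stable_lattice:
  fixes v :: "'i \<Rightarrow> complex" and x :: complex
  assumes fin: "finite I" and nz: "\<exists>i\<in>I. v i \<noteq> 0"
    and stable: "\<And>i. i \<in> I \<Longrightarrow> \<exists>c::'i \<Rightarrow> int. x * v i = (\<Sum>j\<in>I. of_int (c j) * v j)"
  shows "algebraic_int x"
proof -
  define n where "n = card I"
  obtain h where h: "bij_betw h {0..<n} I"
    using ex_bij_betw_nat_finite[OF fin] unfolding n_def by blast
  from stable have "\<forall>i\<in>I. \<exists>c::'i \<Rightarrow> int. x * v i = (\<Sum>j\<in>I. of_int (c j) * v j)" by blast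
  then obtain C :: "'i \<Rightarrow> 'i \<Rightarrow> int"
    where C: "\<And>i. i \<in> I \<Longrightarrow> x * v i = (\<Sum>j\<in>I. of_int (C i j) * v j)" by metis
  define A :: "int mat" where "A = mat n n (\<lambda>(i, j). C (h i) (h j))"
  define B :: "complex mat" where "B = map_mat of_int A"
  define w where "w = vec n (\<lambda>i. v (h i))"
  have A: "A \<in> carrier_mat n n" and B: "B \<in> carrier_mat n n"
    by (auto simp: A_def B_def)
  have hI: "h i \<in> I" if "i < n" for i using h that by (auto simp: bij_betw_def)
  have "B *\<^sub>v w = x \<cdot>\<^sub>v w"
  proof (rule eq_vecI)
    fix i assume "i < dim_vec (x \<cdot>\<^sub>v w)"
    then have i: "i < n" by (simp add: w_def)
    have "(B *\<^sub>v w) $ i = (\<Sum>j = 0..<n. of_int (C (h i) (h j)) * v (h j))"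
      using i by (simp add: B_def A_def w_def scalar_prod_def)
    also have "\<dots> = (\<Sum>j\<in>I. of_int (C (h i) j) * v j)"
      by (rule sum.reindex_bij_betw[OF h])
    also have "\<dots> = x * v (h i)" using C[OF hI[OF i]] by simp
    finally show "(B *\<^sub>v w) $ i = (x \<cdot>\<^sub>v w) $ i" using i by (simp add: w_def)
  qed (use B in \<open>simp add: w_def\<close>)
  moreover have "w \<noteq> 0\<^sub>v n"
  proof -
    obtain i where i: "i \<in> I" "v i \<noteq> 0" using nz by blast
    then obtain m where m: "m < n" "h m = i" using h by (auto simp: bij_betw_def)
    have "w $ m \<noteq> (0\<^sub>v n) $ m" using m i by (simp add: w_def)
    then show ?thesis by auto
  qed
  ultimately have "eigenvector B w x"
    using B by (auto simp: eigenvector_def w_def)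
  then have "eigenvalue B x" unfolding eigenvalue_def by blast
  then have root: "poly (char_poly B) x = 0" using eigenvalue_root_char_poly[OF B] by blast
  have "char_poly B = map_poly of_int (char_poly A)"
    unfolding B_def by (rule of_int_hom.char_poly_hom[OF A])
  with root have "poly (map_poly of_int (char_poly A)) x = 0" by simp
  moreover have "Polynomial.lead_coeff (char_poly A) = 1"
    using degree_monic_char_poly[OF A] by simp
  ultimately show ?thesis unfolding algebraic_int_altdef_ipoly by blast
qed

text \<open>Spanned by an indexed family instead of a set, so that products x^i y^j may coincide
  without harm.\<close>

definition int_span :: "'i set \<Rightarrow> ('i \<Rightarrow> complex) \<Rightarrow> complex set" where
  "int_span I v = range (\<lambda>c :: 'i \<Rightarrow> int. \<Sum>i\<in>I. of_int (c i) * v i)"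

lemma int_spanI: "z = (\<Sum>i\<in>I. of_int (c i) * v i) \<Longrightarrow> z \<in> int_span I v"
  unfolding int_span_def by auto

lemma int_span_0: "0 \<in> int_span I v"
  unfolding int_span_def by (rule image_eqI[where x = "\<lambda>_. 0"]) auto

lemma int_span_add:
  assumes "a \<in> int_span I v" "b \<in> int_span I v"
  shows "a + b \<in> int_span I v"
proof -
  obtain c d :: "'a \<Rightarrow> int"
    where "a = (\<Sum>i\<in>I. of_int (c i) * v i)" "b = (\<Sum>i\<in>I. of_int (d i) * v i)"
    using assms unfolding int_span_def by blast
  then have "a + b = (\<Sum>i\<in>I. of_int (c i + d i) * v i)" by (simp add: algebra_simps sum.distrib)
  then show ?thesis by (rule int_spanI[where c = "\<lambda>i. c i + d i"])
qed

lemma int_span_scale: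
  assumes "a \<in> int_span I v"
  shows "of_int n * a \<in> int_span I v"
proof -
  obtain c :: "'a \<Rightarrow> int" where "a = (\<Sum>i\<in>I. of_int (c i) * v i)"
    using assms unfolding int_span_def by blast
  then have "of_int n * a = (\<Sum>i\<in>I. of_int (n * c i) * v i)"
    by (simp add: sum_distrib_left mult.assoc)
  then show ?thesis by (rule int_spanI[where c = "\<lambda>i. n * c i"])
qed

lemma int_span_sum: "(\<And>j. j \<in> J \<Longrightarrow> f j \<in> int_span I v) \<Longrightarrow> (\<Sum>j\<in>J. f j) \<in> int_span I v"
  by (induction J rule: infinite_finite_induct) (auto simp: int_span_0 int_span_add)

lemma int_span_base:
  assumes "finite I" "i \<in> I"
  shows "v i \<in> int_span I v"
proof -
  have "(\<Sum>j\<in>I. of_int (if j = i then 1 else 0) * v j) = (\<Sum>j\<in>I. if j = i then v j else 0)"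
    by (rule sum.cong) simp_all
  also have "\<dots> = v i" using assms by simp
  finally have "v i = (\<Sum>j\<in>I. of_int (if j = i then 1 else 0) * v j)" ..
  then show ?thesis by (rule int_spanI[where c = "\<lambda>j. if j = i then 1 else 0"])
qed

lemma int_span_mult:
  assumes "\<And>i. i \<in> I \<Longrightarrow> x * v i \<in> int_span I v" and "z \<in> int_span I v"
  shows "x * z \<in> int_span I v"
proof -
  obtain c :: "'a \<Rightarrow> int" where "z = (\<Sum>i\<in>I. of_int (c i) * v i)"
    using assms(2) by (auto simp: int_span_def)
  then have "x * z = (\<Sum>i\<in>I. of_int (c i) * (x * v i))"
    by (simp add: sum_distrib_left mult.left_commute)
  also have "\<dots> \<in> int_span I v" by (intro int_span_sum int_span_scale assms(1))
  finally show ?thesis .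
qed

lemma algebraic_int_if_int_span_stable:
  assumes "finite I" "\<exists>i\<in>I. v i \<noteq> 0" "\<And>i. i \<in> I \<Longrightarrow> x * v i \<in> int_span I v"
  shows "algebraic_int x"
  by (rule algebraic_int_if_stable_lattice[OF assms(1,2)])
     (use assms(3) in \<open>auto simp: int_span_def\<close>)

lemma algebraic_int_power_relation:
  fixes x :: complex
  assumes "algebraic_int x"
  obtains n and c :: "nat \<Rightarrow> int" where "n > 0" "x ^ n = (\<Sum>i<n. of_int (c i) * x ^ i)"
proof -
  obtain p :: "int poly" where p: "poly (map_poly of_int p) x = 0" "Polynomial.lead_coeff p = 1"
    using assms unfolding algebraic_int_altdef_ipoly by blast
  define n where "n = Polynomial.degree p"
  have "0 = poly (map_poly of_int p) x" using p by simp
  also have "\<dots> = (\<Sum>i\<le>n. of_int (Polynomial.coeff p i) * x ^ i)"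
    by (simp add: poly_altdef n_def coeff_map_poly degree_map_poly)
  also have "{..n} = insert n {..<n}" by auto
  also have "(\<Sum>i\<in>\<dots>. of_int (Polynomial.coeff p i) * x ^ i)
      = x ^ n + (\<Sum>i<n. of_int (Polynomial.coeff p i) * x ^ i)"
    using p by (simp add: n_def)
  finally have eq: "x ^ n = (\<Sum>i<n. of_int (- Polynomial.coeff p i) * x ^ i)"
    by (simp add: sum_negf eq_neg_iff_add_eq_0)
  have "n > 0" using eq by (intro Nat.gr0I) auto
  then show ?thesis using eq by (rule that)
qed

text \<open>The lattice of the products x^i y^j, with exponents below the degrees of the integral
  equations, is stable under multiplication by \<open>x\<close> and by \<open>y\<close>, hence by
  their sum and product.\<close>

lemma algebraic_int_closed_aux:
  fixes x y :: complex
  assumes "algebraic_int x" "algebraic_int y"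
  shows "algebraic_int (x + y)" "algebraic_int (x * y)"
proof -
  obtain m a where m: "m > 0" and x: "x ^ m = (\<Sum>i<m. of_int (a i :: int) * x ^ i)"
    using algebraic_int_power_relation[OF assms(1)] by metis
  obtain n b where n: "n > 0" and y: "y ^ n = (\<Sum>i<n. of_int (b i :: int) * y ^ i)"
    using algebraic_int_power_relation[OF assms(2)] by metis
  define I where "I = {..<m} \<times> {..<n}"
  define v where "v = (\<lambda>(i::nat, j::nat). x ^ i * y ^ j)"
  let ?S = "int_span I v"
  have fin: "finite I" by (simp add: I_def)
  have nz: "\<exists>i\<in>I. v i \<noteq> 0" using m n by (intro bexI[of _ "(0, 0)"]) (auto simp: I_def v_def)
  have base: "x ^ i * y ^ j \<in> ?S" if "i < m" "j < n" for i j
    using int_span_base[OF fin, of "(i, j)" v] that by (auto simp: I_def v_def)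
  have xS: "x * v p \<in> ?S" if "p \<in> I" for p
  proof -
    obtain i j where p: "p = (i, j)" "i < m" "j < n" using \<open>p \<in> I\<close> unfolding I_def by blast
    show ?thesis
    proof (cases "Suc i < m")
      case True
      then show ?thesis using base[of "Suc i" j] p by (simp add: v_def mult.assoc)
    next
      case False
      then have "Suc i = m" using p by simp
      then have "x * v p = x ^ m * y ^ j" using p by (auto simp: v_def)
      also have "\<dots> = (\<Sum>i<m. of_int (a i) * (x ^ i * y ^ j))"
        by (simp add: x sum_distrib_right mult.assoc)
      also have "\<dots> \<in> ?S" by (intro int_span_sum int_span_scale base) (use p in auto)
      finally show ?thesis .
    qed
  qed
  have yS: "y * v p \<in> ?S" if "p \<in> I" for p
  proof -
    obtain i j where p: "p = (i, j)" "i < m" "j < n" using \<open>p \<in> I\<close> unfolding I_def by blast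
    show ?thesis
    proof (cases "Suc j < n")
      case True
      then show ?thesis using base[of i "Suc j"] p by (simp add: v_def mult.left_commute)
    next
      case False
      then have "Suc j = n" using p by simp
      then have "y * v p = x ^ i * y ^ n" using p by (auto simp: v_def)
      also have "\<dots> = (\<Sum>j<n. of_int (b j) * (x ^ i * y ^ j))"
        by (simp add: y sum_distrib_left mult.left_commute)
      also have "\<dots> \<in> ?S" by (intro int_span_sum int_span_scale base) (use p in auto)
      finally show ?thesis .
    qed
  qed
  show "algebraic_int (x + y)"
    by (rule algebraic_int_if_int_span_stable[OF fin nz])
       (simp add: distrib_right int_span_add xS yS)
  show "algebraic_int (x * y)"
    by (rule algebraic_int_if_int_span_stable[OF fin nz])
       (simp add: mult.assoc int_span_mult[OF xS] yS)
qed

lemmas algebraic_int_add [intro] = algebraic_int_closed_aux(1)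
lemmas algebraic_int_mult [intro] = algebraic_int_closed_aux(2)

lemma algebraic_int_diff [intro]:
  fixes x y :: complex shows "algebraic_int x \<Longrightarrow> algebraic_int y \<Longrightarrow> algebraic_int (x - y)"
  using algebraic_int_add[of x "- y"] by auto

lemma algebraic_int_power [intro]:
  fixes x :: complex shows "algebraic_int x \<Longrightarrow> algebraic_int (x ^ n)"
  by (induction n) auto

text \<open>Dividing an integral equation of \<open>x\<close> by its lowest power of \<open>x\<close> exhibits
  \<open>1 / x\<close> as a polynomial in \<open>x\<close>.\<close>

lemma inverse_in_subring:
  fixes S :: "complex set"
  assumes S: "\<rat> \<subseteq> S" "\<And>a b. a \<in> S \<Longrightarrow> b \<in> S \<Longrightarrow> a + b \<in> S"
    "\<And>a b. a \<in> S \<Longrightarrow> b \<in> S \<Longrightarrow> a * b \<in> S"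
    and x: "x \<in> S" "m \<noteq> 0" "algebraic_int (of_int m * x)"
  shows "inverse x \<in> S"
proof (cases "x = 0")
  case True
  then show ?thesis using S(1) by auto
next
  case False
  let ?y = "of_int m * x"
  have y: "?y \<in> S" "?y \<noteq> 0" using S x False by (auto simp: subset_iff)
  obtain p :: "int poly" where p: "poly (map_poly of_int p) ?y = 0" "Polynomial.lead_coeff p = 1"
    using x(3) unfolding algebraic_int_altdef_ipoly by blast
  have polyS: "poly (map_poly of_int q) ?y \<in> S" for q :: "int poly"
  proof (induction q)
    case 0
    then show ?case using S(1) by auto
  next
    case (pCons a q)
    then show ?case using S y by (auto simp: map_poly_pCons subset_iff)
  qed
  have "p \<noteq> 0 \<Longrightarrow> poly (map_poly of_int p) ?y = 0 \<Longrightarrow> inverse ?y \<in> S"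
  proof (induction p)
    case (pCons a p)
    show ?case
    proof (cases "a = 0")
      case True
      \<comment> \<open>With a vanishing constant term one factor \<open>?y\<close> cancels and the
        induction hypothesis applies.\<close>
      then show ?thesis using pCons y by (auto simp: map_poly_pCons)
    next
      case False
      let ?h = "poly (map_poly of_int p) ?y"
      have "of_int a + ?y * ?h = 0" using pCons.prems by (simp add: map_poly_pCons)
      then have "?y * ?h = - of_int a" by (simp add: eq_neg_iff_add_eq_0 add.commute)
      then have "?y * (of_rat (- 1 / of_int a) * ?h) = 1"
        using False by (simp only: mult.left_commute[of ?y]) (simp add: of_rat_divide of_rat_minus)
      then have "inverse ?y = of_rat (- 1 / of_int a) * ?h" by (rule inverse_unique)
      also have "\<dots> \<in> S" using S polyS by (auto simp: subset_iff)
      finally show ?thesis .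
    qed
  qed simp
  moreover have "p \<noteq> 0" using p by auto
  ultimately have yS: "inverse ?y \<in> S" using p(1) by blast
  have "inverse x = of_int m * inverse ?y" using x(2) by simp
  moreover have "of_int m \<in> S" using S(1) by auto
  ultimately show ?thesis using S(3) yS by metis
qed

section \<open>The quartic and its roots\<close>

interpretation of_rat_poly: map_poly_comm_ring_hom "of_rat :: rat \<Rightarrow> complex" ..

text \<open>Elements of the field of a root are written \<open>rp p (r i)\<close>; conjugation then
  keeps \<open>p\<close> and changes \<open>i\<close>.\<close>

definition rp :: "rat poly \<Rightarrow> complex \<Rightarrow> complex" where
  "rp p z = poly (map_poly of_rat p) z"

lemma rp_0 [simp]: "rp 0 z = 0"
  and rp_1 [simp]: "rp 1 z = 1"
  and rp_pCons [simp]: "rp (pCons c p) z = of_rat c + z * rp p z"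
  and rp_add [simp]: "rp (p + q) z = rp p z + rp q z"
  and rp_diff [simp]: "rp (p - q) z = rp p z - rp q z"
  and rp_minus [simp]: "rp (- p) z = - rp p z"
  and rp_mult [simp]: "rp (p * q) z = rp p z * rp q z"
  and rp_pcompose [simp]: "rp (pcompose p q) z = rp p (rp q z)"
  and rp_of_rat: "rp p (of_rat c) = of_rat (poly p c)"
  by (simp_all add: rp_def of_rat_poly.hom_add of_rat_poly.hom_minus of_rat_poly.hom_uminus
      of_rat_poly.hom_mult of_rat_hom.map_poly_pCons_hom
      of_rat_hom.map_poly_pcompose poly_pcompose)

lemma rp_smult [simp]: "rp (Polynomial.smult c p) z = of_rat c * rp p z"
  using rp_mult[of "[:c:]" p z] by simp

lemma rp_of_int_poly: "rp (map_poly of_int p) z = poly (map_poly of_int p) z"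
  by (induction p) (simp_all add: map_poly_pCons)

lemma of_rat_in_Rats_iff: "(x :: complex) \<in> \<rat> \<longleftrightarrow> (\<exists>q. x = of_rat q)"
  by (auto simp: Rats_def)

text \<open>Both \<open>x\<close> and \<open>h\<close> are rational algebraic integers, hence
  integers. The fourth power fits the relation of \<open>shifted_root\<close>.\<close>

lemma even_if_square_relation:
  fixes x :: complex
  assumes "algebraic_int x" "x \<in> \<rat>" "algebraic_int h" "x ^ 4 = 2 * h"
  obtains n where "x = of_int n" "even n"
proof -
  obtain n where n: "x = of_int n"
    using rational_algebraic_int_is_int[OF assms(1,2)] by (auto elim: Ints_cases)
  have h: "h = of_int (n ^ 4) / 2" using assms(4) n by simp
  then have "h \<in> \<rat>" by (metis Rats_divide Rats_of_int Rats_number_of)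
  then obtain m where "h = of_int m"
    using rational_algebraic_int_is_int[OF assms(3)] by (auto elim: Ints_cases)
  then have "of_int (n ^ 4) = (of_int (2 * m) :: complex)" using h by simp
  then have "n ^ 4 = 2 * m" by (simp only: of_int_eq_iff)
  then have "even (n ^ 4)" by simp
  then show ?thesis using n that by simp
qed

lemma index_set_4: "{1..4} = {1, 2, 3, 4 :: nat}"
  by auto

text \<open>The roots enter with an arbitrary labelling, so that facts about \<open>r 1\<close> and
  \<open>r 2\<close> pass to every other pair by interpreting the locale at permuted roots.\<close>

locale A4_quartic =
  fixes k :: int and r :: "nat \<Rightarrow> complex"
  assumes k_nonzero: "k \<noteq> 0" and k_even: "even k" and squarefree_d: "squarefree (27 * k ^ 4 + 1)"
    and factorization: "[:of_int (27 * k ^ 4 + 1), 0, 0, of_int (4 * k), 1:]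
      = [:- r 1, 1:] * [:- r 2, 1:] * [:- r 3, 1:] * [:- r 4, 1:]"
begin

definition d :: int where "d = 27 * k ^ 4 + 1"

definition F :: "rat poly" where "F = [:of_int d, 0, 0, of_int (4 * k), 1:]"

lemma d_gt_1: "d > 1"
  using k_nonzero by (simp add: d_def)

lemma degree_F: "Polynomial.degree F = 4" and lead_coeff_F: "Polynomial.lead_coeff F = 1"
  by (simp_all add: F_def)

lemma Vieta:
  "r 1 + r 2 + r 3 + r 4 = - of_int (4 * k)"
  "r 1 * r 2 + r 1 * r 3 + r 1 * r 4 + r 2 * r 3 + r 2 * r 4 + r 3 * r 4 = 0"
  "r 1 * r 2 * r 3 + r 1 * r 2 * r 4 + r 1 * r 3 * r 4 + r 2 * r 3 * r 4 = 0"
  "r 1 * r 2 * r 3 * r 4 = of_int d"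
proof -
  have e: "[:of_int (27 * k ^ 4 + 1), 0, 0, of_int (4 * k), 1:] =
    [: r 1 * r 2 * r 3 * r 4, - (r 1 * r 2 * r 3 + r 1 * r 2 * r 4 + r 1 * r 3 * r 4 + r 2 * r 3 * r 4),
     r 1 * r 2 + r 1 * r 3 + r 1 * r 4 + r 2 * r 3 + r 2 * r 4 + r 3 * r 4,
     - (r 1 + r 2 + r 3 + r 4), 1:]"
    unfolding factorization by (simp add: algebra_simps)
  show "r 1 + r 2 + r 3 + r 4 = - of_int (4 * k)"
    "r 1 * r 2 + r 1 * r 3 + r 1 * r 4 + r 2 * r 3 + r 2 * r 4 + r 3 * r 4 = 0"
    "r 1 * r 2 * r 3 + r 1 * r 2 * r 4 + r 1 * r 3 * r 4 + r 2 * r 3 * r 4 = 0"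
    "r 1 * r 2 * r 3 * r 4 = of_int d"
    using e unfolding d_def pCons_eq_iff by (metis minus_minus neg_equal_0_iff_equal)+
qed

lemma F_at: "rp F x = (x - r 1) * (x - r 2) * (x - r 3) * (x - r 4)"
proof -
  have "rp F x = poly [:of_int (27 * k ^ 4 + 1), 0, 0, of_int (4 * k), 1:] x"
    by (simp add: F_def d_def of_rat_add of_rat_mult of_rat_power)
  also have "\<dots> = (x - r 1) * (x - r 2) * (x - r 3) * (x - r 4)"
    unfolding factorization by (simp add: algebra_simps)
  finally show ?thesis .
qed

lemma F_at_expand: "rp F x = x ^ 4 + of_int (4 * k) * x ^ 3 + of_int d"
  by (simp add: F_def algebra_simps power_numeral_reduce of_rat_mult)

lemma root_iff: "rp F x = 0 \<longleftrightarrow> (\<exists>i\<in>{1..4}. x = r i)"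
  unfolding F_at index_set_4 by auto

lemma root: "i \<in> {1..4} \<Longrightarrow> rp F (r i) = 0"
  using root_iff by blast

lemma root_eq:
  assumes "i \<in> {1..4}"
  shows "r i ^ 4 = - of_int (4 * k) * r i ^ 3 - of_int d"
  using root[OF assms] unfolding F_at_expand by (simp add: algebra_simps eq_neg_iff_add_eq_0)

lemma algebraic_int_root: "i \<in> {1..4} \<Longrightarrow> algebraic_int (r i)"
  unfolding algebraic_int_altdef_ipoly
proof (intro exI conjI)
  assume i: "i \<in> {1..4}"
  have "rp F (r i) = poly (map_poly of_int [:d, 0, 0, 4 * k, 1:]) (r i)"
    by (simp add: F_def map_poly_pCons of_rat_mult)
  then show "poly (map_poly of_int [:d, 0, 0, 4 * k, 1:]) (r i) = 0" using root[OF i] by simp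
qed simp

text \<open>In the Taylor expansion of \<open>F\<close> at 1 all coefficients below the leading one
  are even for even \<open>k\<close>, and \<open>h\<close> is minus half of that lower part. This is
  the Eisenstein property at 2, used for irreducibility and again in
  \<open>prime_step_2\<close>.\<close>

lemma shifted_root:
  assumes "rp F x = 0"
  shows "\<exists>h. algebraic_int h \<and> (1 - x) ^ 4 = 2 * h"
proof -
  obtain i where i: "i \<in> {1..4}" "x = r i" using assms root_iff by blast
  obtain j where j: "k = 2 * j" using k_even by blast
  let ?y = "x - 1"
  define h where "h = - (of_int (2 + 4 * j) * ?y ^ 3 + of_int (3 + 12 * j) * ?y ^ 2
      + of_int (2 + 12 * j) * ?y + of_int (1 + 4 * j + 216 * j ^ 4))"
  have x: "algebraic_int x" using i algebraic_int_root by simp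
  have "algebraic_int h" unfolding h_def
    by (intro algebraic_int_minus algebraic_int_add algebraic_int_mult algebraic_int_power
        algebraic_int_diff algebraic_int_of_int x algebraic_int_1)
  moreover have "(1 - x) ^ 4 - 2 * h = rp F x"
    unfolding F_at_expand d_def unfolding h_def j
    by (simp add: algebra_simps power_numeral_reduce)
  ultimately show ?thesis using assms by auto
qed

text \<open>Two factors of \<open>F\<close> would both be even at 1, whereas \<open>F(1)\<close> is 2 modulo 4.\<close>

lemma F_at_1: "poly F 1 = of_int (2 + 4 * k + 27 * k ^ 4)"
  by (simp add: F_def d_def)

lemma F1_mod_4: "even (2 + 4 * k + 27 * k ^ 4)" "\<not> 4 dvd 2 + 4 * k + 27 * k ^ 4"
proof -
  obtain j where "k = 2 * j" using k_even by blast
  then have e: "2 + 4 * k + 27 * k ^ 4 = 4 * (2 * j + 108 * j ^ 4) + 2"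
    by (simp add: power_mult_distrib)
  show "even (2 + 4 * k + 27 * k ^ 4)" "\<not> 4 dvd 2 + 4 * k + 27 * k ^ 4"
    unfolding e by presburger+
qed

text \<open>The value of \<open>g\<close> at 1 is the product of 1 - x over the complex roots of
  \<open>g\<close>, which are roots of \<open>F\<close>. By \<open>shifted_root\<close> its fourth
  power is twice an algebraic integer, and being rational it is an even integer. Rational factors
  are treated directly, without Gauss's lemma.\<close>

lemma monic_factor_at_1:
  assumes g: "g dvd F" "Polynomial.lead_coeff g = 1" "Polynomial.degree g > 0"
  obtains n where "poly g 1 = of_int n" "even n"
proof -
  define G where "G = (map_poly of_rat g :: complex poly)"
  have G: "Polynomial.lead_coeff G = 1" "Polynomial.degree G > 0"
    using g by (simp_all add: G_def)
  define A where "A = proots G"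
  have G0: "G \<noteq> 0" using G by auto
  have Gp: "G = (\<Prod>x\<in>#A. [:- x, 1:])"
    using complex_poly_decompose_multiset[of G] G by (simp add: A_def)
  have A: "rp F x = 0" if "x \<in># A" for x
  proof -
    have "rp g x = 0" using that G0 by (simp add: A_def G_def rp_def)
    then show ?thesis using g(1) by (auto simp: dvd_def)
  qed
  have "A \<noteq> {#}" using size_proots_complex[of G] G(2) by (auto simp: A_def)
  have "(\<forall>x\<in>#B. rp F x = 0) \<Longrightarrow> algebraic_int (\<Prod>x\<in>#B. 1 - x) \<and>
      (B \<noteq> {#} \<longrightarrow> (\<exists>h. algebraic_int h \<and> (\<Prod>x\<in>#B. 1 - x) ^ 4 = 2 * h))" for B
  proof (induction B)
    case (add x B)
    obtain h where h: "algebraic_int h" "(1 - x) ^ 4 = 2 * h" using shifted_root add.prems by auto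
    have "algebraic_int x" using algebraic_int_root root_iff add.prems by auto
    moreover have "algebraic_int (\<Prod>x\<in>#B. 1 - x)" using add by simp
    moreover have "((1 - x) * (\<Prod>x\<in>#B. 1 - x)) ^ 4 = 2 * (h * (\<Prod>x\<in>#B. 1 - x) ^ 4)"
      by (simp add: power_mult_distrib h)
    ultimately show ?case using h by auto
  qed simp
  then obtain h where h: "algebraic_int (\<Prod>x\<in>#A. 1 - x)" "algebraic_int h" "(\<Prod>x\<in>#A. 1 - x) ^ 4 = 2 * h"
    using A \<open>A \<noteq> {#}\<close> by meson
  have "of_rat (poly g 1) = rp g (of_rat 1)" by (simp only: rp_of_rat)
  also have "\<dots> = poly G 1" by (simp add: rp_def G_def)
  also have "\<dots> = (\<Prod>x\<in>#A. 1 - x)" unfolding Gp by (simp add: poly_prod_mset image_mset.compositionality comp_def)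
  finally have eq: "of_rat (poly g 1) = (\<Prod>x\<in>#A. 1 - x)" .
  then have "(\<Prod>x\<in>#A. 1 - x) \<in> \<rat>" by (metis Rats_of_rat)
  then obtain n where n: "(\<Prod>x\<in>#A. 1 - x) = of_int n" "even n"
    using even_if_square_relation[OF h(1) _ h(2,3)] by blast
  then have "(of_rat (poly g 1) :: complex) = of_rat (of_int n)" using eq by simp
  then have "poly g 1 = of_int n" by (simp only: of_rat_eq_iff)
  then show ?thesis using n(2) that by blast
qed

lemma irreducible_F: "Factorial_Ring.irreducible F"
proof (rule irreducibleI)
  show "F \<noteq> 0" by (simp add: F_def)
  show "\<not> is_unit F" using degree_F by (auto dest: is_unit_iff_degree[THEN iffD1, rotated] simp: F_def)
  fix g h assume gh: "F = g * h"
  have nz: "g \<noteq> 0" "h \<noteq> 0" using gh by (auto simp: F_def)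
  show "is_unit g \<or> is_unit h"
  proof (rule ccontr)
    assume "\<not> (is_unit g \<or> is_unit h)"
    then have deg: "Polynomial.degree g > 0" "Polynomial.degree h > 0"
      using nz by (simp_all add: is_unit_iff_degree)
    define c where "c = Polynomial.lead_coeff g"
    have c: "c \<noteq> 0" "Polynomial.lead_coeff h = 1 / c"
      using nz lead_coeff_F unfolding gh c_def Polynomial.lead_coeff_mult by (simp_all add: field_simps)
    define g' where "g' = Polynomial.smult (1 / c) g"
    define h' where "h' = Polynomial.smult c h"
    have gh': "F = g' * h'" using c by (simp add: g'_def h'_def gh)
    have "Polynomial.lead_coeff g' = 1" "Polynomial.lead_coeff h' = 1"
      using c by (simp_all add: g'_def h'_def c_def)
    moreover have "Polynomial.degree g' > 0" "Polynomial.degree h' > 0"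
      using deg c by (simp_all add: g'_def h'_def)
    ultimately obtain m n where mn: "poly g' 1 = of_int m" "even m" "poly h' 1 = of_int n" "even n"
      using monic_factor_at_1[of g'] monic_factor_at_1[of h'] gh' by (metis dvd_triv_left dvd_triv_right)
    have "of_int (2 + 4 * k + 27 * k ^ 4) = (of_int (m * n) :: rat)"
      unfolding F_at_1[symmetric] gh' using mn by simp
    then have "2 + 4 * k + 27 * k ^ 4 = m * n" by (simp only: of_int_eq_iff)
    moreover have "2 * 2 dvd m * n" using mn by (intro mult_dvd_mono) auto
    ultimately show False using F1_mod_4 by simp
  qed
qed

section \<open>Conjugation between the roots\<close>

lemma F_dvd:
  assumes "i \<in> {1..4}" "rp p (r i) = 0"
  shows "F dvd p"
proof (rule ccontr)
  assume "\<not> F dvd p"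
  then have "Rings.coprime F p"
  proof -
    have "prime_elem F" using irreducible_F by (rule irreducible_imp_prime_elem)
    then show ?thesis using \<open>\<not> F dvd p\<close> by (rule prime_elem_imp_coprime)
  qed
  then obtain u v where "u * F + v * p = 1" using bezout_coefficients_fst_snd[of F p]
    by (metis coprime_iff_gcd_eq_1)
  then have "rp (u * F + v * p) (r i) = 1" by simp
  then show False using assms root by simp
qed

text \<open>This plays the part of the isomorphism between the fields of \<open>r i\<close> and
  \<open>r j\<close>.\<close>

lemma conjugate_zero:
  assumes "i \<in> {1..4}" "rp p (r i) = 0" "j \<in> {1..4}"
  shows "rp p (r j) = 0"
  using F_dvd[OF assms(1,2)] root[OF assms(3)] by (auto simp: dvd_def)

lemma conjugate_eq:
  assumes "i \<in> {1..4}" "rp p (r i) = rp q (r i)" "j \<in> {1..4}"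
  shows "rp p (r j) = rp q (r j)"
  using conjugate_zero[OF assms(1) _ assms(3), of "p - q"] assms(2) by simp

text \<open>A monic integral equation of the element, composed with \<open>p\<close>, is a rational
  relation for the root \<open>r i\<close> and passes to \<open>r j\<close>.\<close>

lemma conjugate_algebraic_int:
  assumes "i \<in> {1..4}" "algebraic_int (rp p (r i))" "j \<in> {1..4}"
  shows "algebraic_int (rp p (r j))"
proof -
  obtain m :: "int poly" where m: "poly (map_poly of_int m) (rp p (r i)) = 0" "Polynomial.lead_coeff m = 1"
    using assms(2) unfolding algebraic_int_altdef_ipoly by blast
  have "rp (pcompose (map_poly of_int m) p) (r i) = 0" using m by (simp add: rp_of_int_poly)
  then have "rp (pcompose (map_poly of_int m) p) (r j) = 0" using conjugate_zero assms by blast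
  then show ?thesis using m(2) unfolding algebraic_int_altdef_ipoly by (auto simp: rp_of_int_poly)
qed

end

section \<open>Derivative, discriminant and traces\<close>

lemma product_of_root_differences:
  fixes t1 t2 t3 t4 :: "'a :: comm_ring_1"
  shows "(t1 - t2) * (t1 - t3) * (t1 - t4) = 4 * t1 ^ 3 - 3 * (t1 + t2 + t3 + t4) * t1 ^ 2
    + 2 * (t1 * t2 + t1 * t3 + t1 * t4 + t2 * t3 + t2 * t4 + t3 * t4) * t1
    - (t1 * t2 * t3 + t1 * t2 * t4 + t1 * t3 * t4 + t2 * t3 * t4)"
  by (simp add: algebra_simps power2_eq_square power3_eq_cube)

lemma Newton_identities:
  fixes t1 t2 t3 t4 :: "'a :: comm_ring_1"
  shows "t1 ^ 2 + t2 ^ 2 + t3 ^ 2 + t4 ^ 2 = (t1 + t2 + t3 + t4) ^ 2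
      - 2 * (t1 * t2 + t1 * t3 + t1 * t4 + t2 * t3 + t2 * t4 + t3 * t4)"
    and "t1 ^ 3 + t2 ^ 3 + t3 ^ 3 + t4 ^ 3 = (t1 + t2 + t3 + t4) ^ 3
      - 3 * (t1 + t2 + t3 + t4) * (t1 * t2 + t1 * t3 + t1 * t4 + t2 * t3 + t2 * t4 + t3 * t4)
      + 3 * (t1 * t2 * t3 + t1 * t2 * t4 + t1 * t3 * t4 + t2 * t3 * t4)"
  by (simp_all add: algebra_simps power2_eq_square power3_eq_cube)

context A4_quartic
begin

text \<open>A square root of the discriminant, whose sign depends on the labelling.\<close>

definition delta :: complex where
  "delta = (r 1 - r 2) * (r 1 - r 3) * (r 1 - r 4) * (r 2 - r 3) * (r 2 - r 4) * (r 3 - r 4)"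

text \<open>The left sides are the values at the roots of the derivative of \<open>F\<close>, which
  is 4 x^2 (x + 3 k).\<close>

lemma derivative_at_roots:
  "(r 1 - r 2) * (r 1 - r 3) * (r 1 - r 4) = 4 * r 1 ^ 2 * (r 1 + of_int (3 * k))"
  "(r 2 - r 1) * (r 2 - r 3) * (r 2 - r 4) = 4 * r 2 ^ 2 * (r 2 + of_int (3 * k))"
  "(r 3 - r 1) * (r 3 - r 2) * (r 3 - r 4) = 4 * r 3 ^ 2 * (r 3 + of_int (3 * k))"
  "(r 4 - r 1) * (r 4 - r 2) * (r 4 - r 3) = 4 * r 4 ^ 2 * (r 4 + of_int (3 * k))"
  using Vieta(1-3) product_of_root_differences[of "r 1" "r 2" "r 3" "r 4"]
    product_of_root_differences[of "r 2" "r 1" "r 3" "r 4"]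
    product_of_root_differences[of "r 3" "r 1" "r 2" "r 4"]
    product_of_root_differences[of "r 4" "r 1" "r 2" "r 3"]
  by (simp_all add: algebra_simps power2_eq_square power3_eq_cube)

lemma prod_shifted_roots: "(r 1 + x) * (r 2 + x) * (r 3 + x) * (r 4 + x) = rp F (- x)"
  unfolding F_at by (simp add: algebra_simps)

text \<open>The discriminant is the product of the four derivatives, that is 256 d^2 times the
  product of the r i + 3 k. The latter is the value of \<open>F\<close> at -3 k, which the choice of
  \<open>d\<close> makes 1.\<close>

lemma delta_square: "delta ^ 2 = of_int (16 * d) ^ 2"
proof -
  have "delta ^ 2 = ((r 1 - r 2) * (r 1 - r 3) * (r 1 - r 4)) * ((r 2 - r 1) * (r 2 - r 3) * (r 2 - r 4))
      * ((r 3 - r 1) * (r 3 - r 2) * (r 3 - r 4)) * ((r 4 - r 1) * (r 4 - r 2) * (r 4 - r 3))"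
  proof -
    have "r 2 - r 1 = - (r 1 - r 2)" "r 3 - r 1 = - (r 1 - r 3)" "r 4 - r 1 = - (r 1 - r 4)"
      "r 3 - r 2 = - (r 2 - r 3)" "r 4 - r 2 = - (r 2 - r 4)" "r 4 - r 3 = - (r 3 - r 4)" by simp_all
    then show ?thesis unfolding delta_def power2_eq_square
      by (simp only: mult_minus_left mult_minus_right minus_minus mult_ac)
  qed
  also have "\<dots> = 256 * (r 1 * r 2 * r 3 * r 4) ^ 2 *
      ((r 1 + of_int (3 * k)) * (r 2 + of_int (3 * k)) * (r 3 + of_int (3 * k)) * (r 4 + of_int (3 * k)))"
    unfolding derivative_at_roots by (simp add: power_mult_distrib mult_ac)
  also have "\<dots> = 256 * of_int d ^ 2" unfolding prod_shifted_roots Vieta(4) F_at_expand d_def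
    by (simp add: power_mult_distrib power_numeral_reduce)
  finally show ?thesis by (simp add: power_mult_distrib)
qed

lemma delta_cases: "delta = of_int (16 * d) \<or> delta = - of_int (16 * d)"
  using delta_square power2_eq_iff by blast

lemma delta_nonzero: "delta \<noteq> 0"
  using delta_square d_gt_1 by (auto simp: power2_eq_square)

lemma delta_Rats: "delta \<in> \<rat>"
  using delta_cases by (metis Rats_minus_iff Rats_of_int)

lemma inj_roots: "inj_on r {1..4}"
  using delta_nonzero unfolding delta_def index_set_4 by (auto simp: inj_on_def)

lemma power_sum_Rats: "r 1 ^ n + r 2 ^ n + r 3 ^ n + r 4 ^ n \<in> \<rat>"
proof (induction n rule: less_induct)
  case (less n)
  let ?a = "of_int (4 * k) :: complex"
  consider "n = 0" | "n = 1" | "n = 2" | "n = 3" | "n \<ge> 4" by linarith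
  then show ?case
  proof cases
    case 1
    then show ?thesis by simp
  next
    case 2
    then show ?thesis using Vieta(1) by simp
  next
    case 3
    show ?thesis unfolding 3 Newton_identities(1) Vieta by simp
  next
    case 4
    show ?thesis unfolding 4 Newton_identities(2) Vieta by simp
  next
    case 5
    define m where "m = n - 4"
    have n: "n = m + 4" using 5 by (simp add: m_def)
    have rec: "r i ^ n = - ?a * r i ^ (m + 3) - of_int d * r i ^ m" if "i \<in> {1..4}" for i
    proof -
      have "r i ^ n = r i ^ m * r i ^ 4" by (simp add: n power_add)
      also have "\<dots> = r i ^ m * (- ?a * r i ^ 3 - of_int d)" by (simp only: root_eq[OF that])
      finally show ?thesis by (simp add: algebra_simps power_add)
    qed
    have "r 1 ^ n + r 2 ^ n + r 3 ^ n + r 4 ^ n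
        = - ?a * (r 1 ^ (m + 3) + r 2 ^ (m + 3) + r 3 ^ (m + 3) + r 4 ^ (m + 3))
          - of_int d * (r 1 ^ m + r 2 ^ m + r 3 ^ m + r 4 ^ m)"
    proof -
      note rec' = rec[of 1] rec[of 2] rec[of 3] rec[of 4]
      show ?thesis by (simp only: rec' index_set_4 insert_iff simp_thms) (simp add: algebra_simps)
    qed
    also have "\<dots> \<in> \<rat>" using less[of "m + 3"] less[of m] n
      by (intro Rats_diff Rats_mult) auto
    finally show ?thesis .
  qed
qed

lemma trace_Rats: "rp p (r 1) + rp p (r 2) + rp p (r 3) + rp p (r 4) \<in> \<rat>"
proof -
  \<comment> \<open>The power of the root generalizes the claim, so that splitting off a coefficient
    leads from \<open>n\<close> to \<open>Suc n\<close>.\<close>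
  have "r 1 ^ n * rp p (r 1) + r 2 ^ n * rp p (r 2) + r 3 ^ n * rp p (r 3) + r 4 ^ n * rp p (r 4) \<in> \<rat>" for n
  proof (induction p arbitrary: n)
    case (pCons c p)
    have "r 1 ^ n * rp (pCons c p) (r 1) + r 2 ^ n * rp (pCons c p) (r 2) + r 3 ^ n * rp (pCons c p) (r 3)
        + r 4 ^ n * rp (pCons c p) (r 4) = of_rat c * (r 1 ^ n + r 2 ^ n + r 3 ^ n + r 4 ^ n)
        + (r 1 ^ Suc n * rp p (r 1) + r 2 ^ Suc n * rp p (r 2) + r 3 ^ Suc n * rp p (r 3) + r 4 ^ Suc n * rp p (r 4))"
      by (simp add: algebra_simps)
    also have "\<dots> \<in> \<rat>" by (intro Rats_add Rats_mult power_sum_Rats pCons.IH) auto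
    finally show ?case .
  qed simp
  from this[of 0] show ?thesis by simp
qed

text \<open>Divided differences recover the coefficients of a polynomial from its values at the roots,
  at the expense of denominators dividing a power of \<open>delta\<close>.\<close>

lemma common_denominator:
  assumes alg: "\<And>i. i \<in> {1..4} \<Longrightarrow> algebraic_int (q0 + q1 * r i + q2 * r i ^ 2 + q3 * r i ^ 3)"
    and Rats: "q0 \<in> \<rat>" "q1 \<in> \<rat>" "q2 \<in> \<rat>" "q3 \<in> \<rat>"
  shows "of_int (16 * d) ^ 3 * q0 \<in> \<int>" "of_int (16 * d) ^ 3 * q1 \<in> \<int>"
    "of_int (16 * d) ^ 3 * q2 \<in> \<int>" "of_int (16 * d) ^ 3 * q3 \<in> \<int>"
proof -
  define D where "D = (of_int (16 * d) :: complex)"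
  define A where "A i = q0 + q1 * r i + q2 * r i ^ 2 + q3 * r i ^ 3" for i
  have A: "algebraic_int (A 1)" "algebraic_int (A 2)" "algebraic_int (A 3)" "algebraic_int (A 4)"
    using alg[of 1] alg[of 2] alg[of 3] alg[of 4] by (simp_all add: A_def)
  have t: "algebraic_int (r 1)" "algebraic_int (r 2)" "algebraic_int (r 3)" "algebraic_int (r 4)"
    using algebraic_int_root by simp_all
  have D: "algebraic_int D" unfolding D_def by (rule algebraic_int_of_int)
  have D2: "D ^ 2 = delta ^ 2" unfolding D_def delta_square ..
  have Dx: "algebraic_int (D * x)" if "algebraic_int (delta * x)" for x
    using delta_cases that algebraic_int_minus[OF that] by (auto simp: D_def)
  \<comment> \<open>\<open>C\<close> and \<open>C'\<close> are the second divided differences of the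
    cubic at the roots 1, 2, 3 and 1, 2, 4, and \<open>B\<close> is the first one at 1, 2. The
    difference of \<open>C\<close> and \<open>C'\<close> isolates \<open>q3\<close>, after which the
    others follow by substitution.\<close>
  define C where "C = q2 + q3 * (r 1 + r 2 + r 3)"
  define C' where "C' = q2 + q3 * (r 1 + r 2 + r 4)"
  define B where "B = q1 + q2 * (r 1 + r 2) + q3 * (r 1 ^ 2 + r 1 * r 2 + r 2 ^ 2)"
  have eB: "(r 1 - r 2) * B = A 1 - A 2"
    by (simp add: B_def A_def algebra_simps power2_eq_square power3_eq_cube)
  have eC: "(r 1 - r 2) * (r 1 - r 3) * (r 2 - r 3) * C = (A 1 - A 2) * (r 1 - r 3) - (A 1 - A 3) * (r 1 - r 2)"
    by (simp add: C_def A_def algebra_simps power2_eq_square power3_eq_cube)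
  have eC': "(r 1 - r 2) * (r 1 - r 4) * (r 2 - r 4) * C' = (A 1 - A 2) * (r 1 - r 4) - (A 1 - A 4) * (r 1 - r 2)"
    by (simp add: C'_def A_def algebra_simps power2_eq_square power3_eq_cube)
  have "delta * B = (A 1 - A 2) * ((r 1 - r 3) * (r 1 - r 4) * (r 2 - r 3) * (r 2 - r 4) * (r 3 - r 4))"
    unfolding eB[symmetric] delta_def by (simp only: mult_ac)
  then have B: "algebraic_int (D * B)" using A t
    by (intro Dx) (auto intro!: algebraic_int_mult algebraic_int_diff)
  have "delta * C = ((A 1 - A 2) * (r 1 - r 3) - (A 1 - A 3) * (r 1 - r 2))
      * ((r 1 - r 4) * (r 2 - r 4) * (r 3 - r 4))"
    unfolding eC[symmetric] delta_def by (simp only: mult_ac)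
  then have C1: "algebraic_int (delta * C)" using A t
    by (auto intro!: algebraic_int_mult algebraic_int_diff)
  have "delta * C' = ((A 1 - A 2) * (r 1 - r 4) - (A 1 - A 4) * (r 1 - r 2))
      * ((r 1 - r 3) * (r 2 - r 3) * (r 3 - r 4))"
    unfolding eC'[symmetric] delta_def by (simp only: mult_ac)
  then have C2: "algebraic_int (delta * C')" using A t
    by (auto intro!: algebraic_int_mult algebraic_int_diff)
  have "C - C' = (r 3 - r 4) * q3" by (simp add: C_def C'_def algebra_simps)
  then have "(delta * C - delta * C') * ((r 1 - r 2) * (r 1 - r 3) * (r 1 - r 4) * (r 2 - r 3) * (r 2 - r 4))
      = delta * delta * q3"
    unfolding right_diff_distrib[symmetric] delta_def by (simp only: mult_ac)
  then have "algebraic_int (delta * delta * q3)" using C1 C2 t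
    by (metis algebraic_int_mult algebraic_int_diff)
  moreover have "delta * delta * q3 = D ^ 2 * q3" unfolding D2 by (simp add: power2_eq_square)
  ultimately have "algebraic_int (D ^ 2 * q3)" by (simp only:)
  then have 3: "algebraic_int (D ^ 3 * q3)" using algebraic_int_mult[OF D] by (simp add: power2_eq_square power3_eq_cube mult.assoc)
  have "D ^ 3 * q2 = D ^ 2 * (D * C) - D ^ 3 * q3 * (r 1 + r 2 + r 3)"
    by (simp add: C_def algebra_simps power2_eq_square power3_eq_cube)
  then have 2: "algebraic_int (D ^ 3 * q2)" using D Dx[OF C1] 3 t
    by (auto intro!: algebraic_int_mult algebraic_int_diff algebraic_int_add algebraic_int_power)
  have "D ^ 3 * q1 = D ^ 2 * (D * B) - D ^ 3 * q2 * (r 1 + r 2) - D ^ 3 * q3 * (r 1 ^ 2 + r 1 * r 2 + r 2 ^ 2)"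
    by (simp add: B_def algebra_simps power2_eq_square power3_eq_cube)
  then have 1: "algebraic_int (D ^ 3 * q1)" using D B 2 3 t
    by (auto intro!: algebraic_int_mult algebraic_int_diff algebraic_int_add algebraic_int_power)
  have "D ^ 3 * q0 = D ^ 3 * A 1 - D ^ 3 * q1 * r 1 - D ^ 3 * q2 * r 1 ^ 2 - D ^ 3 * q3 * r 1 ^ 3"
    by (simp add: A_def algebra_simps)
  then have 0: "algebraic_int (D ^ 3 * q0)" using D A 1 2 3 t
    by (auto intro!: algebraic_int_mult algebraic_int_diff algebraic_int_add algebraic_int_power)
  have DR: "D ^ 3 * q \<in> \<rat>" if "q \<in> \<rat>" for q using that by (auto simp: D_def)
  show "of_int (16 * d) ^ 3 * q0 \<in> \<int>" "of_int (16 * d) ^ 3 * q1 \<in> \<int>"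
    "of_int (16 * d) ^ 3 * q2 \<in> \<int>" "of_int (16 * d) ^ 3 * q3 \<in> \<int>"
    using rational_algebraic_int_is_int[OF 0 DR] rational_algebraic_int_is_int[OF 1 DR]
      rational_algebraic_int_is_int[OF 2 DR] rational_algebraic_int_is_int[OF 3 DR] Rats
    by (simp_all only: D_def)
qed

text \<open>Multiplying the four relations gives p^4 Z = b^4 W with an algebraic integer
  \<open>Z\<close>. This equation itself shows that \<open>Z\<close> is rational, hence an integer;
  if \<open>p\<close> did not divide \<open>b\<close>, then p^4 would divide
  \<open>W\<close>.\<close>

lemma norm_step:
  fixes p b W :: int and w z :: "nat \<Rightarrow> complex"
  assumes p: "Factorial_Ring.prime p" and W: "w 1 * w 2 * w 3 * w 4 = of_int W" "\<not> p ^ 4 dvd W"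
    and z: "\<And>i. i \<in> {1..4} \<Longrightarrow> algebraic_int (z i)" "\<And>i. i \<in> {1..4} \<Longrightarrow> of_int p * z i = of_int b * w i"
  shows "p dvd b"
proof (rule ccontr)
  assume nd: "\<not> p dvd b"
  have p0: "p \<noteq> 0" using p by auto
  define Z where "Z = z 1 * z 2 * z 3 * z 4"
  have Z: "algebraic_int Z" unfolding Z_def using z(1) by (intro algebraic_int_mult) auto
  have "of_int (p ^ 4) * Z = (of_int p * z 1) * (of_int p * z 2) * (of_int p * z 3) * (of_int p * z 4)"
    by (simp add: Z_def power_numeral_reduce mult_ac)
  also have "\<dots> = (of_int b * w 1) * (of_int b * w 2) * (of_int b * w 3) * (of_int b * w 4)"
    using z(2)[of 1] z(2)[of 2] z(2)[of 3] z(2)[of 4] by simp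
  also have "\<dots> = of_int (b ^ 4) * (w 1 * w 2 * w 3 * w 4)" by (simp add: power_numeral_reduce mult_ac)
  finally have eq: "of_int (p ^ 4) * Z = of_int (b ^ 4 * W)" by (simp only: W of_int_mult)
  then have "Z = of_int (b ^ 4 * W) / of_int (p ^ 4)" using p0 by (simp add: field_simps)
  then have "Z \<in> \<rat>" by (metis Rats_divide Rats_of_int)
  then obtain n where "Z = of_int n" using rational_algebraic_int_is_int[OF Z] by (auto elim: Ints_cases)
  then have "of_int (p ^ 4 * n) = (of_int (b ^ 4 * W) :: complex)" using eq by simp
  then have "p ^ 4 * n = b ^ 4 * W" by (simp only: of_int_eq_iff)
  then have "p ^ 4 dvd b ^ 4 * W" by (metis dvd_triv_left)
  moreover have "Rings.coprime (p ^ 4) (b ^ 4)" using prime_imp_coprime[OF p nd] by simp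
  ultimately show False using W(2) by (simp add: coprime_dvd_mult_right_iff)
qed

text \<open>\<open>p\<close> divides \<open>m\<close> exactly once and therefore m^3 exactly three
  times.\<close>

lemma not_fourth_power_dvd_cube:
  fixes p m :: int
  assumes "Factorial_Ring.prime p" "p dvd m" "\<not> p\<^sup>2 dvd m"
  shows "\<not> p ^ 4 dvd m ^ 3"
proof
  assume *: "p ^ 4 dvd m ^ 3"
  obtain e where e: "m = p * e" using assms(2) by blast
  have "p ^ 3 * p dvd p ^ 3 * e ^ 3" using * by (simp add: e power_mult_distrib power_numeral_reduce mult_ac)
  then have "p dvd e ^ 3" using assms(1) by (subst (asm) dvd_times_left_cancel_iff) auto
  then have "p dvd e" using assms(1) prime_dvd_power by blast
  then show False using assms(3) by (simp add: e power2_eq_square)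
qed

end

section \<open>The ring of integers\<close>

lemma prime_2_int: "Factorial_Ring.prime (2 :: int)"
  by simp

text \<open>The multiplier of \<open>X\<close> turns every term above the lowest into a multiple of
  t^3 (t + A) = - P E, which is absorbed on the left. The surviving term always contains the same
  factor t^2 (t + A), so a single norm serves all three cases of \<open>norm_step\<close>.\<close>

lemma quartic_peeling:
  fixes t :: complex
  assumes "t ^ 4 = - A * t ^ 3 - P * E"
  shows "P * X = b0 + b1 * t + b2 * t ^ 2 + b3 * t ^ 3 \<Longrightarrow>
      P * (t ^ 2 * (t + A) * X + E * (b1 + b2 * t + b3 * t ^ 2)) = b0 * (t ^ 2 * (t + A))"
    and "P * X = b1 * t + b2 * t ^ 2 + b3 * t ^ 3 \<Longrightarrow>
      P * (t * (t + A) * X + E * (b2 + b3 * t)) = b1 * (t ^ 2 * (t + A))"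
    and "P * X = b2 * t ^ 2 + b3 * t ^ 3 \<Longrightarrow>
      P * ((t + A) * X + E * b3) = b2 * (t ^ 2 * (t + A))"
proof -
  have key: "t ^ 3 * (t + A) + P * E = 0"
  proof -
    have "t ^ 3 * (t + A) = t ^ 4 + A * t ^ 3" by (simp add: algebra_simps power_numeral_reduce)
    then show ?thesis by (simp add: assms)
  qed
  note simps = algebra_simps power2_eq_square power3_eq_cube
  assume X: "P * X = b0 + b1 * t + b2 * t ^ 2 + b3 * t ^ 3"
  have "P * (t ^ 2 * (t + A) * X + E * (b1 + b2 * t + b3 * t ^ 2))
      = t ^ 2 * (t + A) * (P * X) + P * E * (b1 + b2 * t + b3 * t ^ 2)" by (simp add: simps)
  also have "\<dots> = b0 * (t ^ 2 * (t + A)) + (b1 + b2 * t + b3 * t ^ 2) * (t ^ 3 * (t + A) + P * E)"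
    unfolding X by (simp add: simps)
  finally show "P * (t ^ 2 * (t + A) * X + E * (b1 + b2 * t + b3 * t ^ 2)) = b0 * (t ^ 2 * (t + A))"
    unfolding key by simp
next
  have key: "t ^ 3 * (t + A) + P * E = 0"
  proof -
    have "t ^ 3 * (t + A) = t ^ 4 + A * t ^ 3" by (simp add: algebra_simps power_numeral_reduce)
    then show ?thesis by (simp add: assms)
  qed
  note simps = algebra_simps power2_eq_square power3_eq_cube
  assume X: "P * X = b1 * t + b2 * t ^ 2 + b3 * t ^ 3"
  have "P * (t * (t + A) * X + E * (b2 + b3 * t))
      = t * (t + A) * (P * X) + P * E * (b2 + b3 * t)" by (simp add: simps)
  also have "\<dots> = b1 * (t ^ 2 * (t + A)) + (b2 + b3 * t) * (t ^ 3 * (t + A) + P * E)"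
    unfolding X by (simp add: simps)
  finally show "P * (t * (t + A) * X + E * (b2 + b3 * t)) = b1 * (t ^ 2 * (t + A))"
    unfolding key by simp
next
  have key: "t ^ 3 * (t + A) + P * E = 0"
  proof -
    have "t ^ 3 * (t + A) = t ^ 4 + A * t ^ 3" by (simp add: algebra_simps power_numeral_reduce)
    then show ?thesis by (simp add: assms)
  qed
  note simps = algebra_simps power2_eq_square power3_eq_cube
  assume X: "P * X = b2 * t ^ 2 + b3 * t ^ 3"
  have "P * ((t + A) * X + E * b3) = (t + A) * (P * X) + P * E * b3" by (simp add: simps)
  also have "\<dots> = b2 * (t ^ 2 * (t + A)) + b3 * (t ^ 3 * (t + A) + P * E)"
    unfolding X by (simp add: simps)
  finally show "P * ((t + A) * X + E * b3) = b2 * (t ^ 2 * (t + A))"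
    unfolding key by simp
qed

text \<open>The same elimination with y^4 = P h; here the surviving factor is always y^3.\<close>

lemma binomial_peeling:
  fixes y :: complex
  assumes "y ^ 4 = P * h"
  shows "P * X = c0 + c1 * y + c2 * y ^ 2 + c3 * y ^ 3 \<Longrightarrow>
      P * (y ^ 3 * X - h * (c1 + c2 * y + c3 * y ^ 2)) = c0 * y ^ 3"
    and "P * X = c1 * y + c2 * y ^ 2 + c3 * y ^ 3 \<Longrightarrow>
      P * (y ^ 2 * X - h * (c2 + c3 * y)) = c1 * y ^ 3"
    and "P * X = c2 * y ^ 2 + c3 * y ^ 3 \<Longrightarrow> P * (y * X - h * c3) = c2 * y ^ 3"
proof -
  note simps = algebra_simps power2_eq_square power3_eq_cube power4_eq_xxxx
  assume X: "P * X = c0 + c1 * y + c2 * y ^ 2 + c3 * y ^ 3"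
  have "P * (y ^ 3 * X - h * (c1 + c2 * y + c3 * y ^ 2))
      = y ^ 3 * (P * X) - (P * h) * (c1 + c2 * y + c3 * y ^ 2)" by (simp add: simps)
  also have "\<dots> = c0 * y ^ 3" unfolding X assms[symmetric] by (simp add: simps)
  finally show "P * (y ^ 3 * X - h * (c1 + c2 * y + c3 * y ^ 2)) = c0 * y ^ 3" .
next
  note simps = algebra_simps power2_eq_square power3_eq_cube power4_eq_xxxx
  assume X: "P * X = c1 * y + c2 * y ^ 2 + c3 * y ^ 3"
  have "P * (y ^ 2 * X - h * (c2 + c3 * y)) = y ^ 2 * (P * X) - (P * h) * (c2 + c3 * y)"
    by (simp add: simps)
  also have "\<dots> = c1 * y ^ 3" unfolding X assms[symmetric] by (simp add: simps)
  finally show "P * (y ^ 2 * X - h * (c2 + c3 * y)) = c1 * y ^ 3" .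
next
  note simps = algebra_simps power2_eq_square power3_eq_cube power4_eq_xxxx
  assume X: "P * X = c2 * y ^ 2 + c3 * y ^ 3"
  have "P * (y * X - h * c3) = y * (P * X) - (P * h) * c3" by (simp add: simps)
  also have "\<dots> = c2 * y ^ 3" unfolding X assms[symmetric] by (simp add: simps)
  finally show "P * (y * X - h * c3) = c2 * y ^ 3" .
qed

section \<open>The field generated by an algebraic integer\<close>

lemma rational_common_denominator:
  assumes "algebraic_int t"
  shows "\<exists>m :: int. m \<noteq> 0 \<and> algebraic_int (of_int m * rp p t)"
proof (induction p)
  case 0
  then show ?case by (intro exI[of _ 1]) simp
next
  case (pCons c p)
  then obtain m :: int where m: "m \<noteq> 0" "algebraic_int (of_int m * rp p t)" by blast
  obtain a b where c: "c = of_int a / of_int b" "b \<noteq> 0"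
    by (metis Rat_cases Fract_of_int_quotient less_irrefl)
  have "of_int (m * b) * rp (pCons c p) t = of_int (m * a) + of_int b * (t * (of_int m * rp p t))"
  proof -
    have "of_int b * of_rat c = (of_int a :: complex)" using c by (simp add: of_rat_divide)
    then show ?thesis by (simp add: distrib_left mult_ac)
  qed
  also have "algebraic_int \<dots>" by (intro algebraic_int_add algebraic_int_mult m assms algebraic_int_of_int)
  finally show ?case using m c by (intro exI[of _ "m * b"]) simp
qed

lemma generate_field_complex_ringI:
  assumes "x \<in> generate_field complex_ring H" "y \<in> generate_field complex_ring H"
  shows "x + y \<in> generate_field complex_ring H" "x * y \<in> generate_field complex_ring H"
  using generate_field.eng_add[OF assms] generate_field.eng_mult[OF assms] by simp_all

lemma generate_field_subset:
  assumes "H \<subseteq> K" "subfield K complex_ring"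
  shows "generate_field complex_ring H \<subseteq> K"
  using field.generate_field_min_subfield1[OF field_complex_ring _ assms(2,1)] by simp

text \<open>The polynomials in \<open>t\<close> are closed under inverses by
  \<open>inverse_in_subring\<close>, since each of them has a nonzero integer multiple that is an
  algebraic integer.\<close>

lemma generate_field_algebraic_int:
  assumes t: "algebraic_int t"
  shows "generate_field complex_ring (\<rat> \<union> {t}) = range (\<lambda>p. rp p t)"
proof
  let ?S = "range (\<lambda>p. rp p t)"
  have rat: "\<rat> \<subseteq> ?S"
  proof
    fix x :: complex assume "x \<in> \<rat>"
    then obtain c where "x = rp [:c:] t" by (auto simp: of_rat_in_Rats_iff)
    then show "x \<in> ?S" by blast
  qed
  have add: "x + y \<in> ?S" and mult: "x * y \<in> ?S" if xy: "x \<in> ?S" "y \<in> ?S" for x y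
  proof -
    obtain p q where "x = rp p t" "y = rp q t" using xy by auto
    then have "x + y = rp (p + q) t" "x * y = rp (p * q) t" by simp_all
    then show "x + y \<in> ?S" "x * y \<in> ?S" by blast+
  qed
  have "subfield ?S complex_ring"
  proof (rule subfield_complex_ringI)
    show "1 \<in> ?S" using rat by auto
    show "- x \<in> ?S" if "x \<in> ?S" for x
    proof -
      obtain p where "x = rp p t" using \<open>x \<in> ?S\<close> by auto
      then have "- x = rp (- p) t" by simp
      then show ?thesis by blast
    qed
    show "inverse x \<in> ?S" if x: "x \<in> ?S" for x
    proof -
      obtain p where p: "x = rp p t" using x by auto
      obtain m :: int where "m \<noteq> 0" "algebraic_int (of_int m * x)"
        using rational_common_denominator[OF t, of p] p by blast
      then show ?thesis using inverse_in_subring[OF rat add mult x] by blast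
    qed
  qed (use add mult in blast)+
  moreover have "t = rp [:0, 1:] t" by simp
  then have "t \<in> ?S" by blast
  ultimately show "generate_field complex_ring (\<rat> \<union> {t}) \<subseteq> ?S"
    using generate_field_subset rat by simp
  show "?S \<subseteq> generate_field complex_ring (\<rat> \<union> {t})"
  proof clarify
    fix p show "rp p t \<in> generate_field complex_ring (\<rat> \<union> {t})"
    proof (induction p)
      case 0
      then show ?case using generate_field.incl[of 0 "\<rat> \<union> {t}" complex_ring] by simp
    next
      case (pCons c p)
      have "of_rat c \<in> generate_field complex_ring (\<rat> \<union> {t})" "t \<in> generate_field complex_ring (\<rat> \<union> {t})"
        using generate_field.incl[of "of_rat c" "\<rat> \<union> {t}" complex_ring]
          generate_field.incl[of t "\<rat> \<union> {t}" complex_ring] by simp_all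
      then show ?case using pCons by (simp add: generate_field_complex_ringI)
    qed
  qed
qed

lemma degree_less_4_cases:
  fixes q :: "'a :: zero poly"
  assumes "Polynomial.degree q < 4"
  obtains c0 c1 c2 c3 where "q = [:c0, c1, c2, c3:]"
proof -
  have "q = [:Polynomial.coeff q 0, Polynomial.coeff q 1, Polynomial.coeff q 2, Polynomial.coeff q 3:]"
    by (rule poly_eqI) (use assms in \<open>auto simp: coeff_pCons numeral_eq_Suc coeff_eq_0 split: nat.splits\<close>)
  then show ?thesis by (rule that)
qed

interpretation int_module: Modules.module int_scale
  by unfold_locales (simp_all add: algebra_simps)

context A4_quartic
begin

text \<open>
  Multiplication by \<open>r\<^sup>2 (r + 4 k)\<close>, and then by the same without a factor \<open>r\<close>, isolates one coefficient
  after the other, because \<open>r\<^sup>3 (r + 4 k) = - d\<close> is divisible by \<open>p\<close>; the norm \<open>d\<^sup>3\<close> of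
  \<open>r\<^sup>2 (r + 4 k)\<close> is not divisible by \<open>p\<^sup>4\<close>. At 2 the powers of \<open>1 - r\<close> play the same role.
\<close>

lemma prime_step_odd:
  assumes p: "Factorial_Ring.prime p" "p dvd d"
    and x: "\<And>i. i \<in> {1..4} \<Longrightarrow> algebraic_int (x i)"
      "\<And>i. i \<in> {1..4} \<Longrightarrow> of_int p * x i = of_int b0 + of_int b1 * r i + of_int b2 * r i ^ 2 + of_int b3 * r i ^ 3"
  shows "p dvd b0 \<and> p dvd b1 \<and> p dvd b2 \<and> p dvd b3"
proof -
  obtain e where e: "d = p * e" using p(2) by blast
  define A where "A = (of_int (4 * k) :: complex)"
  have "\<not> p\<^sup>2 dvd d" using squarefreeD[OF squarefree_d, of p] p(1) unfolding d_def[symmetric] by auto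
  then have W: "\<not> p ^ 4 dvd d ^ 3" by (rule not_fourth_power_dvd_cube[OF p])
  have t4: "r i ^ 4 = - A * r i ^ 3 - of_int p * of_int e" if "i \<in> {1..4}" for i
    using root_eq[OF that] by (simp add: A_def e)
  note alg = algebraic_int_add algebraic_int_diff algebraic_int_mult algebraic_int_power
    algebraic_int_of_int algebraic_int_root
  have A: "algebraic_int A" unfolding A_def by (rule algebraic_int_of_int)
  \<comment> \<open>The norm of r^2 (r + 4 k): the roots multiply to \<open>d\<close>, and the
    factors r i + 4 k multiply to the value of \<open>F\<close> at -4 k, which is again
    \<open>d\<close>.\<close>
  have "r 1 ^ 2 * (r 1 + A) * (r 2 ^ 2 * (r 2 + A)) * (r 3 ^ 2 * (r 3 + A)) * (r 4 ^ 2 * (r 4 + A))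
      = (r 1 * r 2 * r 3 * r 4) ^ 2 * ((r 1 + A) * (r 2 + A) * (r 3 + A) * (r 4 + A))"
    by (simp add: power_mult_distrib mult_ac)
  also have "(r 1 + A) * (r 2 + A) * (r 3 + A) * (r 4 + A) = of_int d"
    unfolding prod_shifted_roots F_at_expand A_def by (simp add: power_numeral_reduce)
  also have "(r 1 * r 2 * r 3 * r 4) ^ 2 * of_int d = of_int (d ^ 3)"
    unfolding Vieta(4) by (simp add: power_numeral_reduce)
  finally have W1: "r 1 ^ 2 * (r 1 + A) * (r 2 ^ 2 * (r 2 + A)) * (r 3 ^ 2 * (r 3 + A)) * (r 4 ^ 2 * (r 4 + A))
      = of_int (d ^ 3)" .
  have "r 1 ^ 3 * r 2 ^ 3 * r 3 ^ 3 * r 4 ^ 3 = (r 1 * r 2 * r 3 * r 4) ^ 3" by (simp add: power_mult_distrib)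
  then have W2: "r 1 ^ 3 * r 2 ^ 3 * r 3 ^ 3 * r 4 ^ 3 = of_int (d ^ 3)" unfolding Vieta(4) by simp
  note step1 = norm_step[OF p(1) W1 W]
  have "p dvd b0"
    by (rule step1[OF _ quartic_peeling(1)[OF t4 x(2)]]) (intro alg A x(1))+
  then obtain c0 where c0: "b0 = p * c0" by blast
  \<comment> \<open>Once \<open>p\<close> divides \<open>b0\<close>, the constant term can be moved
    into the integral element, which leaves one coefficient fewer.\<close>
  define x1 where "x1 i = x i - of_int c0" for i
  have x1: "algebraic_int (x1 i)"
      "of_int p * x1 i = of_int b1 * r i + of_int b2 * r i ^ 2 + of_int b3 * r i ^ 3" if "i \<in> {1..4}" for i
    using x(1)[OF that] x(2)[OF that] by (auto simp: x1_def right_diff_distrib c0 intro!: alg)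
  have "p dvd b1"
    by (rule step1[OF _ quartic_peeling(2)[OF t4 x1(2)]]) (intro alg A x1(1))+
  then obtain c1 where c1: "b1 = p * c1" by blast
  define x2 where "x2 i = x1 i - of_int c1 * r i" for i
  have x2: "algebraic_int (x2 i)" "of_int p * x2 i = of_int b2 * r i ^ 2 + of_int b3 * r i ^ 3"
    if "i \<in> {1..4}" for i
    using x1[OF that] that by (auto simp: x2_def right_diff_distrib c1 intro!: alg)
  have "p dvd b2"
    by (rule step1[OF _ quartic_peeling(3)[OF t4 x2(2)]]) (intro alg A x2(1))+
  then obtain c2 where c2: "b2 = p * c2" by blast
  have "p dvd b3"
  proof (rule norm_step[OF p(1) W2 W])
    fix i :: nat assume i: "i \<in> {1..4}"
    show "algebraic_int (x2 i - of_int c2 * r i ^ 2)" by (intro alg x2 i)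
    show "of_int p * (x2 i - of_int c2 * r i ^ 2) = of_int b3 * r i ^ 3"
      using x2(2)[OF i] by (simp add: right_diff_distrib c2)
  qed
  then show ?thesis using c0 c1 c2 by auto
qed

lemma prime_step_2:
  assumes x: "\<And>i. i \<in> {1..4} \<Longrightarrow> algebraic_int (x i)"
      "\<And>i. i \<in> {1..4} \<Longrightarrow> of_int 2 * x i = of_int b0 + of_int b1 * r i + of_int b2 * r i ^ 2 + of_int b3 * r i ^ 3"
  shows "2 dvd b0 \<and> 2 dvd b1 \<and> 2 dvd b2 \<and> 2 dvd b3"
proof -
  define y where "y i = 1 - r i" for i
  have "\<exists>h. algebraic_int h \<and> y i ^ 4 = 2 * h" if "i \<in> {1..4}" for i
    using shifted_root[OF root[OF that]] by (simp add: y_def)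
  then obtain h where h: "\<And>i. i \<in> {1..4} \<Longrightarrow> algebraic_int (h i)"
    "\<And>i. i \<in> {1..4} \<Longrightarrow> y i ^ 4 = of_int 2 * h i" by (simp only: of_int_numeral) metis
  note alg = algebraic_int_add algebraic_int_diff algebraic_int_mult algebraic_int_power
    algebraic_int_of_int
  have y: "algebraic_int (y i)" if "i \<in> {1..4}" for i
    unfolding y_def by (intro alg algebraic_int_1 algebraic_int_root that)
  \<comment> \<open>The coefficients of the same element in powers of
    \<open>y i = 1 - r i\<close>.\<close>
  define c0 where "c0 = b0 + b1 + b2 + b3"
  define c1 where "c1 = - b1 - 2 * b2 - 3 * b3"
  define c2 where "c2 = b2 + 3 * b3"
  define c3 where "c3 = - b3"
  have x': "of_int 2 * x i = of_int c0 + of_int c1 * y i + of_int c2 * y i ^ 2 + of_int c3 * y i ^ 3"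
    if "i \<in> {1..4}" for i
    unfolding x(2)[OF that] c0_def c1_def c2_def c3_def y_def
    by (simp add: algebra_simps power2_eq_square power3_eq_cube)
  \<comment> \<open>The norm of 1 - r, which is the value of \<open>F\<close> at 1 and divisible by
    2 exactly once.\<close>
  define m where "m = 2 + 4 * k + 27 * k ^ 4"
  have "y 1 ^ 3 * y 2 ^ 3 * y 3 ^ 3 * y 4 ^ 3 = (rp F 1) ^ 3"
    unfolding F_at y_def by (simp add: power_mult_distrib)
  also have "rp F 1 = of_int m" unfolding F_at_expand m_def d_def by simp
  finally have W1: "y 1 ^ 3 * y 2 ^ 3 * y 3 ^ 3 * y 4 ^ 3 = of_int (m ^ 3)" by simp
  have W: "\<not> 2 ^ 4 dvd m ^ 3"
    using F1_mod_4 by (intro not_fourth_power_dvd_cube) (simp_all add: m_def)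
  note step1 = norm_step[OF prime_2_int W1 W]
  have "2 dvd c0"
    by (rule step1[OF _ binomial_peeling(1)[OF h(2) x']]) (intro alg h(1) y x(1))+
  then obtain e0 where e0: "c0 = 2 * e0" by blast
  define x1 where "x1 i = x i - of_int e0" for i
  have x1: "algebraic_int (x1 i)"
      "of_int 2 * x1 i = of_int c1 * y i + of_int c2 * y i ^ 2 + of_int c3 * y i ^ 3" if "i \<in> {1..4}" for i
    using x(1)[OF that] x'[OF that] by (auto simp: x1_def right_diff_distrib e0 intro!: alg)
  have "2 dvd c1"
    by (rule step1[OF _ binomial_peeling(2)[OF h(2) x1(2)]]) (intro alg h(1) y x1(1))+
  then obtain e1 where e1: "c1 = 2 * e1" by blast
  define x2 where "x2 i = x1 i - of_int e1 * y i" for i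
  have x2: "algebraic_int (x2 i)" "of_int 2 * x2 i = of_int c2 * y i ^ 2 + of_int c3 * y i ^ 3"
    if "i \<in> {1..4}" for i
    using x1[OF that] y[OF that] by (auto simp: x2_def right_diff_distrib e1 intro!: alg)
  have "2 dvd c2"
    by (rule step1[OF _ binomial_peeling(3)[OF h(2) x2(2)]]) (intro alg h(1) y x2(1))+
  then obtain e2 where e2: "c2 = 2 * e2" by blast
  have "2 dvd c3"
  proof (rule step1)
    fix i :: nat assume i: "i \<in> {1..4}"
    show "algebraic_int (x2 i - of_int e2 * y i ^ 2)" by (intro alg x2 y i)
    show "of_int 2 * (x2 i - of_int e2 * y i ^ 2) = of_int c3 * y i ^ 3"
      using x2(2)[OF i] by (simp add: right_diff_distrib e2)
  qed
  \<comment> \<open>The change of coefficients is triangular with diagonal entries 1 or -1, so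
    evenness passes back from the top coefficient downwards.\<close>
  then have "2 dvd b3" by (simp add: c3_def)
  moreover then have "2 dvd b2" using \<open>2 dvd c2\<close> unfolding c2_def by presburger
  moreover then have "2 dvd b1" using \<open>2 dvd c1\<close> \<open>2 dvd b3\<close> unfolding c1_def by presburger
  moreover then have "2 dvd b0" using \<open>2 dvd c0\<close> \<open>2 dvd b2\<close> \<open>2 dvd b3\<close> unfolding c0_def by presburger
  ultimately show ?thesis by blast
qed

text \<open>Prime factors of the denominator are split off one at a time: the prime step for
  \<open>p\<close> is applied to the algebraic integers \<open>of_int N * x i\<close>, where
  \<open>N\<close> is the cofactor of \<open>p\<close>.\<close>

lemma divide_coefficients:
  fixes N :: int
  assumes "N \<noteq> 0" "\<And>p. Factorial_Ring.prime p \<Longrightarrow> p dvd N \<Longrightarrow> p = 2 \<or> p dvd d"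
    and "\<And>i. i \<in> {1..4} \<Longrightarrow> algebraic_int (x i)"
      "\<And>i. i \<in> {1..4} \<Longrightarrow> of_int N * x i = of_int b0 + of_int b1 * r i + of_int b2 * r i ^ 2 + of_int b3 * r i ^ 3"
  shows "N dvd b0 \<and> N dvd b1 \<and> N dvd b2 \<and> N dvd b3"
  using assms
proof (induction N arbitrary: b0 b1 b2 b3 rule: prime_divisors_induct)
  case (factor p N)
  have N: "N \<noteq> 0" using factor.prems(1) by simp
  have xN: "algebraic_int (of_int N * x i)" if "i \<in> {1..4}" for i
    using factor.prems(3)[OF that] by (intro algebraic_int_mult algebraic_int_of_int)
  have xN': "of_int p * (of_int N * x i) = of_int b0 + of_int b1 * r i + of_int b2 * r i ^ 2 + of_int b3 * r i ^ 3"
    if "i \<in> {1..4}" for i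
    using factor.prems(4)[OF that] by (simp only: of_int_mult mult.assoc)
  have "p = 2 \<or> p dvd d" using factor.prems(2)[OF factor.hyps] by simp
  then have "p dvd b0 \<and> p dvd b1 \<and> p dvd b2 \<and> p dvd b3"
  proof
    assume p2: "p = 2"
    show ?thesis unfolding p2 by (rule prime_step_2[OF xN xN'[unfolded p2]])
  next
    assume "p dvd d"
    then show ?thesis by (rule prime_step_odd[OF factor.hyps _ xN xN'])
  qed
  then obtain c0 c1 c2 c3 where c: "b0 = p * c0" "b1 = p * c1" "b2 = p * c2" "b3 = p * c3" unfolding dvd_def by metis
  have p0: "p \<noteq> 0" using factor.hyps by auto
  have "N dvd c0 \<and> N dvd c1 \<and> N dvd c2 \<and> N dvd c3"
  proof (rule factor.IH)
    fix i :: nat assume i: "i \<in> {1..4}"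
    have "of_int p * (of_int N * x i) = of_int p * (of_int c0 + of_int c1 * r i + of_int c2 * r i ^ 2 + of_int c3 * r i ^ 3)"
      unfolding xN'[OF i] c of_int_mult distrib_left by (simp only: mult.assoc)
    moreover have "of_int p \<noteq> (0 :: complex)" using p0 by simp
    ultimately show "of_int N * x i = of_int c0 + of_int c1 * r i + of_int c2 * r i ^ 2 + of_int c3 * r i ^ 3"
      using mult_left_cancel by blast
  qed (use factor.prems N in auto)
  then show ?case using c by (simp add: mult_dvd_mono)
next
  case (unit N)
  then show ?case using unit_imp_dvd by blast
next
  case zero
  then show ?case by simp
qed

text \<open>The denominator (16 d)^3 of \<open>common_denominator\<close> has only the prime factor
  2 and prime factors of \<open>d\<close>, exactly those that the prime steps can remove.\<close>

lemma integral_coefficients: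
  assumes alg: "\<And>i. i \<in> {1..4} \<Longrightarrow> algebraic_int (q0 + q1 * r i + q2 * r i ^ 2 + q3 * r i ^ 3)"
    and Rats: "q0 \<in> \<rat>" "q1 \<in> \<rat>" "q2 \<in> \<rat>" "q3 \<in> \<rat>"
  shows "q0 \<in> \<int>" "q1 \<in> \<int>" "q2 \<in> \<int>" "q3 \<in> \<int>"
proof -
  define N where "N = (16 * d) ^ 3"
  have N0: "N \<noteq> 0" using d_gt_1 by (simp add: N_def)
  obtain b0 b1 b2 b3 :: int where b: "of_int N * q0 = of_int b0" "of_int N * q1 = of_int b1"
    "of_int N * q2 = of_int b2" "of_int N * q3 = of_int b3"
    using common_denominator[OF alg Rats] unfolding N_def of_int_power by (auto elim!: Ints_cases)
  have "N dvd b0 \<and> N dvd b1 \<and> N dvd b2 \<and> N dvd b3"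
  proof (rule divide_coefficients[OF N0 _ alg])
    fix p :: int assume p: "Factorial_Ring.prime p" "p dvd N"
    then have "p dvd 16 * d" unfolding N_def by (rule prime_dvd_power)
    then have "p dvd 2 ^ 4 \<or> p dvd d" using p(1) by (simp add: prime_dvd_mult_iff)
    then have "p dvd 2 \<or> p dvd d" using prime_dvd_power[OF p(1)] by blast
    then show "p = 2 \<or> p dvd d" using primes_dvd_imp_eq[OF p(1) prime_2_int] by blast
  next
    fix i :: nat
    show "of_int N * (q0 + q1 * r i + q2 * r i ^ 2 + q3 * r i ^ 3)
        = of_int b0 + of_int b1 * r i + of_int b2 * r i ^ 2 + of_int b3 * r i ^ 3"
      unfolding b[symmetric] by (simp add: algebra_simps)
  qed
  moreover have "q \<in> \<int>" if qb: "of_int N * q = of_int b" "N dvd b" for q :: complex and b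
  proof -
    obtain c where "b = N * c" using qb(2) by blast
    then have "of_int N * q = of_int N * of_int c" using qb(1) by simp
    then show ?thesis using N0 by simp
  qed
  ultimately show "q0 \<in> \<int>" "q1 \<in> \<int>" "q2 \<in> \<int>" "q3 \<in> \<int>" using b by blast+
qed

lemma rational_independence:
  assumes "i \<in> {1..4}" "of_rat c0 + of_rat c1 * r i + of_rat c2 * r i ^ 2 + of_rat c3 * r i ^ 3 = 0"
  shows "c0 = 0" "c1 = 0" "c2 = 0" "c3 = 0"
proof -
  let ?p = "[:c0, c1, c2, c3:]"
  have "rp ?p (r i) = 0" using assms(2) by (simp add: algebra_simps power2_eq_square power3_eq_cube)
  then have "F dvd ?p" by (rule F_dvd[OF assms(1)])
  moreover have "Polynomial.degree ?p < 4" by (simp add: less_Suc_eq_le numeral_eq_Suc)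
  ultimately have "?p = 0" using dvd_imp_degree_le[of F ?p] degree_F by fastforce
  then show "c0 = 0" "c1 = 0" "c2 = 0" "c3 = 0" by simp_all
qed

lemma integers_of_generated_field:
  assumes i: "i \<in> {1..4}"
  shows "integers_of (generate_field complex_ring (\<rat> \<union> {r i}))
    = {of_int b0 + of_int b1 * r i + of_int b2 * r i ^ 2 + of_int b3 * r i ^ 3 | b0 b1 b2 b3. True}"
    (is "?L = ?R")
proof
  show "?R \<subseteq> ?L"
  proof clarify
    fix b0 b1 b2 b3 :: int
    let ?x = "of_int b0 + of_int b1 * r i + of_int b2 * r i ^ 2 + of_int b3 * r i ^ 3"
    have "?x = rp [:of_int b0, of_int b1, of_int b2, of_int b3:] (r i)"
      by (simp add: algebra_simps power2_eq_square power3_eq_cube)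
    moreover have "algebraic_int ?x"
      by (intro algebraic_int_add algebraic_int_mult algebraic_int_power algebraic_int_of_int
          algebraic_int_root i)
    ultimately show "?x \<in> ?L" unfolding integers_of_def generate_field_algebraic_int[OF algebraic_int_root[OF i]]
      by blast
  qed
  show "?L \<subseteq> ?R"
  proof
    fix x assume "x \<in> ?L"
    then obtain p where p: "x = rp p (r i)" "algebraic_int x"
      unfolding integers_of_def generate_field_algebraic_int[OF algebraic_int_root[OF i]] by blast
    define q where "q = p mod F"
    have "Polynomial.degree q < 4" using degree_mod_less[of F p] degree_F by (auto simp: q_def F_def)
    then obtain c0 c1 c2 c3 where q: "q = [:c0, c1, c2, c3:]" by (rule degree_less_4_cases)
    have "p = F * (p div F) + q" by (simp add: q_def)
    then have xq: "x = rp q (r i)" unfolding p by (metis rp_add rp_mult root[OF i] mult_zero_left add_0)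
    have q': "rp q z = of_rat c0 + of_rat c1 * z + of_rat c2 * z ^ 2 + of_rat c3 * z ^ 3" for z
      by (simp add: q algebra_simps power2_eq_square power3_eq_cube)
    \<comment> \<open>\<open>integral_coefficients\<close> asks for integrality at all four roots,
      which conjugation supplies.\<close>
    have "algebraic_int (of_rat c0 + of_rat c1 * r j + of_rat c2 * r j ^ 2 + of_rat c3 * r j ^ 3)"
      if "j \<in> {1..4}" for j
      using conjugate_algebraic_int[OF i _ that, of q] p(2) xq unfolding q' by simp
    from integral_coefficients[OF this] have "(of_rat c0 :: complex) \<in> \<int>" "(of_rat c1 :: complex) \<in> \<int>"
      "(of_rat c2 :: complex) \<in> \<int>" "(of_rat c3 :: complex) \<in> \<int>" by simp_all
    then obtain b0 b1 b2 b3 where "of_rat c0 = (of_int b0 :: complex)" "of_rat c1 = (of_int b1 :: complex)"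
      "of_rat c2 = (of_int b2 :: complex)" "of_rat c3 = (of_int b3 :: complex)" by (elim Ints_cases)
    then have "x = of_int b0 + of_int b1 * r i + of_int b2 * r i ^ 2 + of_int b3 * r i ^ 3"
      by (simp only: xq q')
    then show "x \<in> ?R" by blast
  qed
qed

section \<open>The power basis and monogenicity\<close>

lemma power_basis:
  assumes i: "i \<in> {1..4}"
  shows "is_int_basis {1, r i, (r i)\<^sup>2, r i ^ 3} (integers_of (generate_field complex_ring (\<rat> \<union> {r i})))"
proof -
  let ?B = "{1, r i, (r i)\<^sup>2, r i ^ 3}"
  note ind = rational_independence[OF i]
  \<comment> \<open>Distinctness gives the set four elements, so that sums over it have four terms
    with independent coefficients.\<close>
  have "1 \<noteq> r i" "1 \<noteq> (r i)\<^sup>2" "1 \<noteq> r i ^ 3" "r i \<noteq> (r i)\<^sup>2" "r i \<noteq> r i ^ 3" "(r i)\<^sup>2 \<noteq> r i ^ 3"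
    using ind(1)[of 1 "-1" 0 0] ind(1)[of 1 0 "-1" 0] ind(1)[of 1 0 0 "-1"]
      ind(2)[of 0 1 "-1" 0] ind(2)[of 0 1 0 "-1"] ind(3)[of 0 0 1 "-1"] by auto
  then have sum: "(\<Sum>v\<in>?B. int_scale (u v) v)
      = of_int (u 1) + of_int (u (r i)) * r i + of_int (u ((r i)\<^sup>2)) * r i ^ 2 + of_int (u (r i ^ 3)) * r i ^ 3"
    and dist: "distinct [1, r i, (r i)\<^sup>2, r i ^ 3]" for u
    by (auto simp: add_ac)
  have "\<not> int_module.dependent ?B"
  proof
    assume "int_module.dependent ?B"
    then obtain u v where uv: "v \<in> ?B" "u v \<noteq> 0" "(\<Sum>v\<in>?B. int_scale (u v) v) = 0"
      by (subst (asm) int_module.dependent_finite) auto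
    have "of_rat (of_int (u 1)) + of_rat (of_int (u (r i))) * r i + of_rat (of_int (u ((r i)\<^sup>2))) * r i ^ 2
        + of_rat (of_int (u (r i ^ 3))) * r i ^ 3 = 0" using uv(3) unfolding sum by simp
    from ind[OF this] show False using uv by auto
  qed
  moreover have "int_module.span ?B = integers_of (generate_field complex_ring (\<rat> \<union> {r i}))"
  proof -
    have "int_module.span ?B = range (\<lambda>u. \<Sum>v\<in>?B. int_scale (u v) v)"
      by (rule int_module.span_finite) simp
    also have "\<dots> = {of_int b0 + of_int b1 * r i + of_int b2 * r i ^ 2 + of_int b3 * r i ^ 3 | b0 b1 b2 b3. True}"
      (is "?X = ?Y")
    proof
      show "?X \<subseteq> ?Y" unfolding sum by blast
      show "?Y \<subseteq> ?X"
      proof clarify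
        fix b0 b1 b2 b3 :: int
        define u where "u v = (if v = 1 then b0 else if v = r i then b1 else if v = (r i)\<^sup>2 then b2 else b3)" for v
        have "u 1 = b0" "u (r i) = b1" "u ((r i)\<^sup>2) = b2" "u (r i ^ 3) = b3"
          using dist by (auto simp: u_def)
        then show "of_int b0 + of_int b1 * r i + of_int b2 * r i ^ 2 + of_int b3 * r i ^ 3 \<in> ?X"
          unfolding sum by (intro range_eqI[of _ _ u]) simp
      qed
    qed
    finally show ?thesis unfolding integers_of_generated_field[OF i] .
  qed
  ultimately show ?thesis unfolding is_int_basis_def by blast
qed

definition f :: "int poly" where "f = [:d, 0, 0, 4 * k, 1:]"

lemma complex_roots_f: "complex_roots f = r ` {1..4}"
proof -
  have "poly (map_poly of_int f) z = rp F z" for z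
    by (simp add: f_def F_def map_poly_pCons of_rat_mult)
  then show ?thesis unfolding complex_roots_def using root_iff by auto
qed

lemma monogenic_f: "monogenic_quartic f"
proof -
  have "map_poly of_int f = F" by (simp add: f_def F_def map_poly_pCons)
  then show ?thesis unfolding monogenic_quartic_def complex_roots_f
    using irreducible_F power_basis by (auto simp: f_def)
qed

end

section \<open>The Galois group\<close>

text \<open>The cubic resolvent: its roots belong to the three ways of splitting four roots into two
  pairs.\<close>

lemma resolvent_Vieta:
  fixes t1 t2 t3 t4 :: complex
  defines "e1 \<equiv> t1 + t2 + t3 + t4"
    and "e2 \<equiv> t1 * t2 + t1 * t3 + t1 * t4 + t2 * t3 + t2 * t4 + t3 * t4"
    and "e3 \<equiv> t1 * t2 * t3 + t1 * t2 * t4 + t1 * t3 * t4 + t2 * t3 * t4"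
    and "e4 \<equiv> t1 * t2 * t3 * t4"
  shows "(x - (t1 * t2 + t3 * t4)) * (x - (t1 * t3 + t2 * t4)) * (x - (t1 * t4 + t2 * t3))
    = x ^ 3 - e2 * x ^ 2 + (e1 * e3 - 4 * e4) * x - (e1 ^ 2 * e4 + e3 ^ 2 - 4 * e2 * e4)"
  unfolding assms by (simp add: algebra_simps power2_eq_square power3_eq_cube)

text \<open>Of the nine permutations without fixed point, the three double transpositions count one
  pairing twice. For the six 4-cycles the sum runs over the sides of a square; the missing diagonals
  form a pairing, and e2 = 0 makes the sum minus its resolvent root.\<close>

lemma fixpoint_free_permutation_of_4:
  fixes t :: "nat \<Rightarrow> complex"
  assumes \<pi>: "\<pi> ` {1..4} \<subseteq> {1..4}" "inj_on \<pi> {1..4}" "\<And>i. i \<in> {1..4} \<Longrightarrow> \<pi> i \<noteq> i"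
    and e2: "t 1 * t 2 + t 1 * t 3 + t 1 * t 4 + t 2 * t 3 + t 2 * t 4 + t 3 * t 4 = 0"
  defines "S \<equiv> t 1 * t (\<pi> 1) + t 2 * t (\<pi> 2) + t 3 * t (\<pi> 3) + t 4 * t (\<pi> 4)"
  shows "\<exists>\<beta>\<in>{t 1 * t 2 + t 3 * t 4, t 1 * t 3 + t 2 * t 4, t 1 * t 4 + t 2 * t 3}. S = 2 * \<beta> \<or> S = - \<beta>"
proof -
  have idx: "{1..4} = {1, 2, 3, 4 :: nat}" by auto
  have "\<pi> 1 \<in> {1, 2, 3, 4}" "\<pi> 2 \<in> {1, 2, 3, 4}" "\<pi> 3 \<in> {1, 2, 3, 4}" "\<pi> 4 \<in> {1, 2, 3, 4}"
    using \<pi>(1) unfolding idx by auto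
  moreover have "\<pi> 1 \<noteq> 1" "\<pi> 2 \<noteq> 2" "\<pi> 3 \<noteq> 3" "\<pi> 4 \<noteq> 4" using \<pi>(3) unfolding idx by auto
  moreover have "\<pi> 1 \<noteq> \<pi> 2" "\<pi> 1 \<noteq> \<pi> 3" "\<pi> 1 \<noteq> \<pi> 4" "\<pi> 2 \<noteq> \<pi> 3" "\<pi> 2 \<noteq> \<pi> 4" "\<pi> 3 \<noteq> \<pi> 4"
    using inj_onD[OF \<pi>(2)] unfolding idx by fastforce+
  ultimately consider
      "\<pi> 1 = 2" "\<pi> 2 = 1" "\<pi> 3 = 4" "\<pi> 4 = 3" | "\<pi> 1 = 2" "\<pi> 2 = 3" "\<pi> 3 = 4" "\<pi> 4 = 1"
    | "\<pi> 1 = 2" "\<pi> 2 = 4" "\<pi> 3 = 1" "\<pi> 4 = 3" | "\<pi> 1 = 3" "\<pi> 2 = 1" "\<pi> 3 = 4" "\<pi> 4 = 2"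
    | "\<pi> 1 = 3" "\<pi> 2 = 4" "\<pi> 3 = 1" "\<pi> 4 = 2" | "\<pi> 1 = 3" "\<pi> 2 = 4" "\<pi> 3 = 2" "\<pi> 4 = 1"
    | "\<pi> 1 = 4" "\<pi> 2 = 1" "\<pi> 3 = 2" "\<pi> 4 = 3" | "\<pi> 1 = 4" "\<pi> 2 = 3" "\<pi> 3 = 1" "\<pi> 4 = 2"
    | "\<pi> 1 = 4" "\<pi> 2 = 3" "\<pi> 3 = 2" "\<pi> 4 = 1"
    by auto
  then show ?thesis
  proof cases
    case 1
    then have "S = 2 * (t 1 * t 2 + t 3 * t 4)" by (simp add: S_def)
    then show ?thesis by blast
  next
    case 2
    then have "S + (t 1 * t 3 + t 2 * t 4) = 0" using e2 by (simp add: S_def algebra_simps)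
    then have "S = - (t 1 * t 3 + t 2 * t 4)" by (simp only: eq_neg_iff_add_eq_0)
    then show ?thesis by blast
  next
    case 3
    then have "S + (t 1 * t 4 + t 2 * t 3) = 0" using e2 by (simp add: S_def algebra_simps)
    then have "S = - (t 1 * t 4 + t 2 * t 3)" by (simp only: eq_neg_iff_add_eq_0)
    then show ?thesis by blast
  next
    case 4
    then have "S + (t 1 * t 4 + t 2 * t 3) = 0" using e2 by (simp add: S_def algebra_simps)
    then have "S = - (t 1 * t 4 + t 2 * t 3)" by (simp only: eq_neg_iff_add_eq_0)
    then show ?thesis by blast
  next
    case 5
    then have "S = 2 * (t 1 * t 3 + t 2 * t 4)" by (simp add: S_def)
    then show ?thesis by blast
  next
    case 6
    then have "S + (t 1 * t 2 + t 3 * t 4) = 0" using e2 by (simp add: S_def algebra_simps)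
    then have "S = - (t 1 * t 2 + t 3 * t 4)" by (simp only: eq_neg_iff_add_eq_0)
    then show ?thesis by blast
  next
    case 7
    then have "S + (t 1 * t 3 + t 2 * t 4) = 0" using e2 by (simp add: S_def algebra_simps)
    then have "S = - (t 1 * t 3 + t 2 * t 4)" by (simp only: eq_neg_iff_add_eq_0)
    then show ?thesis by blast
  next
    case 8
    then have "S + (t 1 * t 2 + t 3 * t 4) = 0" using e2 by (simp add: S_def algebra_simps)
    then have "S = - (t 1 * t 2 + t 3 * t 4)" by (simp only: eq_neg_iff_add_eq_0)
    then show ?thesis by blast
  next
    case 9
    then have "S = 2 * (t 1 * t 4 + t 2 * t 3)" by (simp add: S_def)
    then show ?thesis by blast
  qed
qed

text \<open>For a root \<open>x\<close> of the quartic the cubic factor has the other three roots as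
  its zeros.\<close>

lemma complementary_cubic_factor:
  fixes x y A :: complex
  shows "(y - x) * (y ^ 3 + (x + A) * (y ^ 2 + x * y + x ^ 2)) = (y ^ 4 + A * y ^ 3) - (x ^ 4 + A * x ^ 3)"
  by (simp add: algebra_simps power2_eq_square power3_eq_cube power4_eq_xxxx)

context A4_quartic
begin

text \<open>A rational root is an integer b with b^3 = 4 d b + 16 k^2 d. A prime \<open>p\<close>
  dividing \<open>d\<close> divides it only once and divides b, so p^2 divides 16 k^2 d and
  \<open>p\<close> divides 4 k. Together with \<open>p\<close> dividing 27 k^4 + 1 this leaves p =
  2, but \<open>d\<close> is odd.\<close>

lemma resolvent_root_irrational:
  assumes \<beta>: "\<beta> \<in> {r 1 * r 2 + r 3 * r 4, r 1 * r 3 + r 2 * r 4, r 1 * r 4 + r 2 * r 3}"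
  shows "\<beta> \<notin> \<rat>"
proof
  assume rat: "\<beta> \<in> \<rat>"
  have "algebraic_int \<beta>" using \<beta> by (auto intro!: algebraic_int_add algebraic_int_mult algebraic_int_root)
  then obtain b where b: "\<beta> = of_int b" using rational_algebraic_int_is_int rat by (auto elim: Ints_cases)
  have "(\<beta> - (r 1 * r 2 + r 3 * r 4)) * (\<beta> - (r 1 * r 3 + r 2 * r 4)) * (\<beta> - (r 1 * r 4 + r 2 * r 3)) = 0"
    using \<beta> by auto
  then have "\<beta> ^ 3 - 4 * of_int d * \<beta> - of_int (4 * k) ^ 2 * of_int d = 0"
    unfolding resolvent_Vieta Vieta by simp
  then have "of_int (b ^ 3 - 4 * d * b - (4 * k) ^ 2 * d) = (of_int 0 :: complex)" by (simp add: b)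
  then have eq: "b ^ 3 - 4 * d * b - (4 * k) ^ 2 * d = 0" by (simp only: of_int_eq_iff)
  obtain p where p: "Factorial_Ring.prime p" "p dvd d"
    using prime_factor_int[of d] d_gt_1 by auto
  obtain e where e: "d = p * e" using p(2) by blast
  have "b ^ 3 = d * (4 * b + (4 * k) ^ 2)" using eq by (simp add: algebra_simps)
  then have "p dvd b ^ 3" using p(2) by simp
  then have "p dvd b" using p(1) prime_dvd_power by blast
  then obtain c where c: "b = p * c" by blast
  have p0: "p \<noteq> 0" using p by auto
  have "p * ((4 * k) ^ 2 * e) = p * (p * (p * c ^ 3 - 4 * e * c))"
    using eq by (simp add: c e algebra_simps power2_eq_square power3_eq_cube)
  then have "(4 * k) ^ 2 * e = p * (p * c ^ 3 - 4 * e * c)" by (rule mult_left_cancel[OF p0, THEN iffD1])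
  then have "p dvd (4 * k) ^ 2 * e" by simp
  moreover have "\<not> p dvd e"
  proof
    assume "p dvd e"
    then have "p\<^sup>2 dvd d" by (auto simp: e power2_eq_square)
    then have "p dvd 1" using squarefreeD squarefree_d unfolding d_def by blast
    then show False using p(1) by auto
  qed
  ultimately have "p dvd (4 * k) ^ 2" using p(1) by (simp add: prime_dvd_mult_iff)
  then have "p dvd 4 * k" by (rule prime_dvd_power[OF p(1)])
  then have "p dvd (4 * k) * (27 * k ^ 3)" by (rule dvd_mult2)
  also have "(4 * k) * (27 * k ^ 3) = 4 * (27 * k ^ 4)" by (simp add: power_numeral_reduce)
  finally have 1: "p dvd 4 * (27 * k ^ 4)" .
  have "p dvd 4 * (27 * k ^ 4 + 1)" using p(2) unfolding d_def by (rule dvd_mult)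
  then have "p dvd 4 * (27 * k ^ 4 + 1) - 4 * (27 * k ^ 4)" using 1 by (rule dvd_diff)
  then have "p dvd 2 ^ 2" by simp
  then have "p dvd 2" by (rule prime_dvd_power[OF p(1)])
  then have "p = 2" using primes_dvd_imp_eq[OF p(1) prime_2_int] by blast
  then have "even (27 * k ^ 4 + 1)" using p(2) by (simp add: d_def)
  then show False using k_even by simp
qed

text \<open>
  If \<open>r j = g (r i)\<close>, then \<open>g\<close> permutes the roots without fixed points, and the trace of
  \<open>r g (r)\<close>, which is rational, is \<open>2 \<beta>\<close> or \<open>- \<beta>\<close> for a root \<open>\<beta>\<close> of the cubic resolvent.
\<close>

lemma root_not_in_generated_field:
  assumes ij: "i \<in> {1..4}" "j \<in> {1..4}" "i \<noteq> j"
  shows "rp g (r i) \<noteq> r j"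
proof
  assume g: "rp g (r i) = r j"
  have root_g: "\<exists>m'\<in>{1..4}. rp g (r m) = r m'" if m: "m \<in> {1..4}" for m
  proof -
    have "rp (pcompose F g) (r i) = 0" using g root[OF ij(2)] by simp
    then have "rp (pcompose F g) (r m) = 0" using conjugate_zero[OF ij(1) _ m] by blast
    then show ?thesis using root_iff by simp
  qed
  then obtain \<pi> where \<pi>: "\<And>m. m \<in> {1..4} \<Longrightarrow> \<pi> m \<in> {1..4}" "\<And>m. m \<in> {1..4} \<Longrightarrow> rp g (r m) = r (\<pi> m)"
    by metis
  \<comment> \<open>A single fixed point would by conjugacy yield g(r i) = r i.\<close>
  have nofix: "\<pi> m \<noteq> m" if m: "m \<in> {1..4}" for m
  proof
    assume "\<pi> m = m"
    then have "rp g (r m) = rp [:0, 1:] (r m)" using \<pi>(2)[OF m] by simp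
    then have "rp g (r i) = rp [:0, 1:] (r i)" by (rule conjugate_eq[OF m _ ij(1)])
    then have "r j = r i" using g by simp
    then show False using inj_onD[OF inj_roots _ ij(2,1)] ij(3) by blast
  qed
  \<comment> \<open>Iterates of \<open>g\<close>, used for the injectivity of \<open>\<pi>\<close>.
    Some iterate returns an index to itself by finiteness; by conjugacy the corresponding polynomial
    then fixes every root, so this iterate of \<open>\<pi>\<close> is the identity on the
    indices.\<close>
  define G where "G n = (pcompose g ^^ n) [:0, 1:]" for n
  have iter: "(\<pi> ^^ n) m \<in> {1..4} \<and> rp (G n) (r m) = r ((\<pi> ^^ n) m)" if "m \<in> {1..4}" for n m
    by (induction n) (use \<pi> that in \<open>auto simp: G_def\<close>)
  have "\<not> inj (\<lambda>n. (\<pi> ^^ n) 1)"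
  proof
    assume "inj (\<lambda>n. (\<pi> ^^ n) 1)"
    moreover have "range (\<lambda>n. (\<pi> ^^ n) 1) \<subseteq> {1..4}" using iter[of 1] by auto
    ultimately show False using finite_subset[OF _ finite_atLeastAtMost] range_inj_infinite by blast
  qed
  then obtain a' b' where ab': "a' \<noteq> b'" "(\<pi> ^^ a') 1 = (\<pi> ^^ b') 1" unfolding inj_def by blast
  obtain a b where ab: "(\<pi> ^^ a) 1 = (\<pi> ^^ b) 1" "a < b"
    using ab' by (metis linorder_neqE_nat)
  define m where "m = (\<pi> ^^ a) 1"
  define n where "n = b - a"
  have m: "m \<in> {1..4}" using iter[of 1 a] by (simp add: m_def)
  have "(\<pi> ^^ n) m = (\<pi> ^^ (n + a)) 1" by (simp add: m_def funpow_add)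
  then have "(\<pi> ^^ n) m = m" using ab by (simp add: n_def m_def)
  then have "rp (G n) (r m) = rp [:0, 1:] (r m)" using iter[OF m, of n] by simp
  then have "rp (G n) (r l) = r l" if "l \<in> {1..4}" for l
    using conjugate_eq[OF m _ that, of "G n" "[:0, 1:]"] by simp
  then have period: "(\<pi> ^^ n) l = l" if "l \<in> {1..4}" for l
    using iter[OF that, of n] inj_onD[OF inj_roots] that by metis
  have n: "n = Suc (n - 1)" using ab by (simp add: n_def)
  have "inj_on \<pi> {1..4}"
  proof (rule inj_onI)
    fix x y assume xy: "x \<in> {1..4}" "y \<in> {1..4}" "\<pi> x = \<pi> y"
    then have "(\<pi> ^^ (n - 1)) (\<pi> x) = (\<pi> ^^ (n - 1)) (\<pi> y)" by simp
    then have "(\<pi> ^^ n) x = (\<pi> ^^ n) y" by (subst (1 2) n) (simp only: funpow_Suc_right comp_apply)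
    then show "x = y" using period xy by simp
  qed
  then obtain \<beta> where \<beta>: "\<beta> \<in> {r 1 * r 2 + r 3 * r 4, r 1 * r 3 + r 2 * r 4, r 1 * r 4 + r 2 * r 3}"
    "r 1 * r (\<pi> 1) + r 2 * r (\<pi> 2) + r 3 * r (\<pi> 3) + r 4 * r (\<pi> 4) \<in> {2 * \<beta>, - \<beta>}"
    using fixpoint_free_permutation_of_4[of \<pi> r, OF _ _ nofix Vieta(2)] \<pi>(1) by blast
  have "rp ([:0, 1:] * g) (r 1) + rp ([:0, 1:] * g) (r 2) + rp ([:0, 1:] * g) (r 3) + rp ([:0, 1:] * g) (r 4) \<in> \<rat>"
    by (rule trace_Rats)
  then have "r 1 * r (\<pi> 1) + r 2 * r (\<pi> 2) + r 3 * r (\<pi> 3) + r 4 * r (\<pi> 4) \<in> \<rat>"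
    using \<pi>(2)[of 1] \<pi>(2)[of 2] \<pi>(2)[of 3] \<pi>(2)[of 4] by simp
  then have "2 * \<beta> \<in> \<rat> \<or> - \<beta> \<in> \<rat>" using \<beta>(2) by auto
  then have "\<beta> \<in> \<rat>"
  proof
    assume "2 * \<beta> \<in> \<rat>"
    then have "(2 * \<beta>) / 2 \<in> \<rat>" by (intro Rats_divide) auto
    then show ?thesis by simp
  qed simp
  then show False using resolvent_root_irrational[OF \<beta>(1)] by blast
qed

lemma cubic_relation:
  assumes "i \<in> {1..4}" "j \<in> {1..4}" "i \<noteq> j"
  shows "r j ^ 3 = - (r i + of_int (4 * k)) * (r j ^ 2 + r i * r j + r i ^ 2)"
proof -
  have "(r j - r i) * (r j ^ 3 + (r i + of_int (4 * k)) * (r j ^ 2 + r i * r j + r i ^ 2)) = 0"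
  proof -
    have "r m ^ 4 + of_int (4 * k) * r m ^ 3 = - of_int d" if "m \<in> {1..4}" for m
      using root[OF that] unfolding F_at_expand by (simp only: eq_neg_iff_add_eq_0)
    from this[OF assms(1)] this[OF assms(2)] show ?thesis
      unfolding complementary_cubic_factor by (simp only: diff_self)
  qed
  moreover have "r j - r i \<noteq> 0" using inj_onD[OF inj_roots _ assms(2,1)] assms(3) by auto
  ultimately have "r j ^ 3 + (r i + of_int (4 * k)) * (r j ^ 2 + r i * r j + r i ^ 2) = 0"
    by (simp only: mult_eq_0_iff simp_thms)
  then show ?thesis by (simp only: mult_minus_left eq_neg_iff_add_eq_0)
qed

lemma generated_field_1_closed:
  defines "S \<equiv> range (\<lambda>p. rp p (r 1))"
  shows "\<And>x y. x \<in> S \<Longrightarrow> y \<in> S \<Longrightarrow> x + y \<in> S" "\<And>x y. x \<in> S \<Longrightarrow> y \<in> S \<Longrightarrow> x - y \<in> S"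
    "\<And>x y. x \<in> S \<Longrightarrow> y \<in> S \<Longrightarrow> x * y \<in> S" "\<And>x y. x \<in> S \<Longrightarrow> y \<in> S \<Longrightarrow> x / y \<in> S"
    "\<And>q. of_rat q \<in> S" "r 1 \<in> S"
proof -
  have S: "S = generate_field complex_ring (\<rat> \<union> {r 1})"
    unfolding S_def by (rule generate_field_algebraic_int[symmetric]) (simp add: algebraic_int_root)
  show add: "x + y \<in> S" if "x \<in> S" "y \<in> S" for x y
    using that unfolding S by (rule generate_field_complex_ringI)
  show mult: "x * y \<in> S" if "x \<in> S" "y \<in> S" for x y
    using that unfolding S by (rule generate_field_complex_ringI)
  show rat: "of_rat q \<in> S" for q
    unfolding S using generate_field.incl[of "of_rat q" "\<rat> \<union> {r 1}" complex_ring] by simp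
  show "r 1 \<in> S"
    unfolding S using generate_field.incl[of "r 1" "\<rat> \<union> {r 1}" complex_ring] by simp
  show "x - y \<in> S" if "x \<in> S" "y \<in> S" for x y
    using add[OF that(1) mult[OF rat[of "- 1"] that(2)]] by simp
  show "x / y \<in> S" if "x \<in> S" "y \<in> S" for x y
  proof (cases "y = 0")
    case False
    then have "inverse y \<in> S" using generate_field.m_inv[of y complex_ring] that(2)
      unfolding S by (simp add: complex_ring_inv)
    then show ?thesis using mult[OF that(1)] by (simp add: divide_inverse)
  qed (use rat[of 0] in simp)
qed

text \<open>A linear or quadratic relation for \<open>r 2\<close> over the field of \<open>r 1\<close> would split off a root
  of the complementary cubic in that field.\<close>

lemma independence_over_generated_field:
  assumes "rp a (r 1) + rp b (r 1) * r 2 + rp c (r 1) * r 2 ^ 2 = 0"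
  shows "rp a (r 1) = 0" "rp b (r 1) = 0" "rp c (r 1) = 0"
proof -
  define S where "S = range (\<lambda>p. rp p (r 1))"
  note cl = generated_field_1_closed[folded S_def]
  let ?t = "r 1" and ?s = "r 2"
  have neg: "- x \<in> S" if "x \<in> S" for x using cl(2)[OF cl(5)[of 0] that] by simp
  have S: "rp a ?t \<in> S" "rp b ?t \<in> S" "rp c ?t \<in> S" by (auto simp: S_def)
  have notS: "r m \<notin> S" if "m \<in> {1..4}" "m \<noteq> 1" for m
    using root_not_in_generated_field[of 1 m] that unfolding S_def by fastforce
  have lin: "v = 0 \<and> u = 0" if uv: "v + u * ?s = 0" "u \<in> S" "v \<in> S" for u v
  proof (cases "u = 0")
    case False
    then have "?s = - v / u" using uv(1) by (simp add: field_simps eq_neg_iff_add_eq_0)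
    also have "\<dots> \<in> S" by (intro cl(4) neg uv)
    finally show ?thesis using notS[of 2] by simp
  qed (use uv in simp)
  have c0: "rp c ?t = 0"
  proof (rule ccontr)
    assume c: "rp c ?t \<noteq> 0"
    define \<beta> where "\<beta> = rp b ?t / rp c ?t"
    define \<gamma> where "\<gamma> = rp a ?t / rp c ?t"
    define P where "P = ?t + of_int (4 * k)"
    have "of_int (4 * k) \<in> S" using cl(5)[of "of_int (4 * k)"] by (simp only: of_rat_of_int_eq)
    moreover have "?t \<in> S" unfolding S_def by (rule range_eqI[of _ _ "[:0, 1:]"]) simp
    ultimately have inS: "\<beta> \<in> S" "\<gamma> \<in> S" "P \<in> S" "?t \<in> S"
      unfolding \<beta>_def \<gamma>_def P_def by (simp_all only: cl S)
    have "rp c ?t * (\<gamma> + \<beta> * ?s + ?s ^ 2) = 0" using assms c by (simp add: \<beta>_def \<gamma>_def field_simps)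
    then have "\<gamma> + \<beta> * ?s + ?s ^ 2 = 0" using c by simp
    then have s2: "?s ^ 2 = - \<beta> * ?s - \<gamma>" by (simp add: algebra_simps eq_neg_iff_add_eq_0)
    \<comment> \<open>\<open>u * y + v\<close> is the remainder of the complementary cubic on
      division by the quadratic y^2 + \<beta> y + \<gamma>. It vanishes at \<open>r 2\<close>, and
      the linear case makes it zero.\<close>
    define u where "u = \<beta> * \<beta> - \<gamma> - P * \<beta> + P * ?t"
    define v where "v = \<beta> * \<gamma> - P * \<gamma> + P * (?t * ?t)"
    have "?s ^ 3 = ?s * ?s ^ 2" by (simp add: power2_eq_square power3_eq_cube)
    also have "\<dots> = ?s * (- \<beta> * ?s - \<gamma>)" by (simp only: s2)
    also have "\<dots> = - \<beta> * ?s ^ 2 - \<gamma> * ?s" by (simp add: algebra_simps power2_eq_square)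
    also have "\<dots> = - \<beta> * (- \<beta> * ?s - \<gamma>) - \<gamma> * ?s" by (simp only: s2)
    finally have "- \<beta> * (- \<beta> * ?s - \<gamma>) - \<gamma> * ?s = - P * ((- \<beta> * ?s - \<gamma>) + ?t * ?s + ?t ^ 2)"
      using cubic_relation[of 1 2] by (simp add: s2 P_def)
    then have "v + u * ?s = 0" by (simp add: u_def v_def algebra_simps power2_eq_square)
    moreover have "u \<in> S" "v \<in> S" unfolding u_def v_def by (intro cl inS)+
    ultimately have uv: "v = 0" "u = 0" using lin by blast+
    \<comment> \<open>The third zero of the cubic: its zeros have sum \<open>- P\<close>, those of
      the quadratic have sum \<open>- \<beta>\<close>.\<close>
    define z where "z = \<beta> - P"
    have zS: "z \<in> S" unfolding z_def by (intro cl inS)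
    have "z ^ 3 + P * (z ^ 2 + ?t * z + ?t ^ 2) = u * z + v"
      unfolding z_def u_def v_def by (simp add: algebra_simps power2_eq_square power3_eq_cube)
    then have zcubic: "z ^ 3 + P * (z ^ 2 + ?t * z + ?t ^ 2) = 0" using uv by simp
    then have "(z ^ 4 + of_int (4 * k) * z ^ 3) - (?t ^ 4 + of_int (4 * k) * ?t ^ 3) = 0"
      unfolding complementary_cubic_factor[symmetric] P_def by simp
    then have "rp F z = rp F ?t" unfolding F_at_expand by simp
    then have "rp F z = 0" using root[of 1] by simp
    then obtain m where m: "m \<in> {1..4}" "z = r m" using root_iff by blast
    \<comment> \<open>At \<open>r 1\<close> itself the cubic takes the value of the derivative of
      \<open>F\<close>, which is nonzero because the roots are distinct.\<close>
    have "m \<noteq> 1"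
    proof
      assume "m = 1"
      then have "4 * ?t ^ 2 * (?t + of_int (3 * k)) = 0" using zcubic m(2)
        by (simp add: P_def algebra_simps power2_eq_square power3_eq_cube)
      then have "(r 1 - r 2) * (r 1 - r 3) * (r 1 - r 4) = 0" unfolding derivative_at_roots .
      then show False using delta_nonzero unfolding delta_def by simp
    qed
    then show False using notS m zS by blast
  qed
  with assms have "rp a ?t + rp b ?t * ?s = 0" by simp
  with lin S c0 show "rp a ?t = 0" "rp b ?t = 0" "rp c ?t = 0" by blast+
qed

end

section \<open>Signs of permutations of the roots\<close>

definition vandermonde :: "(nat \<Rightarrow> complex) \<Rightarrow> complex" where
  "vandermonde t = (t 1 - t 2) * (t 1 - t 3) * (t 1 - t 4) * (t 2 - t 3) * (t 2 - t 4) * (t 3 - t 4)"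

lemma prod_4: "(\<Prod>i\<in>{1..4}. g i) = g 1 * g 2 * g 3 * g (4 :: nat)" for g :: "nat \<Rightarrow> 'a :: comm_monoid_mult"
  unfolding index_set_4 by (simp add: mult_ac)

text \<open>With separate arguments a transposition becomes a visible exchange of variables.\<close>

definition vandermonde4 :: "complex \<Rightarrow> complex \<Rightarrow> complex \<Rightarrow> complex \<Rightarrow> complex" where
  "vandermonde4 x y z w = (x - y) * (x - z) * (x - w) * (y - z) * (y - w) * (z - w)"

lemma vandermonde4_swap:
  "vandermonde4 y x z w = - vandermonde4 x y z w" "vandermonde4 z y x w = - vandermonde4 x y z w"
  "vandermonde4 w y z x = - vandermonde4 x y z w" "vandermonde4 x z y w = - vandermonde4 x y z w"
  "vandermonde4 x w z y = - vandermonde4 x y z w" "vandermonde4 x y w z = - vandermonde4 x y z w"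
proof -
  have m: "y - x = - (x - y)" "z - x = - (x - z)" "w - x = - (x - w)"
    "z - y = - (y - z)" "w - y = - (y - w)" "w - z = - (z - w)" by simp_all
  show "vandermonde4 y x z w = - vandermonde4 x y z w" "vandermonde4 z y x w = - vandermonde4 x y z w"
    "vandermonde4 w y z x = - vandermonde4 x y z w" "vandermonde4 x z y w = - vandermonde4 x y z w"
    "vandermonde4 x w z y = - vandermonde4 x y z w" "vandermonde4 x y w z = - vandermonde4 x y z w"
    unfolding vandermonde4_def m by (simp_all only: mult_minus_left mult_minus_right minus_minus mult_ac)
qed

lemma vandermonde_transpose_less:
  assumes "a \<in> {1..4}" "b \<in> {1..4}" "a < b"
  shows "vandermonde (t \<circ> Transposition.transpose a b) = - vandermonde t"
proof -
  have v: "vandermonde t = vandermonde4 (t 1) (t 2) (t 3) (t 4)" for t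
    by (simp add: vandermonde_def vandermonde4_def)
  consider "a = 1" "b = 2" | "a = 1" "b = 3" | "a = 1" "b = 4" | "a = 2" "b = 3" | "a = 2" "b = 4" | "a = 3" "b = 4"
    using assms unfolding index_set_4 by auto
  then show ?thesis
    by cases (simp_all add: v Transposition.transpose_def, (rule vandermonde4_swap)+)
qed

lemma vandermonde_permute:
  assumes "p permutes {1..4}"
  shows "vandermonde (t \<circ> p) = (if evenperm p then 1 else - 1) * vandermonde t"
  using assms finite_atLeastAtMost
proof (induction p arbitrary: t rule: permutes_induct)
  case (swap a b p)
  have tr: "vandermonde (t \<circ> Transposition.transpose a b) = - vandermonde t"
    using vandermonde_transpose_less[of a b t] vandermonde_transpose_less[of b a t] swap.hyps
    by (cases a b rule: linorder_cases) (simp_all add: transpose_commute)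
  have "vandermonde (t \<circ> (Transposition.transpose a b \<circ> p)) = vandermonde ((t \<circ> Transposition.transpose a b) \<circ> p)"
    by (simp add: comp_assoc)
  also have "\<dots> = (if evenperm p then 1 else - 1) * - vandermonde t" by (simp only: swap.IH tr)
  finally have v: "vandermonde (t \<circ> (Transposition.transpose a b \<circ> p)) = (if evenperm p then 1 else - 1) * - vandermonde t" .
  have e: "evenperm (Transposition.transpose a b \<circ> p) \<longleftrightarrow> \<not> evenperm p"
    using swap.hyps permutes_imp_permutation[OF finite_atLeastAtMost]
    by (subst evenperm_comp) (auto simp: permutation_swap_id evenperm_swap)
  show ?case unfolding v e by (cases "evenperm p") simp_all
qed (simp add: evenperm_id)

text \<open>The quotient of the two permutations fixes 1 and 2, so it is the identity or the odd
  transposition of 3 and 4.\<close>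

lemma even_permutations_eq:
  fixes p q :: "nat \<Rightarrow> nat"
  assumes "p permutes {1..4}" "q permutes {1..4}" "evenperm p" "evenperm q" "p 1 = q 1" "p 2 = q 2"
  shows "p = q"
proof -
  define s where "s = inv' q \<circ> p"
  have s: "s permutes {1..4}" unfolding s_def by (intro permutes_compose permutes_inv assms)
  note perm_4 = permutes_imp_permutation[OF finite_atLeastAtMost]
  note perm = perm_4[OF assms(1)] perm_4[OF assms(2)] perm_4[OF permutes_inv[OF assms(2)]]
  have even: "evenperm s" unfolding s_def using evenperm_comp[OF perm(3,1)] evenperm_inv[OF perm(2)] assms by simp
  have "s 1 = 1" "s 2 = 2" using assms(5,6) permutes_inverses(2)[OF assms(2)] by (simp_all add: s_def)
  then have "s x = x" if "x \<in> {1..4} - {3, 4}" for x using that unfolding index_set_4 by auto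
  then have "s permutes {3, 4}" by (rule permutes_superset[OF s])
  then have "s = id \<or> s = Transposition.transpose 3 4" by (simp only: permutes_doubleton_iff)
  then have "s = id" using even by (auto simp: evenperm_swap)
  then have "q \<circ> s = q" by simp
  moreover have "q \<circ> s = p" unfolding s_def using permutes_inv_o(1)[OF assms(2)] by (simp add: comp_assoc[symmetric])
  ultimately show ?thesis by simp
qed

text \<open>For distinct roots \<open>x\<close> and \<open>y\<close> of the quartic, the elements of the splitting field are the
  values \<open>E x y T\<close>; an automorphism changes the pair \<open>x\<close>, \<open>y\<close> and keeps \<open>T\<close>.\<close>

definition E :: "complex \<Rightarrow> complex \<Rightarrow> rat poly \<times> rat poly \<times> rat poly \<Rightarrow> complex" where
  "E x y = (\<lambda>(a, b, c). rp a x + rp b x * y + rp c x * y ^ 2)"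

text \<open>What matters here and in the next lemmas is that the coefficients of the result do not
  depend on \<open>x\<close> and \<open>y\<close>. This makes the change of the pair a
  homomorphism.\<close>

lemma E_add: "\<exists>T''. \<forall>x y. E x y T + E x y T' = E x y T''"
proof -
  obtain a b c a' b' c' where "T = (a, b, c)" "T' = (a', b', c')" by (cases T, cases T')
  then show ?thesis
    by (intro exI[of _ "(a + a', b + b', c + c')"]) (simp add: E_def algebra_simps)
qed

lemma E_diff: "\<exists>T''. \<forall>x y. E x y T - E x y T' = E x y T''"
proof -
  obtain a b c a' b' c' where "T = (a, b, c)" "T' = (a', b', c')" by (cases T, cases T')
  then show ?thesis
    by (intro exI[of _ "(a - a', b - b', c - c')"]) (simp add: E_def algebra_simps)
qed

text \<open>The powers y^3 and y^4 are reduced by the relation to coefficients polynomial in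
  \<open>x\<close>, \<open>P\<close> and the given ones, as \<open>E_mult\<close> requires.\<close>

lemma cubic_extension_product:
  fixes x y P :: complex
  assumes y: "y ^ 3 = - P * (y ^ 2 + x * y + x ^ 2)"
  shows "(a0 + a1 * y + a2 * y ^ 2) * (b0 + b1 * y + b2 * y ^ 2)
    = (a0 * b0 - P * (x * x) * (a1 * b2 + a2 * b1) + P * P * (x * x) * (a2 * b2))
    + (a0 * b1 + a1 * b0 - P * x * (a1 * b2 + a2 * b1) + (P * P * x - P * (x * x)) * (a2 * b2)) * y
    + (a0 * b2 + a1 * b1 + a2 * b0 - P * (a1 * b2 + a2 * b1) + (P * P - P * x) * (a2 * b2)) * y ^ 2"
proof -
  have "y ^ 4 = y * y ^ 3" by (simp add: power_numeral_reduce)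
  also have "\<dots> = y * (- P * (y ^ 2 + x * y + x ^ 2))" by (simp only: y)
  also have "\<dots> = - P * (y ^ 3 + x * y ^ 2 + x ^ 2 * y)"
    by (simp add: algebra_simps power2_eq_square power3_eq_cube)
  finally have y4: "y ^ 4 = - P * (- P * (y ^ 2 + x * y + x ^ 2) + x * y ^ 2 + x ^ 2 * y)"
    unfolding y .
  have "(a0 + a1 * y + a2 * y ^ 2) * (b0 + b1 * y + b2 * y ^ 2)
    = a0 * b0 + (a0 * b1 + a1 * b0) * y + (a0 * b2 + a1 * b1 + a2 * b0) * y ^ 2
      + (a1 * b2 + a2 * b1) * y ^ 3 + (a2 * b2) * y ^ 4"
    by (simp add: algebra_simps power2_eq_square power3_eq_cube power4_eq_xxxx)
  also have "\<dots> = (a0 * b0 - P * (x * x) * (a1 * b2 + a2 * b1) + P * P * (x * x) * (a2 * b2))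
    + (a0 * b1 + a1 * b0 - P * x * (a1 * b2 + a2 * b1) + (P * P * x - P * (x * x)) * (a2 * b2)) * y
    + (a0 * b2 + a1 * b1 + a2 * b0 - P * (a1 * b2 + a2 * b1) + (P * P - P * x) * (a2 * b2)) * y ^ 2"
    unfolding y y4 by (simp add: algebra_simps power2_eq_square)
  finally show ?thesis .
qed

text \<open>For A = 4 k the relation is \<open>cubic_relation\<close>, which holds for every ordered
  pair of distinct roots; one \<open>T''\<close> serves them all.\<close>

lemma E_mult:
  fixes A :: int
  shows "\<exists>T''. \<forall>x y. y ^ 3 = - (x + of_int A) * (y ^ 2 + x * y + x ^ 2) \<longrightarrow> E x y T * E x y T' = E x y T''"
proof -
  obtain a0 a1 a2 b0 b1 b2 where T: "T = (a0, a1, a2)" "T' = (b0, b1, b2)" by (cases T, cases T')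
  define X :: "rat poly" where "X = [:0, 1:]"
  define P :: "rat poly" where "P = [:of_int A, 1:]"
  define T'' where "T'' = (a0 * b0 - P * (X * X) * (a1 * b2 + a2 * b1) + P * P * (X * X) * (a2 * b2),
    a0 * b1 + a1 * b0 - P * X * (a1 * b2 + a2 * b1) + (P * P * X - P * (X * X)) * (a2 * b2),
    a0 * b2 + a1 * b1 + a2 * b0 - P * (a1 * b2 + a2 * b1) + (P * P - P * X) * (a2 * b2))"
  have X: "rp X x = x" and P: "rp P x = x + of_int A" for x by (simp_all add: X_def P_def)
  show ?thesis
    by (intro exI[of _ T''] allI impI)
       (simp only: T T''_def E_def prod.case rp_add rp_diff rp_mult X P cubic_extension_product)
qed

lemma rp_in_generate_field:
  assumes "x \<in> generate_field complex_ring H" "\<rat> \<subseteq> H"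
  shows "rp p x \<in> generate_field complex_ring H"
proof (induction p)
  case 0
  then show ?case using generate_field.incl[of 0 H complex_ring] assms(2) by auto
next
  case (pCons c p)
  have "of_rat c \<in> generate_field complex_ring H"
    by (rule generate_field.incl) (use assms(2) Rats_of_rat in blast)
  then show ?case using pCons assms(1) by (simp add: generate_field_complex_ringI)
qed

section \<open>The splitting field and its automorphisms\<close>

context A4_quartic
begin

definition L :: "complex set" where
  "L = generate_field complex_ring (\<rat> \<union> r ` {1..4})"

lemma L_closed:
  "\<And>x y. x \<in> L \<Longrightarrow> y \<in> L \<Longrightarrow> x + y \<in> L" "\<And>x y. x \<in> L \<Longrightarrow> y \<in> L \<Longrightarrow> x * y \<in> L"
  "\<And>x. x \<in> \<rat> \<Longrightarrow> x \<in> L" "\<And>i. i \<in> {1..4} \<Longrightarrow> r i \<in> L" "\<And>x p. x \<in> L \<Longrightarrow> rp p x \<in> L"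
  unfolding L_def
  using generate_field_complex_ringI rp_in_generate_field generate_field.incl[of _ "\<rat> \<union> r ` {1..4}" complex_ring]
  by auto

lemma L_closed':
  assumes "x \<in> L" shows "- x \<in> L" and "y \<in> L \<Longrightarrow> x - y \<in> L"
proof -
  have m: "- z \<in> L" if "z \<in> L" for z using L_closed(2)[OF L_closed(3)[of "- 1"] that] by simp
  then show "- x \<in> L" using assms .
  show "x - y \<in> L" if "y \<in> L" using L_closed(1)[OF assms m[OF that]] by simp
qed

lemma permuted_roots:
  assumes "p permutes {1..4}"
  shows "A4_quartic k (r \<circ> p)"
proof
  have "(\<Prod>i\<in>{1..4}. [:- r i, 1:]) = (\<Prod>i\<in>{1..4}. [:- r (p i), 1:])"
    by (rule prod.reindex_bij_betw[OF permutes_imp_bij[OF assms], symmetric])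
  then show "[:of_int (27 * k ^ 4 + 1), 0, 0, of_int (4 * k), 1:]
      = [:- (r \<circ> p) 1, 1:] * [:- (r \<circ> p) 2, 1:] * [:- (r \<circ> p) 3, 1:] * [:- (r \<circ> p) 4, 1:]"
    unfolding factorization comp_apply prod_4 .
qed (fact k_nonzero k_even squarefree_d)+

lemma E_common_denominator: "\<exists>m :: int. m \<noteq> 0 \<and> algebraic_int (of_int m * E (r 1) (r 2) T)"
proof -
  obtain a b c where T: "T = (a, b, c)" by (cases T)
  have alg: "algebraic_int (r 1)" "algebraic_int (r 2)" by (simp_all add: algebraic_int_root)
  obtain ma mb mc :: int where m: "ma \<noteq> 0" "mb \<noteq> 0" "mc \<noteq> 0" "algebraic_int (of_int ma * rp a (r 1))"
    "algebraic_int (of_int mb * rp b (r 1))" "algebraic_int (of_int mc * rp c (r 1))"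
    using rational_common_denominator[OF alg(1)] by metis
  have "of_int (ma * mb * mc) * E (r 1) (r 2) T = of_int (mb * mc) * (of_int ma * rp a (r 1))
      + of_int (ma * mc) * (of_int mb * rp b (r 1)) * r 2 + of_int (ma * mb) * (of_int mc * rp c (r 1)) * r 2 ^ 2"
    by (simp only: T E_def prod.case of_int_mult distrib_left mult_ac)
  also have "algebraic_int \<dots>"
    by (intro algebraic_int_add algebraic_int_mult algebraic_int_power algebraic_int_of_int alg m)
  finally show ?thesis using m by (intro exI[of _ "ma * mb * mc"]) simp
qed

text \<open>\<open>r 3\<close> and \<open>r 4\<close> lie in the field of \<open>r 1\<close> and
  \<open>r 2\<close>: their sum by Vieta, and their difference because the derivatives at
  \<open>r 1\<close> and \<open>r 2\<close> times r 3 - r 4 give delta (r 2 - r 1). Here the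
  rationality of \<open>delta\<close> is decisive.\<close>

lemma range_E: "range (E (r 1) (r 2)) = L"
proof
  show "range (E (r 1) (r 2)) \<subseteq> L"
  proof clarify
    fix a b c
    have "r 1 \<in> L" "r 2 \<in> L" by (simp_all add: L_closed(4))
    then show "E (r 1) (r 2) (a, b, c) \<in> L"
      by (simp add: E_def power2_eq_square L_closed)
  qed
  let ?S = "range (E (r 1) (r 2))"
  have add: "x + y \<in> ?S" if xy: "x \<in> ?S" "y \<in> ?S" for x y
  proof -
    obtain T T' where T: "x = E (r 1) (r 2) T" "y = E (r 1) (r 2) T'" using xy by auto
    obtain T'' where "\<forall>x y. E x y T + E x y T' = E x y T''" using E_add by blast
    then have "x + y = E (r 1) (r 2) T''" by (simp add: T)
    then show ?thesis by (rule range_eqI)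
  qed
  have mult: "x * y \<in> ?S" if xy: "x \<in> ?S" "y \<in> ?S" for x y
  proof -
    obtain T T' where T: "x = E (r 1) (r 2) T" "y = E (r 1) (r 2) T'" using xy by auto
    obtain T'' where "\<forall>x y. y ^ 3 = - (x + of_int (4 * k)) * (y ^ 2 + x * y + x ^ 2)
        \<longrightarrow> E x y T * E x y T' = E x y T''" using E_mult by blast
    then have "E (r 1) (r 2) T * E (r 1) (r 2) T' = E (r 1) (r 2) T''"
      using cubic_relation[of 1 2] by simp
    then have "x * y = E (r 1) (r 2) T''" by (simp only: T)
    then show ?thesis by (rule range_eqI)
  qed
  have base: "rp a (r 1) \<in> ?S" "r 2 \<in> ?S" for a
  proof -
    have "rp a (r 1) = E (r 1) (r 2) (a, 0, 0)" "r 2 = E (r 1) (r 2) (0, 1, 0)" by (simp_all add: E_def)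
    then show "rp a (r 1) \<in> ?S" "r 2 \<in> ?S" by (blast intro: range_eqI)+
  qed
  have rat: "\<rat> \<subseteq> ?S"
  proof
    fix x :: complex assume "x \<in> \<rat>"
    then obtain q where "x = rp [:q:] (r 1)" by (auto simp: of_rat_in_Rats_iff)
    then show "x \<in> ?S" by (simp only: base(1))
  qed
  have inv: "inverse x \<in> ?S" if x: "x \<in> ?S" for x
  proof -
    obtain T where T: "x = E (r 1) (r 2) T" using x by auto
    obtain m :: int where "m \<noteq> 0" "algebraic_int (of_int m * x)" using E_common_denominator unfolding T by blast
    then show ?thesis using inverse_in_subring[OF rat add mult x] by blast
  qed
  have neg: "- x \<in> ?S" if "x \<in> ?S" for x using mult[OF subsetD[OF rat, of "- 1"] that] by simp
  have diff: "x - y \<in> ?S" if "x \<in> ?S" "y \<in> ?S" for x y using add[OF that(1) neg[OF that(2)]] by simp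
  have sf: "subfield ?S complex_ring"
    by (rule subfield_complex_ringI) (use rat add mult inv neg in auto)
  have t1: "r 1 \<in> ?S" using base(1)[of "[:0, 1:]"] by simp
  note t2 = base(2)
  have num: "numeral n \<in> ?S" "of_int m \<in> ?S" for n m using rat by auto
  define D1 where "D1 = 4 * r 1 ^ 2 * (r 1 + of_int (3 * k))"
  define D2 where "D2 = 4 * r 2 ^ 2 * (r 2 + of_int (3 * k))"
  have D: "D1 \<in> ?S" "D2 \<in> ?S"
    unfolding D1_def D2_def power2_eq_square by (intro mult add num t1 t2)+
  have D1: "(r 1 - r 2) * (r 1 - r 3) * (r 1 - r 4) = D1" and D2: "(r 2 - r 1) * (r 2 - r 3) * (r 2 - r 4) = D2"
    unfolding derivative_at_roots D1_def D2_def by (rule refl)+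
  have "delta * (r 2 - r 1) = D1 * D2 * (r 3 - r 4)"
    unfolding D1[symmetric] D2[symmetric] delta_def by (simp only: mult_ac)
  moreover have "D1 \<noteq> 0" "D2 \<noteq> 0"
    using delta_nonzero unfolding D1[symmetric] D2[symmetric] delta_def by auto
  ultimately have "r 3 - r 4 = delta * (r 2 - r 1) * inverse D1 * inverse D2"
    by (simp add: field_simps)
  also have "\<dots> \<in> ?S" using delta_Rats rat by (intro mult inv D diff t1 t2) auto
  finally have m: "r 3 - r 4 \<in> ?S" .
  have "r 3 + r 4 = - of_int (4 * k) - r 1 - r 2" unfolding Vieta(1)[symmetric] by simp
  also have "\<dots> \<in> ?S" by (intro diff neg num t1 t2)
  finally have p: "r 3 + r 4 \<in> ?S" .
  have "r 3 = inverse 2 * ((r 3 + r 4) + (r 3 - r 4))" "r 4 = inverse 2 * ((r 3 + r 4) - (r 3 - r 4))" by simp_all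
  moreover have "inverse 2 * ((r 3 + r 4) + (r 3 - r 4)) \<in> ?S" "inverse 2 * ((r 3 + r 4) - (r 3 - r 4)) \<in> ?S"
    by (rule mult[OF inv[OF num(1)] add[OF p m]]) (rule mult[OF inv[OF num(1)] diff[OF p m]])
  ultimately have t34: "r 3 \<in> ?S" "r 4 \<in> ?S" by simp_all
  have "r ` {1..4} \<subseteq> ?S"
    unfolding index_set_4 by (simp only: image_insert image_empty insert_subset empty_subsetI t1 t2 t34 simp_thms)
  then show "L \<subseteq> ?S" unfolding L_def by (intro generate_field_subset[OF _ sf] Un_least rat)
qed

text \<open>The difference of the two triples represents 0. Independence over the field of
  \<open>r 1\<close> makes its three components vanish at \<open>r 1\<close>, hence at every
  conjugate.\<close>

lemma E_transfer:
  assumes p: "p permutes {1..4}" and eq: "E (r 1) (r 2) T = E (r 1) (r 2) T'"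
  shows "E (r (p 1)) (r (p 2)) T = E (r (p 1)) (r (p 2)) T'"
proof -
  obtain T'' where T'': "\<forall>x y. E x y T - E x y T' = E x y T''" using E_diff by blast
  obtain a b c where abc: "T'' = (a, b, c)" by (cases T'')
  have "E (r 1) (r 2) T'' = 0" using T'' eq by (metis cancel_comm_monoid_add_class.diff_cancel)
  then have z: "rp a (r 1) = 0" "rp b (r 1) = 0" "rp c (r 1) = 0"
    using independence_over_generated_field by (simp_all add: abc E_def)
  have "p 1 \<in> {1..4}" using permutes_in_image[OF p, of 1] by simp
  then have "rp a (r (p 1)) = 0" "rp b (r (p 1)) = 0" "rp c (r (p 1)) = 0"
    using z conjugate_zero[of 1] by auto
  then have "E (r (p 1)) (r (p 2)) T'' = 0" by (simp add: abc E_def)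
  then show ?thesis using T'' by (metis eq_iff_diff_eq_0)
qed

lemma E_transfer_iff:
  assumes p: "p permutes {1..4}"
  shows "E (r (p 1)) (r (p 2)) T = E (r (p 1)) (r (p 2)) T' \<longleftrightarrow> E (r 1) (r 2) T = E (r 1) (r 2) T'"
proof
  \<comment> \<open>The converse is \<open>E_transfer\<close> for the permuted labelling and the
    inverse permutation.\<close>
  interpret P: A4_quartic k "r \<circ> p" by (rule permuted_roots[OF p])
  assume "E (r (p 1)) (r (p 2)) T = E (r (p 1)) (r (p 2)) T'"
  then show "E (r 1) (r 2) T = E (r 1) (r 2) T'"
    using P.E_transfer[OF permutes_inv[OF p], of T T'] by (simp add: permutes_inverses[OF p])
qed (rule E_transfer[OF p])

lemma range_E_permuted:
  assumes p: "p permutes {1..4}"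
  shows "range (E (r (p 1)) (r (p 2))) = L"
proof -
  interpret P: A4_quartic k "r \<circ> p" by (rule permuted_roots[OF p])
  have "(r \<circ> p) ` {1..4} = r ` {1..4}" by (metis image_comp permutes_image[OF p])
  then have "P.L = L" unfolding P.L_def L_def by (simp only:)
  then show ?thesis using P.range_E by simp
qed

lemma galois_carrier: "\<sigma> \<in> carrier (galois_group f) \<longleftrightarrow> \<sigma> \<in> Bij L \<and>
    (\<forall>x\<in>L. \<forall>y\<in>L. \<sigma> (x * y) = \<sigma> x * \<sigma> y \<and> \<sigma> (x + y) = \<sigma> x + \<sigma> y) \<and> (\<forall>q\<in>\<rat>. \<sigma> q = q)"
  (is "?l \<longleftrightarrow> ?r")
proof -
  have L: "splitting_field f = L" by (simp add: splitting_field_def complex_roots_f L_def)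
  have "?l \<longleftrightarrow> \<sigma> \<in> Bij L \<and> \<sigma> \<in> Ring.ring_hom (complex_ring\<lparr>carrier := L\<rparr>) (complex_ring\<lparr>carrier := L\<rparr>)
      \<and> (\<forall>q\<in>\<rat>. \<sigma> q = q)"
    unfolding galois_group_def Let_def L by simp
  also have "\<dots> \<longleftrightarrow> ?r"
  proof (rule conj_cong[OF refl], rule iffI)
    assume "\<sigma> \<in> Bij L" and h: "\<sigma> \<in> Ring.ring_hom (complex_ring\<lparr>carrier := L\<rparr>) (complex_ring\<lparr>carrier := L\<rparr>)
      \<and> (\<forall>q\<in>\<rat>. \<sigma> q = q)"
    then show "(\<forall>x\<in>L. \<forall>y\<in>L. \<sigma> (x * y) = \<sigma> x * \<sigma> y \<and> \<sigma> (x + y) = \<sigma> x + \<sigma> y) \<and> (\<forall>q\<in>\<rat>. \<sigma> q = q)"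
      using ring_hom_mult[OF conjunct1[OF h]] ring_hom_add[OF conjunct1[OF h]] by simp
  next
    assume b: "\<sigma> \<in> Bij L" and h: "(\<forall>x\<in>L. \<forall>y\<in>L. \<sigma> (x * y) = \<sigma> x * \<sigma> y \<and> \<sigma> (x + y) = \<sigma> x + \<sigma> y)
      \<and> (\<forall>q\<in>\<rat>. \<sigma> q = q)"
    have "\<sigma> \<in> Ring.ring_hom (complex_ring\<lparr>carrier := L\<rparr>) (complex_ring\<lparr>carrier := L\<rparr>)"
      by (rule ring_hom_memI) (use h funcset_mem[OF Bij_imp_funcset[OF b]] in auto)
    then show "\<sigma> \<in> Ring.ring_hom (complex_ring\<lparr>carrier := L\<rparr>) (complex_ring\<lparr>carrier := L\<rparr>)
      \<and> (\<forall>q\<in>\<rat>. \<sigma> q = q)" using h by blast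
  qed
  finally show ?thesis .
qed

lemma galois_mult:
  assumes "\<sigma> \<in> carrier (galois_group f)" "\<tau> \<in> carrier (galois_group f)"
  shows "\<sigma> \<otimes>\<^bsub>galois_group f\<^esub> \<tau> = compose L \<sigma> \<tau>"
proof -
  have L: "splitting_field f = L" by (simp add: splitting_field_def complex_roots_f L_def)
  show ?thesis using assms unfolding galois_carrier by (simp add: galois_group_def Let_def L BijGroup_def)
qed

lemma automorphism_exists:
  assumes p: "p permutes {1..4}"
  obtains \<sigma> where "\<sigma> \<in> carrier (galois_group f)" "\<sigma> (r 1) = r (p 1)" "\<sigma> (r 2) = r (p 2)"
proof -
  \<comment> \<open>By \<open>E_transfer\<close> the value does not depend on the chosen triple. The
    restriction makes the map extensional, as \<open>Bij\<close> demands.\<close>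
  define \<sigma> where "\<sigma> = restrict (\<lambda>z. E (r (p 1)) (r (p 2)) (SOME T. z = E (r 1) (r 2) T)) L"
  have inL: "E (r 1) (r 2) T \<in> L" for T using range_E by blast
  have \<sigma>E: "\<sigma> (E (r 1) (r 2) T) = E (r (p 1)) (r (p 2)) T" for T
  proof -
    have "E (r 1) (r 2) T = E (r 1) (r 2) (SOME T'. E (r 1) (r 2) T = E (r 1) (r 2) T')"
      by (rule someI) (rule refl)
    from E_transfer[OF p this] show ?thesis using inL by (simp add: \<sigma>_def)
  qed
  have cases: "\<exists>T. z = E (r 1) (r 2) T" if "z \<in> L" for z using that range_E by blast
  have "\<sigma> ` L = L"
  proof -
    have "\<sigma> ` L = range (\<lambda>T. \<sigma> (E (r 1) (r 2) T))" unfolding range_E[symmetric] by (rule image_image)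
    then show ?thesis using \<sigma>E range_E_permuted[OF p] by simp
  qed
  moreover have "inj_on \<sigma> L"
  proof (rule inj_onI)
    fix z w assume "z \<in> L" "w \<in> L" and eq: "\<sigma> z = \<sigma> w"
    then obtain T T' where T: "z = E (r 1) (r 2) T" "w = E (r 1) (r 2) T'" using cases by blast
    then show "z = w" using eq \<sigma>E E_transfer_iff[OF p] by simp
  qed
  moreover have "\<sigma> \<in> extensional L" by (simp add: \<sigma>_def)
  ultimately have bij: "\<sigma> \<in> Bij L" by (simp add: Bij_def bij_betw_def)
  have rel: "r 2 ^ 3 = - (r 1 + of_int (4 * k)) * (r 2 ^ 2 + r 1 * r 2 + r 1 ^ 2)"
    using cubic_relation[of 1 2] by simp
  have p12: "p 1 \<in> {1..4}" "p 2 \<in> {1..4}" using permutes_in_image[OF p, of 1] permutes_in_image[OF p, of 2] by simp_all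
  have "p 1 \<noteq> p 2" using injD[OF permutes_inj[OF p], of 1 2] by auto
  from cubic_relation[OF p12 this]
  have rel': "r (p 2) ^ 3 = - (r (p 1) + of_int (4 * k)) * (r (p 2) ^ 2 + r (p 1) * r (p 2) + r (p 1) ^ 2)" .
  have hom: "\<sigma> (z * w) = \<sigma> z * \<sigma> w \<and> \<sigma> (z + w) = \<sigma> z + \<sigma> w" if zw: "z \<in> L" "w \<in> L" for z w
  proof -
    obtain T T' where T: "z = E (r 1) (r 2) T" "w = E (r 1) (r 2) T'" using cases zw by blast
    obtain T1 where T1: "\<And>x y. y ^ 3 = - (x + of_int (4 * k)) * (y ^ 2 + x * y + x ^ 2)
        \<Longrightarrow> E x y T * E x y T' = E x y T1" using E_mult by metis
    obtain T2 where T2: "\<And>x y. E x y T + E x y T' = E x y T2" using E_add by metis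
    have "\<sigma> (z * w) = E (r (p 1)) (r (p 2)) T1" "\<sigma> (z + w) = E (r (p 1)) (r (p 2)) T2"
      by (simp_all only: T T1[OF rel] T2 \<sigma>E)
    moreover have "\<sigma> z * \<sigma> w = E (r (p 1)) (r (p 2)) T1" "\<sigma> z + \<sigma> w = E (r (p 1)) (r (p 2)) T2"
      by (simp_all only: T T1[OF rel'] T2 \<sigma>E)
    ultimately show ?thesis by (simp only:)
  qed
  have rat: "\<sigma> q = q" if "q \<in> \<rat>" for q
  proof -
    obtain c where "q = E (r 1) (r 2) ([:c:], 0, 0)" "q = E (r (p 1)) (r (p 2)) ([:c:], 0, 0)"
      using \<open>q \<in> \<rat>\<close> by (auto simp: of_rat_in_Rats_iff E_def)
    then show ?thesis using \<sigma>E by metis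
  qed
  have "\<sigma> \<in> carrier (galois_group f)" unfolding galois_carrier using bij hom rat by blast
  moreover have "\<sigma> (r 1) = r (p 1)" using \<sigma>E[of "([:0, 1:], 0, 0)"] by (simp add: E_def)
  moreover have "\<sigma> (r 2) = r (p 2)" using \<sigma>E[of "(0, 1, 0)"] by (simp add: E_def)
  ultimately show ?thesis by (rule that)
qed

text \<open>It is the identity outside the indices because \<open>permutes\<close> demands
  this.\<close>

definition root_perm :: "(complex \<Rightarrow> complex) \<Rightarrow> nat \<Rightarrow> nat" where
  "root_perm \<sigma> i = (if i \<in> {1..4} then THE j. j \<in> {1..4} \<and> \<sigma> (r i) = r j else i)"

lemma galois_hom:
  assumes "\<sigma> \<in> carrier (galois_group f)"
  shows "x \<in> L \<Longrightarrow> y \<in> L \<Longrightarrow> \<sigma> (x + y) = \<sigma> x + \<sigma> y" "x \<in> L \<Longrightarrow> y \<in> L \<Longrightarrow> \<sigma> (x * y) = \<sigma> x * \<sigma> y"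
    "q \<in> \<rat> \<Longrightarrow> \<sigma> q = q" "x \<in> L \<Longrightarrow> y \<in> L \<Longrightarrow> \<sigma> (x - y) = \<sigma> x - \<sigma> y"
    "x \<in> L \<Longrightarrow> \<sigma> (rp p x) = rp p (\<sigma> x)" "x \<in> L \<Longrightarrow> \<sigma> x \<in> L" "inj_on \<sigma> L"
proof -
  have c: "\<sigma> \<in> Bij L" "\<And>x y. x \<in> L \<Longrightarrow> y \<in> L \<Longrightarrow> \<sigma> (x * y) = \<sigma> x * \<sigma> y"
    "\<And>x y. x \<in> L \<Longrightarrow> y \<in> L \<Longrightarrow> \<sigma> (x + y) = \<sigma> x + \<sigma> y" "\<And>q. q \<in> \<rat> \<Longrightarrow> \<sigma> q = q"
    using assms unfolding galois_carrier by blast+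
  show "x \<in> L \<Longrightarrow> y \<in> L \<Longrightarrow> \<sigma> (x + y) = \<sigma> x + \<sigma> y" "x \<in> L \<Longrightarrow> y \<in> L \<Longrightarrow> \<sigma> (x * y) = \<sigma> x * \<sigma> y"
    "q \<in> \<rat> \<Longrightarrow> \<sigma> q = q" by (fact c)+
  show "\<sigma> (x - y) = \<sigma> x - \<sigma> y" if "x \<in> L" "y \<in> L"
    using c(3)[OF L_closed'(2)[OF that] that(2)] by simp
  show "x \<in> L \<Longrightarrow> \<sigma> x \<in> L" "inj_on \<sigma> L" using c(1) by (auto simp: Bij_def bij_betw_def)
  show "\<sigma> (rp p x) = rp p (\<sigma> x)" if x: "x \<in> L"
  proof (induction p)
    case 0
    then show ?case using c(4)[of 0] by simp
  next
    case (pCons a p)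
    have "of_rat a \<in> L" by (rule L_closed(3)) simp
    moreover have "x * rp p x \<in> L" by (intro L_closed(2) L_closed(5) x)
    ultimately show ?case using pCons.IH c(2)[OF x L_closed(5)[OF x]] by (simp add: c(3,4))
  qed
qed

text \<open>The image of a root is a root because the automorphism commutes with
  \<open>rp F\<close>. Evenness holds because \<open>delta\<close> is rational, hence fixed, and
  nonzero, while an odd permutation would change its sign.\<close>

lemma root_perm:
  assumes \<sigma>: "\<sigma> \<in> carrier (galois_group f)"
  shows "i \<in> {1..4} \<Longrightarrow> \<sigma> (r i) = r (root_perm \<sigma> i)" "root_perm \<sigma> permutes {1..4}" "evenperm (root_perm \<sigma>)"
proof -
  note hom = galois_hom[OF \<sigma>]
  have ex: "\<exists>!j. j \<in> {1..4} \<and> \<sigma> (r i) = r j" if i: "i \<in> {1..4}" for i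
  proof -
    have "rp F (\<sigma> (r i)) = \<sigma> (rp F (r i))" using hom(5)[OF L_closed(4)[OF i]] by simp
    also have "\<dots> = 0" using root[OF i] hom(3)[of 0] by simp
    finally obtain j where j: "j \<in> {1..4}" "\<sigma> (r i) = r j" using root_iff by blast
    then show ?thesis using inj_onD[OF inj_roots] by metis
  qed
  have rp: "root_perm \<sigma> i \<in> {1..4} \<and> \<sigma> (r i) = r (root_perm \<sigma> i)" if i: "i \<in> {1..4}" for i
    using theI'[OF ex[OF i]] i by (simp add: root_perm_def)
  show "i \<in> {1..4} \<Longrightarrow> \<sigma> (r i) = r (root_perm \<sigma> i)" using rp by blast
  show perm: "root_perm \<sigma> permutes {1..4}"
  proof (rule inj_imp_permutes)
    show "inj_on (root_perm \<sigma>) {1..4}"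
    proof (rule inj_onI)
      fix i j assume ij: "i \<in> {1..4}" "j \<in> {1..4}" "root_perm \<sigma> i = root_perm \<sigma> j"
      then have "\<sigma> (r i) = \<sigma> (r j)" using rp by metis
      then have "r i = r j" using inj_onD[OF hom(7)] L_closed(4) ij by blast
      then show "i = j" using inj_onD[OF inj_roots] ij by blast
    qed
  qed (use rp in \<open>auto simp: root_perm_def\<close>)
  have rL: "r 1 \<in> L" "r 2 \<in> L" "r 3 \<in> L" "r 4 \<in> L" by (simp_all add: L_closed(4))
  have delta: "delta = vandermonde r" by (simp add: delta_def vandermonde_def)
  have "delta = \<sigma> delta" using hom(3)[OF delta_Rats] by simp
  also have "\<dots> = vandermonde (\<sigma> \<circ> r)"
    unfolding delta_def vandermonde_def comp_apply
    by (simp only: hom(2,4) rL L_closed(2) L_closed'(2))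
  also have "\<dots> = vandermonde (r \<circ> root_perm \<sigma>)"
    unfolding vandermonde_def comp_apply using rp[of 1] rp[of 2] rp[of 3] rp[of 4] by simp
  also have "\<dots> = (if evenperm (root_perm \<sigma>) then 1 else - 1) * delta"
    using vandermonde_permute[OF perm] delta by simp
  finally show "evenperm (root_perm \<sigma>)" using delta_nonzero by (simp split: if_splits)
qed

text \<open>Injectivity: an automorphism is determined on all values of \<open>E\<close> by the
  images of \<open>r 1\<close> and \<open>r 2\<close>. Surjectivity: the automorphism with the
  prescribed images of these two roots acts by an even permutation, and two even permutations
  agreeing at 1 and 2 are equal.\<close>

lemma galois_group_f: "galois_group f \<cong> alt_group 4"
proof -
  have perm_eq: "root_perm \<sigma> i = j" if "\<sigma> \<in> carrier (galois_group f)" "i \<in> {1..4}" "j \<in> {1..4}" "\<sigma> (r i) = r j" for \<sigma> i j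
  proof -
    have "root_perm \<sigma> i \<in> {1..4}" using permutes_in_image[OF root_perm(2)[OF that(1)]] that(2) by blast
    then show ?thesis using root_perm(1)[OF that(1,2)] that(3,4) inj_onD[OF inj_roots] by metis
  qed
  have carrier: "\<sigma> \<otimes>\<^bsub>galois_group f\<^esub> \<tau> \<in> carrier (galois_group f)"
    if "\<sigma> \<in> carrier (galois_group f)" "\<tau> \<in> carrier (galois_group f)" for \<sigma> \<tau>
    unfolding galois_mult[OF that] galois_carrier
    using that compose_Bij[of \<sigma> L \<tau>] galois_hom[OF that(1)] galois_hom[OF that(2)]
    by (auto simp: galois_carrier compose_eq L_closed)
  have "root_perm \<in> hom (galois_group f) (alt_group 4)"
  proof (rule homI)
    fix \<sigma> assume "\<sigma> \<in> carrier (galois_group f)"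
    then show "root_perm \<sigma> \<in> carrier (alt_group 4)" using root_perm by (simp add: alt_group_carrier)
  next
    fix \<sigma> \<tau> assume \<sigma>: "\<sigma> \<in> carrier (galois_group f)" and \<tau>: "\<tau> \<in> carrier (galois_group f)"
    have "root_perm (\<sigma> \<otimes>\<^bsub>galois_group f\<^esub> \<tau>) i = root_perm \<sigma> (root_perm \<tau> i)" for i
    proof (cases "i \<in> {1..4}")
      case True
      have 1: "root_perm \<tau> i \<in> {1..4}" using permutes_in_image[OF root_perm(2)[OF \<tau>]] True by blast
      then have 2: "root_perm \<sigma> (root_perm \<tau> i) \<in> {1..4}"
        using permutes_in_image[OF root_perm(2)[OF \<sigma>]] by blast
      have "(\<sigma> \<otimes>\<^bsub>galois_group f\<^esub> \<tau>) (r i) = \<sigma> (\<tau> (r i))"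
        unfolding galois_mult[OF \<sigma> \<tau>] by (simp add: compose_eq L_closed(4)[OF True])
      also have "\<dots> = r (root_perm \<sigma> (root_perm \<tau> i))"
        using root_perm(1)[OF \<tau> True] root_perm(1)[OF \<sigma> 1] by simp
      finally show ?thesis by (rule perm_eq[OF carrier[OF \<sigma> \<tau>] True 2])
    next
      case False
      then have "root_perm \<tau> i = i" "root_perm \<sigma> i = i" by (simp_all only: root_perm_def if_False)
      then show ?thesis using False by (simp only: root_perm_def if_False)
    qed
    then show "root_perm (\<sigma> \<otimes>\<^bsub>galois_group f\<^esub> \<tau>) = root_perm \<sigma> \<otimes>\<^bsub>alt_group 4\<^esub> root_perm \<tau>"
      by (simp add: alt_group_mult fun_eq_iff)
  qed
  moreover have "bij_betw root_perm (carrier (galois_group f)) (carrier (alt_group 4))"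
  proof (rule bij_betw_imageI)
    show "inj_on root_perm (carrier (galois_group f))"
    proof (rule inj_onI)
      fix \<sigma> \<tau> assume \<sigma>: "\<sigma> \<in> carrier (galois_group f)" and \<tau>: "\<tau> \<in> carrier (galois_group f)"
        and eq: "root_perm \<sigma> = root_perm \<tau>"
      have r12: "r 1 \<in> L" "r 2 \<in> L" "\<And>p. rp p (r 1) \<in> L" by (simp_all add: L_closed)
      have on_E: "\<rho> (E (r 1) (r 2) T) = E (r (root_perm \<rho> 1)) (r (root_perm \<rho> 2)) T"
        if \<rho>: "\<rho> \<in> carrier (galois_group f)" for \<rho> T
      proof -
        obtain a b c where "T = (a, b, c)" by (cases T)
        then show ?thesis using r12 root_perm(1)[OF \<rho>, of 1] root_perm(1)[OF \<rho>, of 2]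
          by (simp add: E_def power2_eq_square galois_hom[OF \<rho>] L_closed)
      qed
      have "\<sigma> z = \<tau> z" if "z \<in> L" for z
        using that on_E[OF \<sigma>] on_E[OF \<tau>] eq unfolding range_E[symmetric] by auto
      moreover have "\<sigma> \<in> extensional L" "\<tau> \<in> extensional L"
        using \<sigma> \<tau> unfolding galois_carrier Bij_def by blast+
      ultimately show "\<sigma> = \<tau>" by (intro extensionalityI)
    qed
    show "root_perm ` carrier (galois_group f) = carrier (alt_group 4)"
    proof
      show "root_perm ` carrier (galois_group f) \<subseteq> carrier (alt_group 4)"
        using root_perm by (auto simp: alt_group_carrier)
      show "carrier (alt_group 4) \<subseteq> root_perm ` carrier (galois_group f)"
      proof
        fix p assume "p \<in> carrier (alt_group 4)"
        then have p: "p permutes {1..4}" "evenperm p" by (simp_all add: alt_group_carrier)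
        obtain \<sigma> where \<sigma>: "\<sigma> \<in> carrier (galois_group f)" "\<sigma> (r 1) = r (p 1)" "\<sigma> (r 2) = r (p 2)"
          using automorphism_exists[OF p(1)] by blast
        have "p 1 \<in> {1..4}" "p 2 \<in> {1..4}"
          using permutes_in_image[OF p(1), of 1] permutes_in_image[OF p(1), of 2] by simp_all
        then have "root_perm \<sigma> 1 = p 1" "root_perm \<sigma> 2 = p 2"
          using perm_eq[OF \<sigma>(1) _ _ \<sigma>(2)] perm_eq[OF \<sigma>(1) _ _ \<sigma>(3)] by simp_all
        then have "root_perm \<sigma> = p"
          using even_permutations_eq root_perm(2,3)[OF \<sigma>(1)] p by blast
        then show "p \<in> root_perm ` carrier (galois_group f)" using \<sigma>(1) by blast
      qed
    qed
  qed
  ultimately show ?thesis unfolding is_iso_def iso_def by blast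
qed

end

section \<open>From a single parameter to infinitely many\<close>

lemma monogenic_with_group_A4:
  fixes k :: int
  assumes "k \<noteq> 0" "even k" "squarefree (27 * k ^ 4 + 1)"
  shows "monogenic_quartic [:27 * k ^ 4 + 1, 0, 0, 4 * k, 1:]"
    "galois_group [:27 * k ^ 4 + 1, 0, 0, 4 * k, 1:] \<cong> alt_group 4"
proof -
  define G :: "complex poly" where "G = [:of_int (27 * k ^ 4 + 1), 0, 0, of_int (4 * k), 1:]"
  have G: "Polynomial.degree G = 4" "Polynomial.coeff G 4 = 1" by (simp_all add: G_def numeral_eq_Suc)
  obtain s where s: "Polynomial.smult (Polynomial.lead_coeff G) (\<Prod>i<Polynomial.degree G. [:- s i, 1:]) = G"
    by (rule complex_poly_decompose')
  \<comment> \<open>The decomposition numbers the roots from 0, the locale from 1.\<close>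
  have "(\<Prod>i<4. [:- s i, 1:]) = (\<Prod>i\<in>{1..4}. [:- s (i - 1), 1:])"
    by (rule prod.reindex_bij_witness[of _ "\<lambda>i. i - 1" Suc]) auto
  then have "G = [:- s (1 - 1), 1:] * [:- s (2 - 1), 1:] * [:- s (3 - 1), 1:] * [:- s (4 - 1), 1:]"
    using s unfolding G prod_4 by (simp only: smult_1_left)
  then interpret A4_quartic k "\<lambda>i. s (i - 1)"
    by unfold_locales (use assms in \<open>simp_all only: G_def simp_thms\<close>)
  have "f = [:27 * k ^ 4 + 1, 0, 0, 4 * k, 1:]" by (simp add: f_def d_def)
  then show "monogenic_quartic [:27 * k ^ 4 + 1, 0, 0, 4 * k, 1:]"
    "galois_group [:27 * k ^ 4 + 1, 0, 0, 4 * k, 1:] \<cong> alt_group 4"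
    using monogenic_f galois_group_f by simp_all
qed

theorem corollary1p4:
  assumes "abc_conjecture_number_fields"
  shows "infinite {k :: int. k \<noteq> 0 \<and>
    (let a = 4 * k; d = 27 * k ^ 4 + 1;
         f = Polynomial.monom 1 4 + Polynomial.monom a 3 + [:d:]
     in monogenic_quartic f \<and> galois_group f \<cong> alt_group 4)}" (is "infinite ?K")
proof
  assume fin: "finite ?K"
  \<comment> \<open>Inserting 0 keeps \<open>Max\<close> away from the empty set.\<close>
  define B where "B = nat (Max (insert 0 ?K))"
  obtain k :: nat where k: "k > B" "even k" "squarefree (27 * k ^ 4 + 1)"
    using abc_squarefree_values[OF assms] by blast
  have sq: "squarefree (27 * int k ^ 4 + 1)"
  proof (rule squarefreeI)
    fix x :: int assume "x ^ 2 dvd 27 * int k ^ 4 + 1"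
    then have "nat \<bar>x ^ 2\<bar> dvd nat \<bar>27 * int k ^ 4 + 1\<bar>" by (simp only: nat_abs_dvd_iff abs_dvd_iff dvd_abs_iff) simp
    moreover have "nat \<bar>x ^ 2\<bar> = (nat \<bar>x\<bar>) ^ 2" by (simp add: nat_power_eq[symmetric])
    moreover have "nat \<bar>27 * int k ^ 4 + 1\<bar> = 27 * k ^ 4 + 1"
    proof -
      have "27 * int k ^ 4 + 1 = int (27 * k ^ 4 + 1)" by simp
      then show ?thesis by (simp only: abs_of_nat nat_int)
    qed
    ultimately have "nat \<bar>x\<bar> dvd 1" using squarefreeD[OF k(3), of "nat \<bar>x\<bar>"] by simp
    then show "x dvd 1" by simp
  qed
  have poly: "Polynomial.monom 1 4 + Polynomial.monom (4 * int k) 3 + [:27 * int k ^ 4 + 1:]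
      = [:27 * int k ^ 4 + 1, 0, 0, 4 * int k, 1:]"
    by (rule poly_eqI) (auto simp: coeff_pCons numeral_eq_Suc split: nat.splits)
  have "int k \<noteq> 0" using k(1) by simp
  then have "int k \<in> ?K" unfolding mem_Collect_eq Let_def poly
    using monogenic_with_group_A4[OF _ _ sq] k(2) by simp
  then have "int k \<le> Max (insert 0 ?K)" using fin by (intro Max_ge) auto
  then show False using k(1) unfolding B_def by linarith
qed

end
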